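(* In the setting described in the context, let $Q<N^{1/2}$, fix $\beta$ with $|\beta|<\frac{2}{QN^{1/2}}$, and let $P_{Q,\beta}=\{\theta=\frac aq+\beta:\ q\sim Q,\ (a,q)=1\}$ (so $|P_{Q,\beta}|\asymp Q^2$). Then for every $\varepsilon>0$, $$\sum_{\theta\in P_{Q,\beta}}|S_N(\theta)|\ll_\varepsilon N^{\delta+1+\varepsilon}Q\left(Q^{-1/2}+N^{-\sigma}+N^{-\sigma/2-1/2}Q\right).$$
   Context: Let $\Gamma<\mathrm{SL}(2,\mathbb{Z})$ be a finitely generated free group with no parabolic elements, fixed with a free generating set, and let $\delta>5/6$ be the Hausdorff dimension of its limit set. Fix primitive $v_0,w_0\in\mathbb{Z}^2$ and a parameter $0<\sigma<1/4$. Let $\|\cdot\|$ be the Frobenius norm and $e(x)=e^{2\pi i x}$. For large $N$: let $\Xi\subset\Gamma$ be a set of elements $\xi$ with $\|\xi\|<N^{1/2}$ whose reduced words in the generators all end with the same letter, with $|\Xi|\gg N^{\delta}$; let $\Pi\subset\Gamma$ be a set of elements $\varpi$ with $\|\varpi\|<N^{1/2-\sigma}$ whose reduced words all start with the same letter, not the inverse of the last letter of the elements of $\Xi$, with $|\Pi|\gg N^{\delta(1-2\sigma)}$. Define the 1-periodic function $S_N(\theta)=\sum_{\xi\in\Xi}\sum_{\varpi\in\Pi}\sum_{\gamma\in\Gamma,\|\gamma\|<N^{\sigma}}e(\langle v_0\gamma\xi\varpi,w_0\rangle\theta)$. The notation $q\sim Q$ means $\frac12Q\le q<Q$; in $P_{Q,\beta}$,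 $a$ ranges over residues mod $q$. *)

theory Defs
  imports "HOL-Analysis.Analysis" "HOL-Algebra.Generated_Groups"
begin

section \<open>Free subgroups and reduced words\<close>

text \<open>A letter \<open>(x, True)\<close> stands for the generator \<open>x\<close>, and \<open>(x, False)\<close> for its inverse.\<close>

type_synonym 'a letter = "'a \<times> bool"

definition inv_letter :: "'a letter \<Rightarrow> 'a letter" where
  "inv_letter l = (fst l, \<not> snd l)"

definition reduced_words :: "'a set \<Rightarrow> 'a letter list set" where
  "reduced_words X =
     {w. set w \<subseteq> X \<times> UNIV \<and> (\<forall>i. Suc i < length w \<longrightarrow> w ! Suc i \<noteq> inv_letter (w ! i))}"

definition letter_val :: "('a, 'b) monoid_scheme \<Rightarrow> 'a letter \<Rightarrow> 'a" where
  "letter_val G l = (if snd l then fst l else inv\<^bsub>G\<^esub> (fst l))"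

definition word_val :: "('a, 'b) monoid_scheme \<Rightarrow> 'a letter list \<Rightarrow> 'a" where
  "word_val G w = foldr (\<lambda>l g. letter_val G l \<otimes>\<^bsub>G\<^esub> g) w \<one>\<^bsub>G\<^esub>"

definition free_generating_set :: "('a, 'b) monoid_scheme \<Rightarrow> 'a set \<Rightarrow> 'a set \<Rightarrow> bool" where
  "free_generating_set G H X \<longleftrightarrow>
     X \<subseteq> carrier G \<and> H = generate G X \<and> inj_on (word_val G) (reduced_words X)"

text \<open>Meaningful when \<open>X\<close> freely generates a subgroup of \<open>G\<close> containing \<open>g\<close>.\<close>

definition reduced_word :: "('a, 'b) monoid_scheme \<Rightarrow> 'a set \<Rightarrow> 'a \<Rightarrow> 'a letter list" where
  "reduced_word G X = the_inv_into (reduced_words X) (word_val G)"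


section \<open>The group \<open>SL(2,\<int>)\<close>\<close>

definition SL2Z :: "(int^2^2) monoid" where
  "SL2Z = \<lparr>carrier = {A. det A = 1}, mult = (**), one = mat 1\<rparr>"

lemma group_SL2Z: "group SL2Z"
proof (rule groupI)
  fix A assume A: "A \<in> carrier SL2Z"
  define B :: "int^2^2" where "B = vector [vector [A$2$2, - A$1$2], vector [- A$2$1, A$1$1]]"
  have "B ** A = mat 1" "det B = 1"
    using A by (auto simp: B_def SL2Z_def det_2 matrix_matrix_mult_def mat_def vec_eq_iff
        forall_2 sum_2 algebra_simps)
  then show "\<exists>B\<in>carrier SL2Z. B \<otimes>\<^bsub>SL2Z\<^esub> A = \<one>\<^bsub>SL2Z\<^esub>"
    by (auto simp: SL2Z_def)
qed (auto simp: SL2Z_def det_mul matrix_mul_assoc)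

definition frobenius_norm :: "int^2^2 \<Rightarrow> real" where
  "frobenius_norm A = sqrt (\<Sum>i\<in>UNIV. \<Sum>j\<in>UNIV. (real_of_int (A $ i $ j))\<^sup>2)"

definition parabolic :: "int^2^2 \<Rightarrow> bool" where
  "parabolic A \<longleftrightarrow> A \<noteq> mat 1 \<and> A \<noteq> - mat 1 \<and> \<bar>trace A\<bar> = 2"

definition primitive :: "int^2 \<Rightarrow> bool" where
  "primitive v \<longleftrightarrow> coprime (v $ 1) (v $ 2)"

definition pairing :: "int^2 \<Rightarrow> int^2 \<Rightarrow> int" where
  "pairing v w = (\<Sum>i\<in>UNIV. v $ i * w $ i)"


section \<open>Limit set and Hausdorff dimension\<close>

definition act :: "int^2^2 \<Rightarrow> complex \<Rightarrow> complex" where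
  "act A = moebius (of_int (A$1$1)) (of_int (A$1$2)) (of_int (A$2$1)) (of_int (A$2$2))"

definition cayley :: "complex \<Rightarrow> complex" where
  "cayley = moebius 1 (- \<i>) 1 \<i>"

text \<open>
  The limit set is the set of boundary points at which the orbit of the base point \<open>\<i>\<close>
  of the upper half plane accumulates. It is taken in the unit disc model, so that the boundary
  \<open>\<real> \<union> {\<infinity>}\<close> becomes the unit circle with its Euclidean metric; away from \<open>\<infinity>\<close> the Cayley map is
  locally bi-Lipschitz on \<open>\<real>\<close>, so the Hausdorff dimension is the same as on the real line.
\<close>

definition limit_set :: "(int^2^2) set \<Rightarrow> complex set" where
  "limit_set \<Gamma> = {\<zeta> \<in> sphere 0 1. \<zeta> islimpt (\<lambda>g. cayley (act g \<i>)) ` \<Gamma>}"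

definition hausdorff_premeasure :: "real \<Rightarrow> real \<Rightarrow> 'a::metric_space set \<Rightarrow> ennreal" where
  "hausdorff_premeasure s r A =
     (INF U \<in> {U :: nat \<Rightarrow> 'a set. A \<subseteq> (\<Union>n. U n) \<and> (\<forall>n. bounded (U n) \<and> diameter (U n) \<le> r)}.
        \<Sum>n. ennreal (diameter (U n) powr s))"

definition hausdorff_measure :: "real \<Rightarrow> 'a::metric_space set \<Rightarrow> ennreal" where
  "hausdorff_measure s A = (SUP r\<in>{0<..}. hausdorff_premeasure s r A)"

text \<open>
  Only exponents \<open>s > 0\<close> are used, since \<open>0 powr 0 = 0\<close> makes the case \<open>s = 0\<close> above
  differ from counting measure.
\<close>

definition hausdorff_dim :: "'a::metric_space set \<Rightarrow> ereal" where
  "hausdorff_dim A = (INF s \<in> {s::real. 0 < s \<and> hausdorff_measure s A = 0}. ereal s)"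


section \<open>The exponential sum\<close>

definition unit_exp :: "real \<Rightarrow> complex" where
  "unit_exp x = exp (2 * of_real pi * \<i> * of_real x)"

definition exp_sum ::
  "(int^2^2) set \<Rightarrow> int^2 \<Rightarrow> int^2 \<Rightarrow> real \<Rightarrow> (int^2^2) set \<Rightarrow> (int^2^2) set \<Rightarrow> real \<Rightarrow> real \<Rightarrow> complex"
  where
  "exp_sum \<Gamma> v\<^sub>0 w\<^sub>0 \<sigma> \<Xi> \<Omega> N \<theta> =
     (\<Sum>\<xi>\<in>\<Xi>. \<Sum>\<omega>\<in>\<Omega>. \<Sum>\<gamma> | \<gamma> \<in> \<Gamma> \<and> frobenius_norm \<gamma> < N powr \<sigma>.
        unit_exp (of_int (pairing (v\<^sub>0 v* (\<gamma> ** \<xi> ** \<omega>)) w\<^sub>0) * \<theta>))"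

definition points :: "real \<Rightarrow> real \<Rightarrow> real set" where
  "points Q \<beta> = {real a / real q + \<beta> | a q :: nat. Q / 2 \<le> real q \<and> real q < Q \<and> a < q \<and> coprime a q}"

end

theory Submission
  imports Defs "HOL-Computational_Algebra.Primes" "HOL-Real_Asymp.Real_Asymp"
begin

text \<open>
  Write \<open>\<langle>v\<^sub>0 \<gamma> \<xi> \<omega>, w\<^sub>0\<rangle> = \<langle>x, y\<rangle>\<close> with \<open>x = v\<^sub>0 \<gamma> \<xi>\<close> and \<open>y = \<omega> w\<^sub>0\<close>, insert unimodular weights
  for the absolute values, and apply Cauchy--Schwarz in \<open>x\<close>. One factor is the second moment of the
  number of ways to write an element of the group as \<open>\<gamma> \<xi>\<close>. For the other, \<open>x\<close> is extended to all
  short integer vectors, and a large sieve inequality reduces it to the number of pairs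
  \<open>(y, a/q)\<close>, \<open>(y', a'/q')\<close> for which \<open>y (a/q + \<beta>)\<close> and \<open>y' (a'/q' + \<beta>)\<close> nearly agree modulo 1;
  such a pair amounts to a congruence \<open>y a q' \<equiv> y' a' q + z\<close> modulo \<open>q q'\<close> with a short vector \<open>z\<close>, and
  the divisor bound counts these.

  The geometric input is that the group is quasiconvex. A sequence of generators leading from \<open>1\<close> to
  \<open>g\<close> has to cross every Farey edge which separates \<open>\<i>\<close> from its image under \<open>g\<close>, so that all these
  edges lie close to the orbit; in a long cusp excursion of the geodesic two of them would then
  differ by a parabolic element of the group. Quasiconvexity makes every limit point conical, so a
  cover of the limit set by balls of radii \<open>\<rho>\<^sub>j\<close> with \<open>\<Sum> \<rho>\<^sub>j\<^sup>s\<close> small yields the recursion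
  \<open>N(T) \<le> N\<^sub>0 + \<Sum> N(C \<rho>\<^sub>j\<^sup>1\<^sup>/\<^sup>2 T)\<close> for the number \<open>N(T)\<close> of group elements of norm less
  than \<open>T\<close>, and hence \<open>N(T) = O(T\<^sup>2\<^sup>s)\<close> for every \<open>s\<close> above the Hausdorff dimension.
\<close>

section \<open>Integer matrices of determinant one\<close>

text \<open>One dictionary translates the geometry: \<open>frob_sq g\<close> is 2 cosh d, with d the
  distance from i to its image under g, so \<open>frobenius_norm g\<close> is about exp(d/2). A
  parameter t between 1 and |g| therefore runs along the geodesic, a boundary ball of radius \<rho>
  corresponds to norms of order \<rho>^(-1/2), and a boundary exponent s becomes the growth exponent
  2s. The absence of parabolic elements enters twice: it excludes long cusp excursions, and it makes
  g -> v0 g and g -> g w0 injective on the group, since an element fixing a nonzero vector has trace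
  2. The terms of the estimate belong to different near pairs. Pairs with z = 0 and y' not parallel
  to y account for Q^(-1/2), generic pairs for N^(-\<sigma>), pairs with y' = y or y' = -y for the
  last term; the remaining contributions are absorbed by the first term. In the pair count one
  factor |Y| is bounded by the growth of the group, the other by the number of integer points in a
  box. The excess of s over \<delta> is paid for by \<epsilon>.\<close>

definition mat2 :: "int \<Rightarrow> int \<Rightarrow> int \<Rightarrow> int \<Rightarrow> int^2^2" where
  "mat2 a b c d = vector [vector [a, b], vector [c, d]]"

definition adj :: "int^2^2 \<Rightarrow> int^2^2" where
  "adj A = mat2 (A$2$2) (- A$1$2) (- A$2$1) (A$1$1)"

definition frob_sq :: "int^2^2 \<Rightarrow> int" where
  "frob_sq A = (A$1$1)\<^sup>2 + (A$1$2)\<^sup>2 + (A$2$1)\<^sup>2 + (A$2$2)\<^sup>2"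

definition row_dot :: "int^2^2 \<Rightarrow> int" where
  "row_dot A = A$1$1 * A$2$1 + A$1$2 * A$2$2"

definition row1_sq :: "int^2^2 \<Rightarrow> int" where
  "row1_sq A = (A$1$1)\<^sup>2 + (A$1$2)\<^sup>2"

definition row2_sq :: "int^2^2 \<Rightarrow> int" where
  "row2_sq A = (A$2$1)\<^sup>2 + (A$2$2)\<^sup>2"

lemma mat2_nth [simp]:
  "mat2 a b c d $ 1 $ 1 = a" "mat2 a b c d $ 1 $ 2 = b"
  "mat2 a b c d $ 2 $ 1 = c" "mat2 a b c d $ 2 $ 2 = d"
  by (simp_all add: mat2_def)

lemma mult_nth:
  fixes A B :: "int^2^2"
  shows "(A ** B) $ i $ j = A$i$1 * B$1$j + A$i$2 * B$2$j"
  by (simp add: matrix_matrix_mult_def sum_2)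

lemma mat2_eqI:
  fixes A B :: "int^2^2"
  assumes "A$1$1 = B$1$1" "A$1$2 = B$1$2" "A$2$1 = B$2$1" "A$2$2 = B$2$2"
  shows "A = B"
  using assms by (simp add: vec_eq_iff forall_2)

lemma mat1_nth [simp]:
  "(mat 1 :: int^2^2) $ 1 $ 1 = 1" "(mat 1 :: int^2^2) $ 1 $ 2 = 0"
  "(mat 1 :: int^2^2) $ 2 $ 1 = 0" "(mat 1 :: int^2^2) $ 2 $ 2 = 1"
  by (simp_all add: mat_def)

lemma frob_sq_rows: "frob_sq A = row1_sq A + row2_sq A"
  by (simp add: frob_sq_def row1_sq_def row2_sq_def)

lemma frobenius_norm_eq: "frobenius_norm A = sqrt (real_of_int (frob_sq A))"
  by (simp add: frobenius_norm_def frob_sq_def sum_2 add.assoc)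

lemma frob_sq_nonneg [simp]: "0 \<le> frob_sq A"
  by (simp add: frob_sq_def)

lemma frobenius_norm_nonneg [simp]: "0 \<le> frobenius_norm A"
  by (simp add: frobenius_norm_eq)

lemma frobenius_norm_sq: "(frobenius_norm A)\<^sup>2 = real_of_int (frob_sq A)"
  by (simp add: frobenius_norm_eq)

lemma adj_mult: "det A = 1 \<Longrightarrow> adj A ** A = mat 1" "det A = 1 \<Longrightarrow> A ** adj A = mat 1"
  by (rule mat2_eqI; simp add: mult_nth adj_def det_2 algebra_simps)+

lemma det_adj [simp]: "det (adj A) = det A"
  by (simp add: adj_def det_2 algebra_simps)

lemma frob_sq_adj [simp]: "frob_sq (adj A) = frob_sq A"
  by (simp add: adj_def frob_sq_def)

lemma frobenius_norm_adj [simp]: "frobenius_norm (adj A) = frobenius_norm A"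
  by (simp add: frobenius_norm_eq)

lemma adj_adj [simp]: "adj (adj A) = A"
  by (rule mat2_eqI) (simp_all add: adj_def)

lemma adj_mult_distrib: "adj (A ** B) = adj B ** adj A"
  by (rule mat2_eqI; simp add: mult_nth adj_def algebra_simps)

lemma adj_mult_cancel:
  assumes "det A = 1"
  shows "adj A ** (A ** B) = B" "A ** (adj A ** B) = B" "(B ** A) ** adj A = B" "(B ** adj A) ** A = B"
  using assms by (simp_all add: matrix_mul_assoc adj_mult) (simp_all add: adj_mult flip: matrix_mul_assoc)

lemma cauchy_two:
  fixes a b c d :: int
  shows "(a * b + c * d)\<^sup>2 \<le> (a\<^sup>2 + c\<^sup>2) * (b\<^sup>2 + d\<^sup>2)"
proof -
  have "(a\<^sup>2 + c\<^sup>2) * (b\<^sup>2 + d\<^sup>2) - (a * b + c * d)\<^sup>2 = (a * d - c * b)\<^sup>2"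
    by (simp add: power2_eq_square algebra_simps)
  then show ?thesis
    by (metis diff_ge_0_iff_ge zero_le_power2)
qed

lemma frob_sq_mult: "frob_sq (A ** B) \<le> frob_sq A * frob_sq B"
proof -
  have "frob_sq (A ** B) \<le> ((A$1$1)\<^sup>2 + (A$1$2)\<^sup>2) * ((B$1$1)\<^sup>2 + (B$2$1)\<^sup>2) + ((A$1$1)\<^sup>2 + (A$1$2)\<^sup>2) * ((B$1$2)\<^sup>2 + (B$2$2)\<^sup>2)
     + ((A$2$1)\<^sup>2 + (A$2$2)\<^sup>2) * ((B$1$1)\<^sup>2 + (B$2$1)\<^sup>2) + ((A$2$1)\<^sup>2 + (A$2$2)\<^sup>2) * ((B$1$2)\<^sup>2 + (B$2$2)\<^sup>2)"
    unfolding frob_sq_def mult_nth by (intro add_mono cauchy_two)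
  also have "\<dots> = frob_sq A * frob_sq B"
    by (simp add: frob_sq_def algebra_simps)
  finally show ?thesis .
qed

lemma frobenius_norm_mult: "frobenius_norm (A ** B) \<le> frobenius_norm A * frobenius_norm B"
  unfolding frobenius_norm_eq real_sqrt_mult[symmetric] of_int_mult[symmetric]
  using frob_sq_mult[of A B] by (simp only: real_sqrt_le_iff of_int_le_iff)

lemma frob_sq_ge_2:
  assumes "det A = 1" shows "2 \<le> frob_sq A"
proof -
  have "frob_sq A - 2 = (A$1$1 - A$2$2)\<^sup>2 + (A$1$2 + A$2$1)\<^sup>2"
    using assms by (simp add: frob_sq_def det_2 power2_eq_square algebra_simps)
  then show ?thesis
    by (metis add_nonneg_nonneg diff_ge_0_iff_ge zero_le_power2)
qed

lemma frobenius_norm_gt_1: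
  assumes "det A = 1" shows "1 < frobenius_norm A"
proof -
  have "2 \<le> real_of_int (frob_sq A)"
    using frob_sq_ge_2[OF assms] by linarith
  then show ?thesis unfolding frobenius_norm_eq by (simp add: real_less_rsqrt)
qed

lemma frobenius_norm_pos: "det A = 1 \<Longrightarrow> 0 < frobenius_norm A"
  using frobenius_norm_gt_1[of A] by linarith

lemma frobenius_norm_mult_left:
  assumes "det A = 1"
  shows "frobenius_norm B \<le> frobenius_norm A * frobenius_norm (A ** B)"
proof -
  have "frobenius_norm (adj A ** (A ** B)) \<le> frobenius_norm (adj A) * frobenius_norm (A ** B)"
    by (rule frobenius_norm_mult)
  then show ?thesis using adj_mult_cancel[OF assms] by simp
qed

lemma finite_frob_sq_le: "finite {A. frob_sq A \<le> n}"
proof (rule finite_subset)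
  let ?I = "{-n..n}"
  show "{A. frob_sq A \<le> n} \<subseteq> (\<lambda>(a,b,c,d). mat2 a b c d) ` (?I \<times> ?I \<times> ?I \<times> ?I)"
  proof
    fix A assume A: "A \<in> {A. frob_sq A \<le> n}"
    have sq: "\<bar>x\<bar> \<le> x\<^sup>2" for x :: int
      using self_le_power[of "\<bar>x\<bar>" 2] by (cases "x = 0") auto
    have "\<bar>A$i$j\<bar> \<le> n" for i j
    proof -
      have "(A$i$j)\<^sup>2 \<le> frob_sq A"
        using exhaust_2[of i] exhaust_2[of j] by (auto simp: frob_sq_def)
      then show ?thesis using sq[of "A$i$j"] A by simp
    qed
    then have "\<forall>i j. A$i$j \<in> ?I" by (auto simp: abs_le_iff minus_le_iff)
    moreover have "A = mat2 (A$1$1) (A$1$2) (A$2$1) (A$2$2)"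
      by (rule mat2_eqI) simp_all
    ultimately show "A \<in> (\<lambda>(a,b,c,d). mat2 a b c d) ` (?I \<times> ?I \<times> ?I \<times> ?I)"
      by (intro image_eqI[of _ _ "(A$1$1, A$1$2, A$2$1, A$2$2)"]) auto
  qed
qed simp

lemma finite_frobenius_norm_le: "finite {A. frobenius_norm A \<le> T}"
proof (rule finite_subset[OF _ finite_frob_sq_le[of "\<lfloor>T\<^sup>2\<rfloor>"]], clarify)
  fix A assume A: "frobenius_norm A \<le> T"
  then have "(frobenius_norm A)\<^sup>2 \<le> T\<^sup>2"
    by (intro power_mono) auto
  then show "frob_sq A \<le> \<lfloor>T\<^sup>2\<rfloor>"
    unfolding frobenius_norm_sq by linarith
qed

lemma finite_frobenius_norm_less: "finite {A. frobenius_norm A < T}"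
  by (rule finite_subset[OF _ finite_frobenius_norm_le[of T]]) auto

lemma row_gram: "det A = 1 \<Longrightarrow> row1_sq A * row2_sq A = (row_dot A)\<^sup>2 + 1"
proof -
  assume "det A = 1"
  then have "(A$1$1 * A$2$2 - A$1$2 * A$2$1)\<^sup>2 = 1" by (simp add: det_2)
  then show ?thesis
    by (simp add: row1_sq_def row2_sq_def row_dot_def power2_eq_square algebra_simps)
qed

lemma row1_sq_pos: "det A = 1 \<Longrightarrow> 1 \<le> row1_sq A"
  and row2_sq_pos: "det A = 1 \<Longrightarrow> 1 \<le> row2_sq A"
proof -
  assume "det A = 1"
  then have "row1_sq A * row2_sq A > 0"
    using row_gram[of A] by (smt (verit) zero_le_power2)
  moreover have "row1_sq A \<ge> 0" "row2_sq A \<ge> 0" by (auto simp: row1_sq_def row2_sq_def)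
  ultimately show "1 \<le> row1_sq A" "1 \<le> row2_sq A"
    by (smt (verit) mult_not_zero)+
qed

text \<open>For rows A1, A2 and A1' the vector A1 turned by a right angle, |A1|^2 A2 = (A1 . A2) A1
  + A1' when the determinant is 1. Applying X and pairing with A1 X gives the identity; the last
  summand is the error, of size at most |A1|^2 |X|^2.\<close>

lemma row_dot_mult_ident:
  assumes "det A = 1"
  shows "row1_sq A * row_dot (A ** X) =
    row_dot A * row1_sq (A ** X) +
    ((A ** X)$1$1 * (- A$1$2 * X$1$1 + A$1$1 * X$2$1) + (A ** X)$1$2 * (- A$1$2 * X$1$2 + A$1$1 * X$2$2))"
    (is "_ = _ + ?P")
proof -
  have "row1_sq A * row_dot (A ** X) - row_dot A * row1_sq (A ** X) = (A$1$1 * A$2$2 - A$1$2 * A$2$1) * ?P"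
    by (simp add: row1_sq_def row_dot_def mult_nth power2_eq_square algebra_simps)
  then show ?thesis using assms by (simp add: det_2)
qed

lemma row1_sq_mult: "row1_sq (A ** X) \<le> row1_sq A * frob_sq X"
proof -
  have "row1_sq (A ** X) \<le> ((A$1$1)\<^sup>2 + (A$1$2)\<^sup>2) * ((X$1$1)\<^sup>2 + (X$2$1)\<^sup>2) + ((A$1$1)\<^sup>2 + (A$1$2)\<^sup>2) * ((X$1$2)\<^sup>2 + (X$2$2)\<^sup>2)"
    unfolding row1_sq_def mult_nth by (intro add_mono cauchy_two)
  also have "\<dots> = row1_sq A * frob_sq X"
    by (simp add: frob_sq_def row1_sq_def algebra_simps)
  finally show ?thesis .
qed

text \<open>Since \<open>row_dot A\<close> has the sign of the real part of \<open>act A \<i>\<close>, this says that only finitely many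
  Farey edges separate \<open>\<i>\<close> from its image under \<open>X\<close>.\<close>

lemma row_dot_sign_change:
  assumes A: "det A = 1" and X: "det X = 1" and ch: "(0 \<le> row_dot A) \<noteq> (0 \<le> row_dot (A ** X))"
  shows "frob_sq A \<le> 2 * ((frob_sq X)^4 + 1)"
proof -
  define B where "B = A ** X"
  define n where "n = frob_sq X"
  define p where "p = row1_sq A"
  define P where "P = B$1$1 * (- A$1$2 * X$1$1 + A$1$1 * X$2$1) + B$1$2 * (- A$1$2 * X$1$2 + A$1$1 * X$2$2)"
  have n: "2 \<le> n" using frob_sq_ge_2[OF X] by (simp add: n_def)
  have p: "1 \<le> p" using row1_sq_pos[OF A] by (simp add: p_def)
  have id: "p * row_dot B = row_dot A * row1_sq B + P"
    using row_dot_mult_ident[OF A, of X] by (simp add: B_def p_def P_def)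
  have up: "row1_sq B \<le> p * n"
    unfolding B_def p_def n_def by (rule row1_sq_mult)
  have lo: "p \<le> row1_sq B * n"
    using row1_sq_mult[of B "adj X"] adj_mult_cancel(3)[OF X, of A] by (simp add: B_def p_def n_def)
  have "P\<^sup>2 \<le> row1_sq B * ((- A$1$2 * X$1$1 + A$1$1 * X$2$1)\<^sup>2 + (- A$1$2 * X$1$2 + A$1$1 * X$2$2)\<^sup>2)"
    unfolding P_def row1_sq_def by (rule cauchy_two)
  also have "(- A$1$2 * X$1$1 + A$1$1 * X$2$1)\<^sup>2 + (- A$1$2 * X$1$2 + A$1$1 * X$2$2)\<^sup>2
      = row1_sq (mat2 (- A$1$2) (A$1$1) 0 0 ** X)"
    by (simp add: row1_sq_def mult_nth)
  also have "\<dots> \<le> p * n"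
    using row1_sq_mult[of "mat2 (- A$1$2) (A$1$1) 0 0" X] by (simp add: row1_sq_def p_def n_def add.commute)
  also have "row1_sq B * (p * n) \<le> (p * n) * (p * n)"
    using up p n by (intro mult_right_mono) auto
  finally have "P\<^sup>2 \<le> (p * n)\<^sup>2"
    by (auto simp: power2_eq_square row1_sq_def mult_left_mono)
  then have P: "\<bar>P\<bar> \<le> p * n"
    using p n by (metis abs_le_square_iff abs_of_nonneg mult_nonneg_nonneg order_trans zero_le_one zero_le_numeral)
  \<comment> \<open>\<open>row_dot A\<close> and \<open>row_dot B\<close> have opposite signs and
    positive weights, so the two terms in \<open>id\<close> cannot balance each other and
    \<open>P\<close> dominates both.\<close>
  have *: "\<bar>row_dot A\<bar> * row1_sq B \<le> \<bar>P\<bar>"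
  proof (cases "0 \<le> row_dot A")
    case True
    then have "p * row_dot B < 0" using ch p by (auto simp: B_def mult_pos_neg)
    then show ?thesis using id True by simp
  next
    case False
    then have "p * row_dot B \<ge> 0" using ch p by (auto simp: B_def)
    then have "- row_dot A * row1_sq B \<le> P" using id by simp
    then show ?thesis using False by simp
  qed
  have "\<bar>row_dot A\<bar> * p \<le> \<bar>row_dot A\<bar> * (row1_sq B * n)"
    using lo by (intro mult_left_mono) auto
  also have "\<dots> \<le> p * n * n"
    using mult_right_mono[OF order_trans[OF * P], of n] n by (simp add: mult.assoc)
  finally have "p * \<bar>row_dot A\<bar> \<le> p * (n * n)"
    by (simp add: mult.commute mult.left_commute)
  then have rd: "\<bar>row_dot A\<bar> \<le> n * n" using p by simp
  then have "(row_dot A)\<^sup>2 \<le> (n * n)\<^sup>2"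
    by (metis abs_le_square_iff abs_of_nonneg zero_le_square)
  then have g: "row1_sq A * row2_sq A \<le> n ^ 4 + 1"
    using row_gram[OF A] by (simp add: power2_eq_square power4_eq_xxxx mult.assoc)
  have q: "1 \<le> row2_sq A" by (rule row2_sq_pos[OF A])
  have "row1_sq A \<le> row1_sq A * row2_sq A" "row2_sq A \<le> row1_sq A * row2_sq A"
    using p q mult_left_mono[of 1 "row2_sq A" "row1_sq A"] mult_right_mono[of 1 "row1_sq A" "row2_sq A"]
    by (simp_all add: p_def)
  then show ?thesis using g by (simp add: frob_sq_rows[of A] n_def)
qed

section \<open>Quasiconvexity of the orbit\<close>

text \<open>Besides shears and the quarter turn, the two matrices of order three occur: they permute
  the superbase B1, B2, B3 = -B1 - B2 cyclically, giving the rows (B2, B3) and (B3, B1).\<close>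

lemma row_mat2:
  "row1_sq (mat2 1 0 k 1 ** B) = row1_sq B"
  "row2_sq (mat2 1 0 k 1 ** B) = row2_sq B + 2 * k * row_dot B + k\<^sup>2 * row1_sq B"
  "row_dot (mat2 1 0 k 1 ** B) = row_dot B + k * row1_sq B"
  "row2_sq (mat2 1 k 0 1 ** B) = row2_sq B"
  "row1_sq (mat2 1 k 0 1 ** B) = row1_sq B + 2 * k * row_dot B + k\<^sup>2 * row2_sq B"
  "row1_sq (mat2 0 1 (-1) 0 ** B) = row2_sq B"
  "row2_sq (mat2 0 1 (-1) 0 ** B) = row1_sq B"
  "row_dot (mat2 0 1 (-1) 0 ** B) = - row_dot B"
  "row_dot (mat2 0 1 (-1) (-1) ** B) = - row_dot B - row2_sq B"
  "row_dot (mat2 (-1) (-1) 1 0 ** B) = - row_dot B - row1_sq B"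
  "frob_sq (mat2 0 1 (-1) (-1) ** B) = row1_sq B + 2 * row2_sq B + 2 * row_dot B"
  "frob_sq (mat2 (-1) (-1) 1 0 ** B) = 2 * row1_sq B + row2_sq B + 2 * row_dot B"
  by (simp_all add: row1_sq_def row2_sq_def row_dot_def frob_sq_def mult_nth power2_eq_square algebra_simps)

lemma det_mat2: "det (mat2 a b c d) = a * d - b * c"
  by (simp add: det_2)

text \<open>After z -> -1/z the images of i under B and B g have real part - \<open>row_dot\<close>
  / \<open>row1_sq\<close> and imaginary part 1 / \<open>row1_sq\<close>. The identity is the
  formula for cosh of their distance with denominators cleared; \<open>frob_sq g\<close> is twice
  that cosh.\<close>

lemma gram_change:
  assumes B: "det B = 1" and g: "det g = 1"
  shows "(row_dot B * row1_sq (B ** g) - row_dot (B ** g) * row1_sq B)\<^sup>2 + (row1_sq B)\<^sup>2 + (row1_sq (B ** g))\<^sup>2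
     = frob_sq g * row1_sq B * row1_sq (B ** g)" (is "?L = ?R")
proof -
  define a b c d where d: "a = B$1$1" "b = B$1$2" "c = B$2$1" "d = B$2$2"
  define x y z w where x: "x = g$1$1" "y = g$1$2" "z = g$2$1" "w = g$2$2"
  have e1: "a * d - b * c = 1" using B by (simp add: det_2 d)
  have e2: "x * w - y * z = 1" using g by (simp add: det_2 x)
  show ?thesis
    unfolding row1_sq_def row2_sq_def row_dot_def frob_sq_def mult_nth d[symmetric] x[symmetric]
    using e1 e2 by algebra
qed

text \<open>The form |v|^2 + s |v g|^2 has the matrix 1 + s g g^T, of determinant 1 + s |g|^2 + s^2.
  The left side is the determinant of its Gram matrix in the unimodular basis of the rows of
  B.\<close>

lemma frob_sq_form:
  fixes s :: real
  assumes B: "det B = 1" and g: "det g = 1"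
  shows "(real_of_int (row1_sq B) + s * row1_sq (B ** g)) * (row2_sq B + s * row2_sq (B ** g))
     - (row_dot B + s * row_dot (B ** g))\<^sup>2 = 1 + s * frob_sq g + s\<^sup>2"
proof -
  define a b c d where d: "a = B$1$1" "b = B$1$2" "c = B$2$1" "d = B$2$2"
  define x y z w where x: "x = g$1$1" "y = g$1$2" "z = g$2$1" "w = g$2$2"
  have e1: "a * d - b * c = 1" using B by (simp add: det_2 d)
  have e2: "x * w - y * z = 1" using g by (simp add: det_2 x)
  have mid: "row1_sq B * row2_sq (B ** g) + row2_sq B * row1_sq (B ** g) - 2 * row_dot B * row_dot (B ** g) = frob_sq g"
    unfolding row1_sq_def row2_sq_def row_dot_def frob_sq_def mult_nth d[symmetric] x[symmetric]
    using e1 e2 by algebra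
  have "det (B ** g) = 1" using B g by (simp add: det_mul)
  note r = row_gram[OF B] row_gram[OF this]
  have r1: "real_of_int (row1_sq B) * row2_sq B = (real_of_int (row_dot B))\<^sup>2 + 1"
    using arg_cong[OF r(1), of real_of_int] by simp
  have r2: "real_of_int (row1_sq (B ** g)) * row2_sq (B ** g) = (real_of_int (row_dot (B ** g)))\<^sup>2 + 1"
    using arg_cong[OF r(2), of real_of_int] by simp
  have r3: "real_of_int (row1_sq B) * row2_sq (B ** g) + real_of_int (row2_sq B) * row1_sq (B ** g)
     - 2 * real_of_int (row_dot B) * row_dot (B ** g) = frob_sq g"
    using arg_cong[OF mid, of real_of_int] by simp
  have "(real_of_int (row1_sq B) + s * row1_sq (B ** g)) * (row2_sq B + s * row2_sq (B ** g))
     - (row_dot B + s * row_dot (B ** g))\<^sup>2 = (real_of_int (row1_sq B) * row2_sq B - (real_of_int (row_dot B))\<^sup>2)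
     + s * (real_of_int (row1_sq B) * row2_sq (B ** g) + real_of_int (row2_sq B) * row1_sq (B ** g)
     - 2 * real_of_int (row_dot B) * row_dot (B ** g))
     + s\<^sup>2 * (real_of_int (row1_sq (B ** g)) * row2_sq (B ** g) - (real_of_int (row_dot (B ** g)))\<^sup>2)"
    by (simp add: power2_eq_square algebra_simps)
  then show ?thesis unfolding r1 r2 r3 by simp
qed

text \<open>The hypotheses say that B1, B2 and B3 = -B1 - B2 form an obtuse superbase. Its Selling
  parameters \<open>a\<close>, \<open>b\<close>, \<open>c\<close> are nonnegative integers with ab +
  bc + ca = 1, so none exceeds 1, and \<open>frob_sq B\<close> is 2a + b + c.\<close>

lemma obtuse_small:
  assumes B: "det B = 1" and "row_dot B \<le> 0" "- row_dot B - row2_sq B \<le> 0" "- row_dot B - row1_sq B \<le> 0"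
  shows "frob_sq B \<le> 4"
proof -
  define a b c where abc: "a = - row_dot B" "b = row2_sq B + row_dot B" "c = row1_sq B + row_dot B"
  have nn: "a \<ge> 0" "b \<ge> 0" "c \<ge> 0" using assms by (auto simp: abc)
  have e: "a * b + b * c + c * a = 1"
    using row_gram[OF B] by (simp add: abc power2_eq_square algebra_simps)
  have *: "x \<le> 1" if "x \<ge> 0" "y \<ge> 0" "z \<ge> 0" "x * y + y * z + z * x = 1" for x y z :: int
  proof (rule ccontr)
    assume "\<not> x \<le> 1"
    then have x: "x \<ge> 2" by simp
    have "x * (y + z) \<le> 1" using that(4) mult_nonneg_nonneg[OF that(2,3)] unfolding distrib_left mult.commute[of z x] by linarith
    moreover have "2 * (y + z) \<le> x * (y + z)" using x that by (intro mult_right_mono) auto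
    ultimately have "2 * (y + z) \<le> 1" by (rule order_trans[rotated])
    then have "y + z \<le> 0" by presburger
    then have "y = 0" "z = 0" using that(2,3) by presburger+
    then show False using that by simp
  qed
  have "a \<le> 1" "b \<le> 1" "c \<le> 1"
    using *[of a b c] *[of b c a] *[of c a b] nn e by (simp_all add: algebra_simps)
  then show ?thesis unfolding frob_sq_rows using abc by linarith
qed

section \<open>Finitely generated subgroups of SL(2,Z) without parabolic elements\<close>

locale nonparabolic_group =
  fixes G X :: "(int^2^2) set"
  assumes finite_X: "finite X"
    and det_X: "\<And>x. x \<in> X \<Longrightarrow> det x = 1"
    and G_eq: "G = generate SL2Z X"
    and not_parabolic: "\<And>g. g \<in> G \<Longrightarrow> \<not> parabolic g"
begin

lemma carrier_SL2Z: "A \<in> carrier SL2Z \<longleftrightarrow> det A = 1"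
  by (simp add: SL2Z_def)

lemma X_sub: "X \<subseteq> carrier SL2Z"
  using det_X by (auto simp: carrier_SL2Z)

lemma inv_SL2Z: "det A = 1 \<Longrightarrow> inv\<^bsub>SL2Z\<^esub> A = adj A"
  by (rule group.inv_equality[OF group_SL2Z]) (auto simp: SL2Z_def adj_mult)

lemma subgroup_G: "subgroup G SL2Z"
  unfolding G_eq by (rule group.generate_is_subgroup[OF group_SL2Z X_sub])

lemma det_G: "g \<in> G \<Longrightarrow> det g = 1"
  using subgroup.mem_carrier[OF subgroup_G] by (simp add: carrier_SL2Z)

lemma one_G: "mat 1 \<in> G"
  using subgroup.one_closed[OF subgroup_G] by (simp add: SL2Z_def)

lemma mult_G: "g \<in> G \<Longrightarrow> h \<in> G \<Longrightarrow> g ** h \<in> G"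
  using subgroup.m_closed[OF subgroup_G] by (simp add: SL2Z_def)

lemma adj_G: "g \<in> G \<Longrightarrow> adj g \<in> G"
  using subgroup.m_inv_closed[OF subgroup_G] inv_SL2Z det_G by metis

text \<open>A Farey edge separating \<open>\<i>\<close> from its image under \<open>g \<in> G\<close> must be crossed by one of the
  steps of a path in the generators, hence lies close to the orbit.\<close>

lemma bottleneck:
  "\<exists>C. \<forall>g\<in>G. \<forall>B. det B = 1 \<longrightarrow> (0 \<le> row_dot B) \<noteq> (0 \<le> row_dot (B ** g)) \<longrightarrow>
     (\<exists>h\<in>G. frobenius_norm (B ** h) \<le> C)"
proof -
  define m where "m = Max (insert 0 (frob_sq ` X))"
  have m: "frob_sq x \<le> m" if "x \<in> X" for x
    unfolding m_def using that finite_X by (intro Max_ge) auto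
  have bound: "frobenius_norm A \<le> sqrt (real_of_int (2 * (m ^ 4 + 1)))"
    if "det A = 1" "det x = 1" "frob_sq x \<le> m" "(0 \<le> row_dot A) \<noteq> (0 \<le> row_dot (A ** x))" for A x
  proof -
    have "frob_sq x ^ 4 \<le> m ^ 4" using that by (intro power_mono) auto
    then have "frob_sq A \<le> 2 * (m ^ 4 + 1)" using row_dot_sign_change[of A x] that by simp
    then show ?thesis unfolding frobenius_norm_eq by (simp only: real_sqrt_le_iff of_int_le_iff)
  qed
  define C where "C = sqrt (real_of_int (2 * (m ^ 4 + 1)))"
  have "\<forall>B. det B = 1 \<longrightarrow> (0 \<le> row_dot B) \<noteq> (0 \<le> row_dot (B ** g)) \<longrightarrow>
     (\<exists>h\<in>G. frobenius_norm (B ** h) \<le> C)" if "g \<in> generate SL2Z X" for g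
    using that
  proof induction
    case one
    show ?case by (simp add: SL2Z_def)
  next
    case (incl x)
    show ?case
      using bound[of _ x] det_X[OF incl] m[OF incl] one_G unfolding C_def
      by (metis matrix_mul_rid)
  next
    case (inv x)
    show ?case
      using bound[of _ "adj x"] det_X[OF inv] m[OF inv] one_G unfolding C_def inv_SL2Z[OF det_X[OF inv]]
      by (metis matrix_mul_rid det_adj frob_sq_adj)
  next
    case (eng h1 h2)
    show ?case
    proof (intro allI impI)
      fix B :: "int^2^2"
      assume B: "det B = 1" and ch: "(0 \<le> row_dot B) \<noteq> (0 \<le> row_dot (B ** (h1 \<otimes>\<^bsub>SL2Z\<^esub> h2)))"
      have h1: "h1 \<in> G" using eng by (simp add: G_eq)
      \<comment> \<open>The path to h1 h2 passes through h1: if its first half does not cross the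
        edge, then its second half does, as seen from \<open>B ** h1\<close>.\<close>
      have e: "B ** (h1 \<otimes>\<^bsub>SL2Z\<^esub> h2) = (B ** h1) ** h2" by (simp add: SL2Z_def matrix_mul_assoc)
      show "\<exists>h\<in>G. frobenius_norm (B ** h) \<le> C"
      proof (cases "(0 \<le> row_dot B) = (0 \<le> row_dot (B ** h1))")
        case False
        then show ?thesis using eng.IH(1) B by blast
      next
        case True
        have "det (B ** h1) = 1" using B det_G[OF h1] by (simp add: det_mul)
        moreover have "(0 \<le> row_dot (B ** h1)) \<noteq> (0 \<le> row_dot ((B ** h1) ** h2))"
          using True ch e by simp
        ultimately obtain h where "h \<in> G" "frobenius_norm ((B ** h1) ** h) \<le> C"
          using eng.IH(2) by blast
        then show ?thesis using mult_G[OF h1] by (metis matrix_mul_assoc)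
      qed
    qed
  qed
  then show ?thesis unfolding G_eq by blast
qed

text \<open>The conjugate has trace 2, and it is the identity only if the first row of B
  vanishes.\<close>

lemma conj_unipotent_notin:
  assumes B: "det B = 1" and n: "n \<noteq> 0" and mem: "adj B ** (mat2 1 0 n 1 ** B) \<in> G"
  shows False
proof -
  define h where "h = adj B ** (mat2 1 0 n 1 ** B)"
  define a b c d where d: "a = B$1$1" "b = B$1$2" "c = B$2$1" "d = B$2$2"
  have e1: "a * d - b * c = 1" using B by (simp add: det_2 d)
  have h: "h$1$1 = 1 - n * a * b" "h$1$2 = - (n * b * b)" "h$2$1 = n * a * a" "h$2$2 = 1 + n * a * b"
    using e1 by (simp_all add: h_def mult_nth adj_def algebra_simps flip: d)
  have tr: "trace h = 2" by (simp add: trace_def sum_2 h)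
  have "h \<noteq> - mat 1"
  proof
    assume *: "h = - mat 1"
    show False using tr by (simp add: * trace_def sum_2)
  qed
  moreover have "h \<noteq> mat 1"
  proof
    assume "h = mat 1"
    then have "n * b * b = 0" "n * a * a = 0" using h by auto
    then have "a = 0" "b = 0" using n by auto
    then show False using e1 by simp
  qed
  ultimately have "parabolic h" using tr by (simp add: parabolic_def)
  then show False using not_parabolic mem by (simp add: h_def)
qed

text \<open>Vectors cannot be short at both ends: otherwise the geodesic makes a long excursion into a
  cusp, crossing many of the edges with rows \<open>v, w + j v\<close>, and two of the nearby orbit points
  differ by a parabolic element.\<close>

lemma no_cusp_excursion:
  "\<exists>\<eta>::real. \<eta> > 0 \<and> (\<forall>g\<in>G. \<forall>B. det B = 1 \<longrightarrow>
     \<eta> * frob_sq g \<le> real_of_int (row1_sq B) * row1_sq (B ** g))"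
proof -
  obtain C where C: "\<forall>g\<in>G. \<forall>B. det B = 1 \<longrightarrow> (0 \<le> row_dot B) \<noteq> (0 \<le> row_dot (B ** g)) \<longrightarrow>
     (\<exists>h\<in>G. frobenius_norm (B ** h) \<le> C)"
    using bottleneck by (elim exE)
  define F where "F = {A :: int^2^2. frobenius_norm A \<le> C}"
  have F: "finite F" unfolding F_def by (rule finite_frobenius_norm_le)
  define n where "n = card F"
  \<comment> \<open>\<open>n\<close> is the number of matrices that can occur near a crossed edge.
    If the claim failed, \<open>gram_change\<close> would make the displacement of \<open>x1\<close>
    from \<open>x0\<close> exceed n + 2, leaving n + 1 integers strictly between them; the summand 2
    pays for the squares of \<open>p0\<close> and \<open>p1\<close>.\<close>
  define \<eta> where "\<eta> = 1 / ((real n + 2)\<^sup>2 + 2)"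
  have den: "(real n + 2)\<^sup>2 + 2 > 0" by (simp add: add_nonneg_pos)
  have "\<eta> > 0" using den by (simp add: \<eta>_def)
  moreover have "\<eta> * frob_sq g \<le> real_of_int (row1_sq B) * row1_sq (B ** g)" if g: "g \<in> G" and B: "det B = 1" for g B
  proof (rule ccontr)
    assume neg: "\<not> ?thesis"
    define p0 where "p0 = real_of_int (row1_sq B)"
    define p1 where "p1 = real_of_int (row1_sq (B ** g))"
    define b0 where "b0 = real_of_int (row_dot B)"
    define b1 where "b1 = real_of_int (row_dot (B ** g))"
    define x0 where "x0 = - b0 / p0"
    define x1 where "x1 = - b1 / p1"
    have detBg: "det (B ** g) = 1" using B det_G[OF g] by (simp add: det_mul)
    have p0: "1 \<le> p0" using row1_sq_pos[OF B] by (simp add: p0_def)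
    have p1: "1 \<le> p1" using row1_sq_pos[OF detBg] by (simp add: p1_def)
    have "(b0 * p1 - b1 * p0)\<^sup>2 + p0\<^sup>2 + p1\<^sup>2 = frob_sq g * p0 * p1"
      using arg_cong[OF gram_change[OF B det_G[OF g]], of real_of_int]
      by (simp add: p0_def p1_def b0_def b1_def)
    moreover have "b0 * p1 - b1 * p0 = (x1 - x0) * (p0 * p1)"
      using p0 p1 by (simp add: x0_def x1_def field_simps)
    ultimately have "((x1 - x0) * (p0 * p1))\<^sup>2 = frob_sq g * (p0 * p1) - p0\<^sup>2 - p1\<^sup>2"
      by simp
    moreover have "frob_sq g > (p0 * p1) * ((real n + 2)\<^sup>2 + 2)"
      using neg den by (simp add: \<eta>_def p0_def p1_def field_simps)
    then have "frob_sq g * (p0 * p1) > (p0 * p1) * ((real n + 2)\<^sup>2 + 2) * (p0 * p1)"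
      using p0 p1 by (intro mult_strict_right_mono) auto
    moreover have "p0\<^sup>2 \<le> (p0 * p1)\<^sup>2" "p1\<^sup>2 \<le> (p0 * p1)\<^sup>2"
      using p0 p1 by (auto intro!: power_mono simp: mult_le_cancel_left1 mult_le_cancel_right1)
    ultimately have "((x1 - x0) * (p0 * p1))\<^sup>2 > (real n + 2)\<^sup>2 * (p0 * p1)\<^sup>2"
      by (simp add: power2_eq_square algebra_simps)
    then have "(x1 - x0)\<^sup>2 > (real n + 2)\<^sup>2"
      using p0 p1 by (simp add: power_mult_distrib)
    then have gap: "\<bar>x1 - x0\<bar> > real n + 2"
      by (metis abs_ge_zero not_le power2_abs power_mono)
    define m where "m = \<lfloor>min x0 x1\<rfloor>"
    define J where "J = {m + 1..m + 1 + int n}"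
    have cardJ: "card J = n + 1" by (simp add: J_def)
    have "\<exists>h\<in>G. mat2 1 0 j 1 ** B ** h \<in> F" if j: "j \<in> J" for j
    proof -
      have j1: "min x0 x1 < j" "j < max x0 x1"
        using j gap unfolding J_def m_def by (simp_all add: min_def max_def split: if_splits) linarith+
      \<comment> \<open>The shear by j shifts the coordinates \<open>x0\<close> and
        \<open>x1\<close>, so its edge separates the end points exactly when j lies between
        them.\<close>
      have r0: "real_of_int (row_dot (mat2 1 0 j 1 ** B)) = (j - x0) * p0"
        using p0 by (simp add: row_mat2 x0_def p0_def b0_def field_simps)
      have r1: "real_of_int (row_dot (mat2 1 0 j 1 ** (B ** g))) = (j - x1) * p1"
        using p1 by (simp add: row_mat2 x1_def p1_def b1_def field_simps)
      have s0: "0 \<le> row_dot (mat2 1 0 j 1 ** B) \<longleftrightarrow> x0 \<le> j"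
      proof -
        have "0 \<le> row_dot (mat2 1 0 j 1 ** B) \<longleftrightarrow> 0 \<le> (j - x0) * p0" unfolding r0[symmetric] by simp
        also have "\<dots> \<longleftrightarrow> x0 \<le> j" using p0 by (simp add: zero_le_mult_iff)
        finally show ?thesis .
      qed
      have s1: "0 \<le> row_dot (mat2 1 0 j 1 ** (B ** g)) \<longleftrightarrow> x1 \<le> j"
      proof -
        have "0 \<le> row_dot (mat2 1 0 j 1 ** (B ** g)) \<longleftrightarrow> 0 \<le> (j - x1) * p1" unfolding r1[symmetric] by simp
        also have "\<dots> \<longleftrightarrow> x1 \<le> j" using p1 by (simp add: zero_le_mult_iff)
        finally show ?thesis .
      qed
      have "(0 \<le> row_dot (mat2 1 0 j 1 ** B)) \<noteq> (0 \<le> row_dot ((mat2 1 0 j 1 ** B) ** g))"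
        using s0 s1 j1 by (auto simp: matrix_mul_assoc min_def max_def split: if_splits)
      moreover have "det (mat2 1 0 j 1 ** B) = 1" using B by (simp add: det_mul det_mat2)
      ultimately have "\<exists>h\<in>G. frobenius_norm ((mat2 1 0 j 1 ** B) ** h) \<le> C"
        using C[rule_format, OF g] by metis
      then show ?thesis by (simp add: F_def)
    qed
    then have "\<forall>j\<in>J. \<exists>h. h \<in> G \<and> mat2 1 0 j 1 ** B ** h \<in> F" by blast
    from bchoice[OF this] obtain h where "\<forall>j\<in>J. h j \<in> G \<and> mat2 1 0 j 1 ** B ** h j \<in> F" ..
    then have h: "\<And>j. j \<in> J \<Longrightarrow> h j \<in> G" "\<And>j. j \<in> J \<Longrightarrow> mat2 1 0 j 1 ** B ** h j \<in> F"
      by simp_all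
    \<comment> \<open>There are n + 1 edges for n matrices. Two edges with the same matrix give an
      element of the group that B conjugates to a nontrivial unipotent.\<close>
    have "\<not> inj_on (\<lambda>j. mat2 1 0 j 1 ** B ** h j) J"
    proof (rule pigeonhole)
      have "card ((\<lambda>j. mat2 1 0 j 1 ** B ** h j) ` J) \<le> card F"
        using h(2) by (intro card_mono[OF F]) auto
      then show "card ((\<lambda>j. mat2 1 0 j 1 ** B ** h j) ` J) < card J" using cardJ by (simp add: n_def)
    qed
    then obtain i j where ij: "i \<in> J" "j \<in> J" "i \<noteq> j"
      and eq: "mat2 1 0 i 1 ** B ** h i = mat2 1 0 j 1 ** B ** h j"
      by (auto simp: inj_on_def)
    have "mat2 1 0 i 1 ** B ** (h i ** adj (h j)) = mat2 1 0 j 1 ** B"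
      using arg_cong[OF eq, of "\<lambda>A. A ** adj (h j)"] adj_mult_cancel(3)[OF det_G[OF h(1)[OF ij(2)]]]
      by (simp add: matrix_mul_assoc)
    then have "h i ** adj (h j) = adj (mat2 1 0 i 1 ** B) ** (mat2 1 0 j 1 ** B)"
      using adj_mult_cancel(1)[of "mat2 1 0 i 1 ** B"] B by (metis det_mul det_mat2 mult_1 mult_zero_left diff_zero)
    also have "\<dots> = adj B ** ((adj (mat2 1 0 i 1) ** mat2 1 0 j 1) ** B)"
      by (simp add: adj_mult_distrib matrix_mul_assoc)
    also have "adj (mat2 1 0 i 1) ** mat2 1 0 j 1 = mat2 1 0 (j - i) 1"
      by (rule mat2_eqI) (simp_all add: mult_nth adj_def)
    finally show False
      using conj_unipotent_notin[OF B, of "j - i"] mult_G[OF h(1)[OF ij(1)] adj_G[OF h(1)[OF ij(2)]]] ij by simp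
  qed
  ultimately show ?thesis by blast
qed

text \<open>The form \<open>|v|\<^sup>2 + s |v g|\<^sup>2\<close> runs through the geodesic from \<open>\<i>\<close> to its image under \<open>g\<close>; its
  obtuse superbase is the Farey triangle at parameter \<open>s\<close>, and one of the three edges of this
  triangle separates the end points unless \<open>g\<close> is small.\<close>

lemma separating_edge:
  fixes s :: real
  assumes g: "det g = 1" and s: "s > 0" and B: "det B = 1"
    and dot: "row_dot B + s * row_dot (B ** g) \<le> 0"
    and d1: "\<bar>2 * (row_dot B + s * row_dot (B ** g))\<bar> \<le> row1_sq B + s * row1_sq (B ** g)"
    and d2: "\<bar>2 * (row_dot B + s * row_dot (B ** g))\<bar> \<le> row2_sq B + s * row2_sq (B ** g)"
    and large: "4 < frobenius_norm g"
  shows "\<exists>D. det D = 1 \<and> (0 \<le> row_dot D) \<noteq> (0 \<le> row_dot (D ** g)) \<and>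
     frob_sq D + s * frob_sq (D ** g) \<le> 3 * (frob_sq B + s * frob_sq (B ** g))"
proof -
  define B2 where "B2 = mat2 0 1 (-1) (-1) ** B"
  define B3 where "B3 = mat2 (-1) (-1) 1 0 ** B"
  have B2g: "B2 ** g = mat2 0 1 (-1) (-1) ** (B ** g)" and B3g: "B3 ** g = mat2 (-1) (-1) 1 0 ** (B ** g)"
    by (simp_all add: B2_def B3_def matrix_mul_assoc)
  have dets: "det B2 = 1" "det B3 = 1" "det (B ** g) = 1"
    using B g by (simp_all add: B2_def B3_def det_mul det_mat2)
  have sep: "(0 \<le> row_dot D) \<noteq> (0 \<le> row_dot (D ** g)) \<or> row_dot D \<le> 0 \<and> row_dot (D ** g) \<le> 0"
    if "row_dot D + s * row_dot (D ** g) \<le> 0" for D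
  proof (rule ccontr)
    assume *: "\<not> ?thesis"
    then have "row_dot D > 0 \<and> row_dot (D ** g) \<ge> 0 \<or> row_dot D \<ge> 0 \<and> row_dot (D ** g) > 0" by linarith
    then have "row_dot D + s * row_dot (D ** g) > 0"
    proof (elim disjE conjE)
      assume "row_dot D > 0" "row_dot (D ** g) \<ge> 0"
      then show ?thesis using s by (intro add_pos_nonneg) auto
    next
      assume "row_dot D \<ge> 0" "row_dot (D ** g) > 0"
      then show ?thesis using s by (intro add_nonneg_pos) auto
    qed
    then show False using that by simp
  qed
  \<comment> \<open>For the weighted form the products of B2 with B3 and of B3 with B1 are -b - q2
    and -b - q1 in terms of the cross term b and the lengths q1, q2; the bounds \<open>d1\<close>
    and \<open>d2\<close> make them nonpositive, so the superbase is obtuse.\<close>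
  have dot2: "row_dot B2 + s * row_dot (B2 ** g) \<le> 0"
    using d2 dot unfolding B2g unfolding B2_def row_mat2 by (simp add: algebra_simps)
  have dot3: "row_dot B3 + s * row_dot (B3 ** g) \<le> 0"
    using d1 dot unfolding B3g unfolding B3_def row_mat2 by (simp add: algebra_simps)
  have nn: "0 \<le> row1_sq B" "0 \<le> row2_sq B" "0 \<le> s * row1_sq (B ** g)" "0 \<le> s * row2_sq (B ** g)"
    using s by (auto simp: row1_sq_def row2_sq_def)
  have f: "frob_sq D + s * frob_sq (D ** g) \<le> 3 * (frob_sq B + s * frob_sq (B ** g))" if "D = B \<or> D = B2 \<or> D = B3" for D
    using that
  proof (elim disjE)
    assume "D = B"
    then show ?thesis using s by (simp add: add_nonneg_nonneg)
  next
    assume "D = B2"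
    then show ?thesis using nn dot unfolding \<open>D = B2\<close> B2g unfolding B2_def row_mat2
      by (simp add: frob_sq_rows algebra_simps)
  next
    assume "D = B3"
    then show ?thesis using nn dot unfolding \<open>D = B3\<close> B3g unfolding B3_def row_mat2
      by (simp add: frob_sq_rows algebra_simps)
  qed
  show ?thesis
  proof (rule ccontr)
    assume neg: "\<not> ?thesis"
    \<comment> \<open>Without a separating edge each of the three products is nonpositive at both
      end points separately. By \<open>obtuse_small\<close> both \<open>B\<close> and
      \<open>B ** g\<close> then have norm at most 2, and |g| is at most the product of these norms:
      this is the 4 in \<open>large\<close>.\<close>
    have ns: "row_dot D \<le> 0 \<and> row_dot (D ** g) \<le> 0" if "D = B \<or> D = B2 \<or> D = B3" for D
    proof -
      have "det D = 1" "row_dot D + s * row_dot (D ** g) \<le> 0"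
        using that B dets dot dot2 dot3 by auto
      then show ?thesis using neg sep[of D] f[OF that] by blast
    qed
    have "frob_sq B \<le> 4"
      using ns[of B] ns[of B2] ns[of B3] by (intro obtuse_small[OF B]) (simp_all add: B2_def B3_def row_mat2)
    moreover have "frob_sq (B ** g) \<le> 4"
      using ns[of B] ns[of B2] ns[of B3] unfolding B2g B3g
      by (intro obtuse_small[OF dets(3)]) (simp_all add: row_mat2)
    ultimately have "frobenius_norm B \<le> sqrt 4" "frobenius_norm (B ** g) \<le> sqrt 4"
      unfolding frobenius_norm_eq real_sqrt_le_iff by linarith+
    then have "frobenius_norm B * frobenius_norm (B ** g) \<le> sqrt 4 * sqrt 4"
      by (intro mult_mono) auto
    then show False using frobenius_norm_mult_left[OF B, of g] large by simp
  qed
qed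

text \<open>The orbit comes within bounded distance of the geodesic at parameter t. The form |v|^2 +
  s |v g|^2 belonging to that point has determinant of order t^4, and
  \<open>no_cusp_excursion\<close> keeps its values on primitive vectors above a multiple of t^2. A
  reduced basis thus has both lengths of order t^2, an edge of its Farey triangle separates the end
  points, and \<open>bottleneck\<close> supplies an orbit point near this edge.\<close>

lemma quasiconvex:
  "\<exists>C>0. \<forall>g\<in>G. \<forall>t. 1 \<le> t \<longrightarrow> t \<le> frobenius_norm g \<longrightarrow>
     (\<exists>h\<in>G. frobenius_norm h \<le> C * t \<and> frobenius_norm (adj h ** g) \<le> C * frobenius_norm g / t)"
proof -
  obtain C1 where C1: "\<forall>g\<in>G. \<forall>B. det B = 1 \<longrightarrow> (0 \<le> row_dot B) \<noteq> (0 \<le> row_dot (B ** g)) \<longrightarrow>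
     (\<exists>h\<in>G. frobenius_norm (B ** h) \<le> C1)"
    using bottleneck by (elim exE)
  obtain \<eta> :: real where \<eta>: "\<eta> > 0" and cusp: "\<And>g B. g \<in> G \<Longrightarrow> det B = 1 \<Longrightarrow>
     \<eta> * frob_sq g \<le> real_of_int (row1_sq B) * row1_sq (B ** g)"
    using no_cusp_excursion by metis
  define \<kappa> where "\<kappa> = 2 * sqrt \<eta>"
  have \<kappa>: "\<kappa> > 0" using \<eta> by (simp add: \<kappa>_def)
  define M where "M = sqrt (24 / \<kappa>)"
  have M: "M > 0" using \<kappa> by (simp add: M_def)
  define C where "C = max 4 (M * C1)"
  have C: "C \<ge> 4" "M * C1 \<le> C" by (auto simp: C_def)
  have "\<exists>h\<in>G. frobenius_norm h \<le> C * t \<and> frobenius_norm (adj h ** g) \<le> C * frobenius_norm g / t"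
    if g: "g \<in> G" and t: "1 \<le> t" "t \<le> frobenius_norm g" for g t
  proof (cases "frobenius_norm g \<le> 4")
    case True
    have "frobenius_norm (mat 1) \<le> 4"
      unfolding frobenius_norm_eq by (intro real_le_lsqrt) (simp_all add: frob_sq_def)
    also have "4 \<le> C * t" using C t mult_mono[of 4 C 1 t] by simp
    finally have "frobenius_norm (mat 1) \<le> C * t" .
    moreover have "frobenius_norm (adj (mat 1) ** g) \<le> C * frobenius_norm g / t"
    proof -
      have "adj (mat 1) = mat 1" by (rule mat2_eqI) (simp_all add: adj_def)
      then have "frobenius_norm (adj (mat 1) ** g) = frobenius_norm g" by simp
      also have "\<dots> \<le> 4" by fact
      also have "4 \<le> C * (frobenius_norm g / t)"
        using C t mult_mono[of 4 C 1 "frobenius_norm g / t"] by simp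
      finally show ?thesis by simp
    qed
    ultimately show ?thesis using one_G by blast
  next
    case False
    define L where "L = frobenius_norm g"
    have L: "4 < L" using False by (simp add: L_def)
    have L2: "real_of_int (frob_sq g) = L\<^sup>2" by (simp add: L_def frobenius_norm_sq)
    have dg: "det g = 1" by (rule det_G[OF g])
    \<comment> \<open>With s |g|^2 = t^4 and s at most t^2, the determinant 1 + s |g|^2 + s^2 lies
      between t^4 and 3 t^4.\<close>
    define s where "s = t^4 / L\<^sup>2"
    have s: "s > 0" using t L by (simp add: s_def)
    have sL: "s * L\<^sup>2 = t^4" using L by (simp add: s_def)
    have st: "s \<le> t\<^sup>2"
    proof -
      have "t\<^sup>2 \<le> L\<^sup>2" using t by (intro power_mono) (auto simp: L_def)
      then have "t\<^sup>2 * t\<^sup>2 \<le> t\<^sup>2 * L\<^sup>2" by (intro mult_left_mono) auto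
      then show ?thesis using L by (simp add: s_def field_simps power2_eq_square power4_eq_xxxx)
    qed
    \<comment> \<open>Reduction by minimizing the trace of the form: only finitely many bases lie
      below a given trace, and comparing a minimal one with its four elementary shears yields
      \<open>d1\<close> and \<open>d2\<close>.\<close>
    define E where "E B = real_of_int (frob_sq B) + s * frob_sq (B ** g)" for B
    define S where "S = {B. det B = 1 \<and> E B \<le> E (mat 1)}"
    have "finite S"
    proof (rule finite_subset[OF _ finite_frob_sq_le[of "\<lceil>E (mat 1)\<rceil>"]], clarify)
      fix B assume "B \<in> S"
      then have "E B \<le> E (mat 1)" by (simp add: S_def)
      moreover have "0 \<le> s * real_of_int (frob_sq (B ** g))" using s by simp
      ultimately have "real_of_int (frob_sq B) \<le> E (mat 1)" unfolding E_def by linarith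
      then show "frob_sq B \<le> \<lceil>E (mat 1)\<rceil>" by linarith
    qed
    moreover have "mat 1 \<in> S" by (simp add: S_def)
    ultimately obtain B0 where "is_arg_min E (\<lambda>B. B \<in> S) B0"
      using ex_is_arg_min_if_finite[of S E] by blast
    then have B0: "det B0 = 1" "E B0 \<le> E (mat 1)" and least: "\<And>D. D \<in> S \<Longrightarrow> E B0 \<le> E D"
      by (auto simp: is_arg_min_def S_def not_less)
    have min0: "E B0 \<le> E D" if "det D = 1" for D
      using least[of D] B0(2) that unfolding S_def by (cases "E D \<le> E (mat 1)") auto
    \<comment> \<open>The quarter turn reverses the sign of the cross term and preserves
      \<open>E\<close>.\<close>
    define B where "B = (if row_dot B0 + s * row_dot (B0 ** g) \<le> 0 then B0 else mat2 0 1 (-1) 0 ** B0)"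
    have B: "det B = 1" using B0(1) by (simp add: B_def det_mul det_mat2)
    have assoc: "(U ** A) ** g = U ** (A ** g)" for U A :: "int^2^2" by (simp add: matrix_mul_assoc)
    have EB: "E B = E B0"
      by (simp add: B_def E_def frob_sq_rows row_mat2 assoc)
    have dot: "row_dot B + s * row_dot (B ** g) \<le> 0"
      by (simp add: B_def assoc row_mat2)
    have min: "E B \<le> E (U ** B)" if "det U = 1" for U
      unfolding EB using min0[of "U ** B"] B that by (simp add: det_mul)
    define q1 where "q1 = row1_sq B + s * row1_sq (B ** g)"
    define q2 where "q2 = row2_sq B + s * row2_sq (B ** g)"
    define b where "b = row_dot B + s * row_dot (B ** g)"
    have EBq: "E B = q1 + q2" by (simp add: E_def q1_def q2_def frob_sq_rows algebra_simps)
    have E1: "E (mat2 1 0 k 1 ** B) = q1 + q2 + 2 * k * b + k\<^sup>2 * q1" for k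
      unfolding E_def assoc frob_sq_rows row_mat2 q1_def q2_def b_def by (simp add: algebra_simps)
    have E2: "E (mat2 1 k 0 1 ** B) = q1 + q2 + 2 * k * b + k\<^sup>2 * q2" for k
      unfolding E_def assoc frob_sq_rows row_mat2 q1_def q2_def b_def by (simp add: algebra_simps)
    have d1: "\<bar>2 * b\<bar> \<le> q1"
      using min[of "mat2 1 0 1 1"] min[of "mat2 1 0 (-1) 1"] unfolding E1 EBq by (simp add: det_mat2)
    have d2: "\<bar>2 * b\<bar> \<le> q2"
      using min[of "mat2 1 1 0 1"] min[of "mat2 1 (-1) 0 1"] unfolding E2 EBq by (simp add: det_mat2)
    \<comment> \<open>The cusp estimate bounds the product of the two summands; the inequality 4xy
      \<le> (x + y)^2 converts it into a bound for their sum, whence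
      \<open>\<kappa> = 2 * sqrt \<eta>\<close>.\<close>
    have lower: "\<kappa> * t\<^sup>2 \<le> real_of_int (row1_sq D) + s * row1_sq (D ** g)" if D: "det D = 1" for D
    proof (rule power2_le_imp_le)
      define x y where xy: "x = real_of_int (row1_sq D)" "y = s * row1_sq (D ** g)"
      have "(\<kappa> * t\<^sup>2)\<^sup>2 = 4 * (\<eta> * (s * L\<^sup>2))"
        unfolding sL using \<eta> by (simp add: \<kappa>_def power_mult_distrib)
      also have "\<dots> = 4 * (s * (\<eta> * frob_sq g))" by (simp add: L2)
      also have "\<dots> \<le> 4 * (s * (real_of_int (row1_sq D) * row1_sq (D ** g)))"
        using cusp[OF g D] s by simp
      also have "\<dots> = 4 * (x * y)" by (simp add: xy)
      also have "\<dots> \<le> (x + y)\<^sup>2"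
      proof -
        have "(x + y)\<^sup>2 - 4 * (x * y) = (x - y)\<^sup>2" by (simp add: power2_eq_square algebra_simps)
        then show ?thesis by (metis diff_ge_0_iff_ge zero_le_power2)
      qed
      finally show "(\<kappa> * t\<^sup>2)\<^sup>2 \<le> (real_of_int (row1_sq D) + s * row1_sq (D ** g))\<^sup>2" by (simp add: xy)
    qed (use s in \<open>auto simp: row1_sq_def\<close>)
    have l1: "\<kappa> * t\<^sup>2 \<le> q1" using lower[OF B] by (simp add: q1_def)
    have l2: "\<kappa> * t\<^sup>2 \<le> q2"
      using lower[of "mat2 0 1 (-1) 0 ** B"] B by (simp add: q2_def det_mul det_mat2 assoc row_mat2)
    \<comment> \<open>In a reduced basis b^2 is at most a quarter of q1 q2, so three quarters of q1
      q2 are at most the determinant, hence at most 3 t^4.\<close>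
    have qq: "q1 * q2 \<le> 4 * t^4"
    proof -
      have f: "q1 * q2 - b\<^sup>2 = 1 + t^4 + s\<^sup>2"
        using frob_sq_form[OF B dg, of s] unfolding L2 sL q1_def q2_def b_def by simp
      have "(2 * b)\<^sup>2 \<le> q1 * q2"
      proof -
        have "\<bar>2 * b\<bar> * \<bar>2 * b\<bar> \<le> q1 * q2" using d1 d2 by (intro mult_mono) auto
        then show ?thesis by (simp add: power2_eq_square)
      qed
      moreover have "s\<^sup>2 \<le> (t\<^sup>2)\<^sup>2" using st s by (intro power_mono) auto
      moreover have "1 \<le> t^4" using t by simp
      ultimately show ?thesis using f by simp
    qed
    have t2: "t\<^sup>2 > 0" using t by simp
    have u: "x \<le> 4 * t\<^sup>2 / \<kappa>" if "\<kappa> * t\<^sup>2 \<le> y" "x * y \<le> 4 * t^4" "x \<ge> 0" for x y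
    proof -
      have "x * (\<kappa> * t\<^sup>2) \<le> x * y" using that by (intro mult_left_mono) auto
      then have "(x * \<kappa>) * t\<^sup>2 \<le> (4 * t\<^sup>2) * t\<^sup>2" using that(2) by (simp add: power2_eq_square power4_eq_xxxx mult.assoc)
      then have "x * \<kappa> \<le> 4 * t\<^sup>2" using t2 by (rule mult_right_le_imp_le)
      then show ?thesis using \<kappa> by (simp add: pos_le_divide_eq)
    qed
    have qs: "q1 \<ge> 0" "q2 \<ge> 0" using d1 d2 by linarith+
    have up: "3 * E B \<le> 24 * t\<^sup>2 / \<kappa>"
    proof -
      have "q1 \<le> 4 * t\<^sup>2 / \<kappa>" by (rule u[OF l2 qq qs(1)])
      moreover have "q2 \<le> 4 * t\<^sup>2 / \<kappa>" using qq by (intro u[OF l1 _ qs(2)]) (simp add: mult.commute)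
      moreover have "3 * (q1 + q2) \<le> 6 * w" if "q1 \<le> w" "q2 \<le> w" for w unfolding distrib_left using that by linarith
      ultimately have "3 * (q1 + q2) \<le> 6 * (4 * t\<^sup>2 / \<kappa>)" by blast
      then show ?thesis unfolding EBq by simp
    qed
    obtain D where D: "det D = 1" "(0 \<le> row_dot D) \<noteq> (0 \<le> row_dot (D ** g))" "E D \<le> 3 * E B"
      using separating_edge[OF dg s B dot] d1 d2 L unfolding E_def b_def q1_def q2_def L_def by blast
    obtain h where h: "h \<in> G" "frobenius_norm (D ** h) \<le> C1"
      using C1[rule_format, OF g D(1,2)] by blast
    have C1nn: "C1 \<ge> 0" using h(2) frobenius_norm_nonneg[of "D ** h"] by linarith
    have fD: "frobenius_norm D \<le> M * t"
    proof (rule power2_le_imp_le)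
      have "s * real_of_int (frob_sq (D ** g)) \<ge> 0" using s by simp
      then have "(frobenius_norm D)\<^sup>2 \<le> 24 * t\<^sup>2 / \<kappa>"
        using D(3) up unfolding frobenius_norm_sq E_def by linarith
      then show "(frobenius_norm D)\<^sup>2 \<le> (M * t)\<^sup>2" using \<kappa> by (simp add: M_def power_mult_distrib)
    qed (use M t in auto)
    have fDg: "frobenius_norm (D ** g) \<le> M * L / t"
    proof (rule power2_le_imp_le)
      have "s * (frobenius_norm (D ** g))\<^sup>2 \<le> 24 * t\<^sup>2 / \<kappa>"
        using D(3) up frob_sq_nonneg[of D] unfolding frobenius_norm_sq E_def by linarith
      then have "(frobenius_norm (D ** g))\<^sup>2 \<le> 24 * t\<^sup>2 / \<kappa> / s" using s by (metis mult.commute pos_le_divide_eq)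
      also have "\<dots> = (M * L / t)\<^sup>2"
        using \<kappa> t L by (simp add: M_def s_def power_mult_distrib power_divide field_simps power2_eq_square power4_eq_xxxx)
      finally show "(frobenius_norm (D ** g))\<^sup>2 \<le> (M * L / t)\<^sup>2" .
    qed (use M t L in auto)
    have "frobenius_norm h \<le> frobenius_norm D * frobenius_norm (D ** h)"
      by (rule frobenius_norm_mult_left[OF D(1)])
    also have "\<dots> \<le> (M * t) * C1" using fD h(2) M t by (intro mult_mono) auto
    also have "\<dots> \<le> C * t" using C(2) t mult_right_mono[of "M * C1" C t] by (simp add: mult_ac)
    finally have 1: "frobenius_norm h \<le> C * t" .
    have "adj h ** g = adj (D ** h) ** (D ** g)"
      by (simp add: adj_mult_distrib adj_mult_cancel(1)[OF D(1)] flip: matrix_mul_assoc)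
    then have "frobenius_norm (adj h ** g) \<le> frobenius_norm (D ** h) * frobenius_norm (D ** g)"
      using frobenius_norm_mult[of "adj (D ** h)" "D ** g"] by simp
    also have "\<dots> \<le> C1 * (M * L / t)" using fDg h(2) C1nn by (intro mult_mono) auto
    also have "\<dots> = (M * C1) * (L / t)" by simp
    also have "\<dots> \<le> C * (L / t)" using C(2) L t by (intro mult_right_mono) auto
    finally have 2: "frobenius_norm (adj h ** g) \<le> C * frobenius_norm g / t" by (simp add: L_def)
    show ?thesis using h(1) 1 2 by blast
  qed
  then show ?thesis using C(1) by (intro exI[of _ C]) auto
qed

end

section \<open>The orbit in the unit disc\<close>

definition orbit_pt :: "int^2^2 \<Rightarrow> complex" where
  "orbit_pt g = cayley (act g \<i>)"

definition disc_num :: "int^2^2 \<Rightarrow> complex" where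
  "disc_num g = Complex (g$1$2 + g$2$1) (g$1$1 - g$2$2)"

definition disc_den :: "int^2^2 \<Rightarrow> complex" where
  "disc_den g = Complex (g$1$2 - g$2$1) (g$1$1 + g$2$2)"

lemma cmod_disc_num: "det g = 1 \<Longrightarrow> (cmod (disc_num g))\<^sup>2 = frob_sq g - 2"
proof -
  assume "det g = 1"
  then have "frob_sq g - 2 = (g$1$2 + g$2$1)\<^sup>2 + (g$1$1 - g$2$2)\<^sup>2"
    by (simp add: frob_sq_def det_2 power2_eq_square algebra_simps)
  then show ?thesis unfolding cmod_power2 disc_num_def by (simp flip: of_int_add of_int_diff of_int_power)
qed

lemma cmod_disc_den: "det g = 1 \<Longrightarrow> (cmod (disc_den g))\<^sup>2 = frob_sq g + 2"
proof -
  assume "det g = 1"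
  then have "frob_sq g + 2 = (g$1$2 - g$2$1)\<^sup>2 + (g$1$1 + g$2$2)\<^sup>2"
    by (simp add: frob_sq_def det_2 power2_eq_square algebra_simps)
  then show ?thesis unfolding cmod_power2 disc_den_def by (simp flip: of_int_add of_int_diff of_int_power)
qed

lemma disc_den_nonzero: "det g = 1 \<Longrightarrow> disc_den g \<noteq> 0"
  using cmod_disc_den[of g] frob_sq_nonneg[of g] by (auto simp del: frob_sq_nonneg)

lemma orbit_pt_eq:
  assumes "det g = 1"
  shows "orbit_pt g = disc_num g / disc_den g"
proof -
  let ?a = "of_int (g$1$1) :: complex" and ?b = "of_int (g$1$2) :: complex"
    and ?c = "of_int (g$2$1) :: complex" and ?d = "of_int (g$2$2) :: complex"
  have nz: "?c * \<i> + ?d \<noteq> 0"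
  proof
    assume "?c * \<i> + ?d = 0"
    then have "g$2$1 = 0" "g$2$2 = 0" by (auto simp: complex_eq_iff)
    then show False using assms by (simp add: det_2)
  qed
  have n: "disc_num g = (?a * \<i> + ?b) - \<i> * (?c * \<i> + ?d)"
    by (simp add: disc_num_def complex_eq_iff)
  have d: "disc_den g = (?a * \<i> + ?b) + \<i> * (?c * \<i> + ?d)"
    by (simp add: disc_den_def complex_eq_iff)
  have "orbit_pt g = ((?a * \<i> + ?b) / (?c * \<i> + ?d) - \<i>) / ((?a * \<i> + ?b) / (?c * \<i> + ?d) + \<i>)"
    by (simp add: orbit_pt_def cayley_def act_def moebius_def)
  also have "\<dots> = disc_num g / disc_den g"
  proof -
    have "(u / w - \<i>) / (u / w + \<i>) = (u - \<i> * w) / (u + \<i> * w)" if "w \<noteq> 0" for u w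
    proof -
      have "u / w - \<i> = (u - \<i> * w) / w" "u / w + \<i> = (u + \<i> * w) / w"
        using that by (simp_all add: diff_divide_distrib add_divide_distrib)
      then show ?thesis using that by simp
    qed
    then show ?thesis unfolding n d using nz by blast
  qed
  finally show ?thesis .
qed

text \<open>The modulus is tanh(d/2), where |g|^2 = 2 cosh d.\<close>

lemma cmod_orbit_pt:
  assumes "det g = 1"
  shows "1 - (cmod (orbit_pt g))\<^sup>2 = 4 / ((frobenius_norm g)\<^sup>2 + 2)"
proof -
  have "frob_sq g + 2 > 0" using frob_sq_nonneg[of g] by linarith
  then have p: "real_of_int (frob_sq g) + 2 > 0" by linarith
  have "(cmod (orbit_pt g))\<^sup>2 = (real_of_int (frob_sq g) - 2) / (frob_sq g + 2)"
    unfolding orbit_pt_eq[OF assms] norm_divide power_divide cmod_disc_num[OF assms] cmod_disc_den[OF assms] by simp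
  then show ?thesis using p unfolding frobenius_norm_sq by (simp add: field_simps)
qed

lemma cmod_orbit_pt_less: "det g = 1 \<Longrightarrow> cmod (orbit_pt g) < 1"
proof -
  assume d: "det g = 1"
  have "4 / ((frobenius_norm g)\<^sup>2 + 2) > 0" by (intro divide_pos_pos add_nonneg_pos) auto
  then have "(cmod (orbit_pt g))\<^sup>2 < 1\<^sup>2" unfolding cmod_orbit_pt[OF d, symmetric] by simp
  then show ?thesis by (rule power2_less_imp_less) simp
qed

text \<open>In the disc, |z - w|^2 = (1 - |z|^2) (1 - |w|^2) sinh^2(d(z,w)/2). All three factors are
  expressed by norms; the distance of the two orbit points is that of i from its image under g^(-1)
  h.\<close>

lemma cmod_orbit_pt_diff:
  assumes g: "det g = 1" and h: "det h = 1"
  shows "(cmod (orbit_pt g - orbit_pt h))\<^sup>2 * (((frobenius_norm g)\<^sup>2 + 2) * ((frobenius_norm h)\<^sup>2 + 2))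
     = 4 * ((frobenius_norm (adj g ** h))\<^sup>2 - 2)"
proof -
  define e where "e = adj g ** h"
  have "det e = 1" using g h by (simp add: e_def det_mul)
  then have e: "frob_sq e - 2 = (e$1$2 + e$2$1)\<^sup>2 + (e$2$2 - e$1$1)\<^sup>2"
    by (simp add: frob_sq_def det_2 power2_eq_square algebra_simps)
  have "(cmod (disc_num g * disc_den h - disc_num h * disc_den g))\<^sup>2
    = real_of_int (4 * ((e$1$2 + e$2$1)\<^sup>2 + (e$2$2 - e$1$1)\<^sup>2))"
    unfolding cmod_power2 disc_num_def disc_den_def e_def mult_nth adj_def
    by (simp add: power2_eq_square algebra_simps)
  also have "\<dots> = 4 * ((frobenius_norm e)\<^sup>2 - 2)"
    unfolding e[symmetric] frobenius_norm_sq by simp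
  finally have num: "(cmod (disc_num g * disc_den h - disc_num h * disc_den g))\<^sup>2 = 4 * ((frobenius_norm e)\<^sup>2 - 2)" .
  have "orbit_pt g - orbit_pt h = (disc_num g * disc_den h - disc_num h * disc_den g) / (disc_den g * disc_den h)"
    unfolding orbit_pt_eq[OF g] orbit_pt_eq[OF h]
    by (rule diff_frac_eq[OF disc_den_nonzero[OF g] disc_den_nonzero[OF h]])
  then have "(orbit_pt g - orbit_pt h) * (disc_den g * disc_den h) = disc_num g * disc_den h - disc_num h * disc_den g"
    using disc_den_nonzero[OF g] disc_den_nonzero[OF h] by simp
  then have "(cmod (orbit_pt g - orbit_pt h))\<^sup>2 * ((cmod (disc_den g))\<^sup>2 * (cmod (disc_den h))\<^sup>2)
     = (cmod (disc_num g * disc_den h - disc_num h * disc_den g))\<^sup>2"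
    by (metis norm_mult power_mult_distrib)
  then show ?thesis
    unfolding num cmod_disc_den[OF g] cmod_disc_den[OF h] e_def frobenius_norm_sq by simp
qed

lemma finite_orbit_pt_le:
  assumes "c < 1"
  shows "finite {g. det g = 1 \<and> cmod (orbit_pt g) \<le> c}"
proof (rule finite_subset[OF _ finite_frob_sq_le[of "\<lceil>4 / (1 - c\<^sup>2)\<rceil>"]], clarify)
  fix g assume g: "det g = 1" "cmod (orbit_pt g) \<le> c"
  have c: "0 \<le> c" using g(2) norm_ge_zero[of "orbit_pt g"] by linarith
  have c2: "1 - c\<^sup>2 > 0" using c assms by (simp add: power_less_one_iff abs_square_less_1)
  have "(cmod (orbit_pt g))\<^sup>2 \<le> c\<^sup>2" using g(2) by (intro power_mono) auto
  then have "1 - c\<^sup>2 \<le> 4 / ((frobenius_norm g)\<^sup>2 + 2)" using cmod_orbit_pt[OF g(1)] by linarith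
  moreover have p: "(frobenius_norm g)\<^sup>2 + 2 > 0" by (intro add_nonneg_pos) auto
  ultimately have "(1 - c\<^sup>2) * ((frobenius_norm g)\<^sup>2 + 2) \<le> 4" by (simp add: pos_le_divide_eq)
  then have "(frobenius_norm g)\<^sup>2 + 2 \<le> 4 / (1 - c\<^sup>2)" using c2 by (simp add: pos_le_divide_eq mult.commute)
  then show "frob_sq g \<le> \<lceil>4 / (1 - c\<^sup>2)\<rceil>" unfolding frobenius_norm_sq by linarith
qed

lemma compact_limit_set: "compact (limit_set S)"
proof -
  have "limit_set S = sphere 0 1 \<inter> {\<zeta>. \<zeta> islimpt (\<lambda>g. cayley (act g \<i>)) ` S}"
    by (auto simp: limit_set_def)
  then show ?thesis using compact_Int_closed[OF compact_sphere closed_limpts] by metis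
qed

section \<open>Shadows and covers of the limit set\<close>

lemma frobenius_norm_sq_ge_2: "det g = 1 \<Longrightarrow> 2 \<le> (frobenius_norm g)\<^sup>2"
  using frob_sq_ge_2[of g] unfolding frobenius_norm_sq by linarith

text \<open>A point g of norm at most C \<rho>^(-1/2) near \<zeta> lies close to every geodesic that
  ends within \<rho> of \<zeta>, so splitting off g from h gains the factor
  \<open>sqrt \<rho>\<close>. The distance formula shows this up to an additive 2.\<close>

lemma norm_shadow:
  assumes g: "det g = 1" and h: "det h = 1" and z: "cmod \<zeta> = 1" and \<rho>: "0 < \<rho>" and C: "0 \<le> C"
    and gz: "cmod (orbit_pt g - \<zeta>) \<le> C * \<rho>" and hz: "cmod (orbit_pt h - \<zeta>) < \<rho>"
    and gC: "frobenius_norm g \<le> C / sqrt \<rho>"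
  shows "frobenius_norm (adj g ** h) \<le> sqrt (2 + (C + 1)\<^sup>2 * C\<^sup>2) * sqrt \<rho> * frobenius_norm h"
proof (rule power2_le_imp_le)
  define G H F where GHF: "G = (frobenius_norm g)\<^sup>2" "H = (frobenius_norm h)\<^sup>2" "F = (frobenius_norm (adj g ** h))\<^sup>2"
  have G2: "2 \<le> G" and H2: "2 \<le> H" using frobenius_norm_sq_ge_2[OF g] frobenius_norm_sq_ge_2[OF h] by (simp_all add: GHF)
  have GC: "G \<le> C\<^sup>2 / \<rho>"
  proof -
    have "G \<le> (C / sqrt \<rho>)\<^sup>2" unfolding GHF using gC by (intro power_mono) auto
    then show ?thesis using \<rho> by (simp add: power_divide)
  qed
  have "cmod (orbit_pt g - orbit_pt h) \<le> cmod (orbit_pt g - \<zeta>) + cmod (orbit_pt h - \<zeta>)"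
    using norm_triangle_ineq4[of "orbit_pt g - \<zeta>" "orbit_pt h - \<zeta>"] by simp
  also have "\<dots> \<le> (C + 1) * \<rho>" using gz hz by (simp add: distrib_right)
  finally have "(cmod (orbit_pt g - orbit_pt h))\<^sup>2 \<le> ((C + 1) * \<rho>)\<^sup>2" by (intro power_mono) auto
  then have d: "(cmod (orbit_pt g - orbit_pt h))\<^sup>2 \<le> (C + 1)\<^sup>2 * \<rho>\<^sup>2" by (simp add: power_mult_distrib)
  have "4 * (F - 2) = (cmod (orbit_pt g - orbit_pt h))\<^sup>2 * ((G + 2) * (H + 2))"
    using cmod_orbit_pt_diff[OF g h] by (simp add: GHF)
  also have "\<dots> \<le> ((C + 1)\<^sup>2 * \<rho>\<^sup>2) * ((2 * (C\<^sup>2 / \<rho>)) * (2 * H))"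
    using G2 H2 GC d by (intro mult_mono) auto
  also have "\<dots> = 4 * ((C + 1)\<^sup>2 * C\<^sup>2 * \<rho> * H)"
    using \<rho> by (simp add: power2_eq_square)
  finally have F: "F \<le> 2 + (C + 1)\<^sup>2 * C\<^sup>2 * \<rho> * H" by argo
  \<comment> \<open>An orbit point within \<rho> of the circle has squared norm at least 1 / \<rho>,
    which absorbs the additive 2 in \<open>F\<close>.\<close>
  have "1 \<le> \<rho> * H"
  proof -
    have "1 - cmod (orbit_pt h) \<le> \<rho>"
      using norm_triangle_ineq2[of \<zeta> "orbit_pt h"] hz z by (simp add: norm_minus_commute)
    moreover have "cmod (orbit_pt h) < 1" by (rule cmod_orbit_pt_less[OF h])
    ultimately have "(1 - cmod (orbit_pt h)) * (1 + cmod (orbit_pt h)) \<le> \<rho> * 2" by (intro mult_mono) auto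
    then have "1 - (cmod (orbit_pt h))\<^sup>2 \<le> 2 * \<rho>" by (simp add: power2_eq_square algebra_simps)
    then have "4 / (H + 2) \<le> 2 * \<rho>" using cmod_orbit_pt[OF h] by (simp add: GHF)
    then have "4 \<le> 2 * \<rho> * (H + 2)" using H2 by (simp add: pos_divide_le_eq)
    also have "\<dots> \<le> 2 * \<rho> * (2 * H)" using H2 \<rho> by (intro mult_left_mono) auto
    finally show ?thesis by simp
  qed
  then have "F \<le> 2 * (\<rho> * H) + (C + 1)\<^sup>2 * C\<^sup>2 * \<rho> * H" using F by linarith
  also have "\<dots> = (2 + (C + 1)\<^sup>2 * C\<^sup>2) * \<rho> * H" by (simp add: algebra_simps)
  also have "\<dots> = (sqrt (2 + (C + 1)\<^sup>2 * C\<^sup>2) * sqrt \<rho> * frobenius_norm h)\<^sup>2"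
    using \<rho> C by (simp add: power_mult_distrib GHF)
  finally show "(frobenius_norm (adj g ** h))\<^sup>2 \<le> (sqrt (2 + (C + 1)\<^sup>2 * C\<^sup>2) * sqrt \<rho> * frobenius_norm h)\<^sup>2"
    by (simp add: GHF)
qed (use \<rho> C in \<open>auto simp: add_nonneg_nonneg\<close>)

text \<open>The sets in the definition are arbitrary and may have diameter 0. Those meeting S are
  enlarged to open balls centred in S, with radii slightly above the diameters, so that compactness
  leaves finitely many.\<close>

lemma hausdorff_null_cover:
  fixes S :: "'a::metric_space set"
  assumes null: "hausdorff_measure s S = 0" and s: "0 < s" and S: "compact S" and r: "0 < r" and \<eta>: "0 < \<eta>"
  obtains J :: "nat set" and z :: "nat \<Rightarrow> 'a" and \<rho> :: "nat \<Rightarrow> real"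
  where "finite J" "\<And>j. j \<in> J \<Longrightarrow> z j \<in> S" "\<And>j. j \<in> J \<Longrightarrow> 0 < \<rho> j" "\<And>j. j \<in> J \<Longrightarrow> \<rho> j \<le> r"
    "S \<subseteq> (\<Union>j\<in>J. ball (z j) (\<rho> j))" "(\<Sum>j\<in>J. \<rho> j powr s) \<le> \<eta>"
proof -
  have "hausdorff_premeasure s (r/2) S \<le> hausdorff_measure s S"
    unfolding hausdorff_measure_def using r by (intro SUP_upper) auto
  then have "hausdorff_premeasure s (r/2) S < ennreal (\<eta>/2)" using null \<eta> by simp
  then obtain U where U: "S \<subseteq> (\<Union>n. U n)" "\<And>n. bounded (U n)" "\<And>n. diameter (U n) \<le> r/2"
    and sumU: "(\<Sum>n. ennreal (diameter (U n) powr s)) < ennreal (\<eta>/2)"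
    unfolding hausdorff_premeasure_def INF_less_iff by auto
  \<comment> \<open>Half of \<open>\<eta>\<close> is reserved for the errors of enlargement, which
    form a geometric series. Continuity of the power at diameter 0 relies on s > 0.\<close>
  define e where "e n = \<eta>/2 * (1/2)^(Suc n)" for n
  have e: "e n > 0" for n using \<eta> by (simp add: e_def)
  have "\<exists>\<rho>. diameter (U n) < \<rho> \<and> \<rho> \<le> r \<and> \<rho> powr s \<le> diameter (U n) powr s + e n" for n
  proof -
    let ?d = "diameter (U n)"
    have d: "0 \<le> ?d" using U(2) by (rule diameter_ge_0)
    have "((\<lambda>x. x powr s) \<longlongrightarrow> ?d powr s) (at_right ?d)"
    proof (rule tendsto_powr')
      show "((\<lambda>x. x) \<longlongrightarrow> ?d) (at_right ?d)" by (rule tendsto_ident_at)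
      have "\<forall>\<^sub>F x in at_right ?d. ?d < x" by (rule eventually_at_right_less)
      then have "\<forall>\<^sub>F x in at_right ?d. 0 \<le> x" by eventually_elim (use d in linarith)
      then show "?d \<noteq> 0 \<or> 0 < s \<and> (\<forall>\<^sub>F x in at_right ?d. 0 \<le> x)" using s by simp
    qed (rule tendsto_const)
    then have "\<forall>\<^sub>F x in at_right ?d. x powr s < ?d powr s + e n"
      by (rule order_tendstoD) (use e[of n] in simp)
    moreover have "\<forall>\<^sub>F x in at_right ?d. x < r"
      using U(3)[of n] r by (intro order_tendstoD(2)[OF tendsto_ident_at]) simp
    moreover have "\<forall>\<^sub>F x in at_right ?d. ?d < x" by (rule eventually_at_right_less)
    ultimately have "\<forall>\<^sub>F x in at_right ?d. ?d < x \<and> x \<le> r \<and> x powr s \<le> ?d powr s + e n"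
      by eventually_elim simp
    then show ?thesis using eventually_happens'[OF trivial_limit_at_right_real] by blast
  qed
  then have "\<forall>n. \<exists>\<rho>. diameter (U n) < \<rho> \<and> \<rho> \<le> r \<and> \<rho> powr s \<le> diameter (U n) powr s + e n" by blast
  from choice[OF this] obtain \<rho> where \<rho>: "\<And>n. diameter (U n) < \<rho> n" "\<And>n. \<rho> n \<le> r" "\<And>n. \<rho> n powr s \<le> diameter (U n) powr s + e n"
    by blast
  define T where "T = {n. U n \<inter> S \<noteq> {}}"
  define z where "z n = (SOME x. x \<in> U n \<inter> S)" for n
  have z: "z n \<in> U n \<inter> S" if "n \<in> T" for n
  proof -
    have "\<exists>x. x \<in> U n \<inter> S" using that by (auto simp: T_def)
    then show ?thesis unfolding z_def by (rule someI_ex)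
  qed
  have "S \<subseteq> (\<Union>n\<in>T. ball (z n) (\<rho> n))"
  proof
    fix x assume x: "x \<in> S"
    then obtain n where n: "x \<in> U n" using U(1) by auto
    then have nT: "n \<in> T" using x by (auto simp: T_def)
    have "dist (z n) x \<le> diameter (U n)"
      using diameter_bounded_bound[OF U(2)] z[OF nT] n by auto
    then show "x \<in> (\<Union>n\<in>T. ball (z n) (\<rho> n))" using \<rho>(1)[of n] nT by (auto intro!: bexI[of _ n])
  qed
  then obtain J where J: "J \<subseteq> T" "finite J" "S \<subseteq> (\<Union>n\<in>J. ball (z n) (\<rho> n))"
    using compactE_image[OF S, of T "\<lambda>n. ball (z n) (\<rho> n)"] by auto
  have "(\<Sum>j\<in>J. \<rho> j powr s) \<le> (\<Sum>j\<in>J. diameter (U j) powr s) + (\<Sum>j\<in>J. e j)"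
    unfolding sum.distrib[symmetric] by (intro sum_mono \<rho>(3))
  also have "(\<Sum>j\<in>J. diameter (U j) powr s) \<le> \<eta>/2"
  proof -
    have "ennreal (\<Sum>j\<in>J. diameter (U j) powr s) = (\<Sum>j\<in>J. ennreal (diameter (U j) powr s))"
      by (simp add: sum_ennreal)
    also have "\<dots> \<le> (\<Sum>n. ennreal (diameter (U n) powr s))"
      by (rule sum_le_suminf) (use J(2) in auto)
    also have "\<dots> \<le> ennreal (\<eta>/2)" using sumU by simp
    finally show ?thesis using \<eta> by (subst (asm) ennreal_le_iff) auto
  qed
  also have "(\<Sum>j\<in>J. e j) \<le> \<eta>/2"
  proof -
    have "(\<lambda>n. (1/2::real)^(Suc n)) sums 1" by (rule power_half_series)
    from sums_mult[OF this, of "\<eta>/2"] have sm: "e sums (\<eta>/2)" unfolding e_def[abs_def] by simp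
    have "(\<Sum>j\<in>J. e j) \<le> (\<Sum>n. e n)"
      using sm J(2) e by (intro sum_le_suminf) (auto simp: sums_iff less_imp_le)
    then show ?thesis using sm by (simp add: sums_iff)
  qed
  finally have "(\<Sum>j\<in>J. \<rho> j powr s) \<le> \<eta>" by simp
  moreover have "0 < \<rho> j" for j using \<rho>(1)[of j] diameter_ge_0[OF U(2)[of j]] by linarith
  ultimately show ?thesis using that[of J z \<rho>] J z \<rho>(2) by blast
qed

section \<open>Counting orbit points\<close>

text \<open>By discreteness a disc of radius below 1 contains the orbit points of finitely many
  elements only. Infinitely many elements outside V would thus have an accumulation point on the
  circle, a limit point outside the open set V.\<close>

lemma (in nonparabolic_group) finite_orbit_outside:
  assumes V: "open V" "limit_set G \<subseteq> V"
  shows "finite {g \<in> G. orbit_pt g \<notin> V}"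
proof (rule ccontr)
  define A where "A = {g \<in> G. orbit_pt g \<notin> V}"
  assume "infinite {g \<in> G. orbit_pt g \<notin> V}"
  then have A: "infinite A" by (simp add: A_def)
  have few: "finite (A \<inter> orbit_pt -` W)" if "\<And>w. w \<in> W \<Longrightarrow> cmod w \<le> c" "c < 1" for W c
    by (rule finite_subset[OF _ finite_orbit_pt_le[OF that(2)]]) (use that(1) det_G in \<open>auto simp: A_def\<close>)
  have "infinite (orbit_pt ` A)"
  proof
    assume "finite (orbit_pt ` A)"
    moreover have "A \<subseteq> (\<Union>w\<in>orbit_pt ` A. A \<inter> orbit_pt -` {w})" by auto
    moreover have "finite (A \<inter> orbit_pt -` {w})" if "w \<in> orbit_pt ` A" for w
      using that cmod_orbit_pt_less det_G by (intro few[of _ "cmod w"]) (auto simp: A_def)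
    ultimately have "finite A" by (meson finite_UN_I finite_subset)
    then show False using A by simp
  qed
  moreover have "orbit_pt ` A \<subseteq> cball 0 1"
  proof (rule image_subsetI)
    fix g assume "g \<in> A"
    then have "cmod (orbit_pt g) < 1" using cmod_orbit_pt_less det_G by (simp add: A_def)
    then show "orbit_pt g \<in> cball 0 1" by simp
  qed
  ultimately obtain \<zeta> where \<zeta>: "\<zeta> \<in> cball 0 1" "\<zeta> islimpt (orbit_pt ` A)"
    using Heine_Borel_imp_Bolzano_Weierstrass[OF compact_cball] by metis
  have "\<not> cmod \<zeta> < 1"
  proof
    assume lt: "cmod \<zeta> < 1"
    define e where "e = (1 - cmod \<zeta>) / 2"
    have e: "e > 0" using lt by (simp add: e_def)
    have "cmod w \<le> (1 + cmod \<zeta>) / 2" if "w \<in> ball \<zeta> e" for w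
    proof -
      have "cmod w \<le> cmod \<zeta> + cmod (w - \<zeta>)" by norm
      also have "cmod (w - \<zeta>) < e" using that by (simp add: dist_norm norm_minus_commute)
      finally show ?thesis by (simp add: e_def field_simps)
    qed
    then have "finite (A \<inter> orbit_pt -` ball \<zeta> e)" using lt by (intro few[of _ "(1 + cmod \<zeta>) / 2"]) auto
    then have "finite (orbit_pt ` (A \<inter> orbit_pt -` ball \<zeta> e))" by (rule finite_imageI)
    moreover have "orbit_pt ` (A \<inter> orbit_pt -` ball \<zeta> e) = orbit_pt ` A \<inter> ball \<zeta> e" by auto
    ultimately show False using \<zeta>(2) e unfolding islimpt_eq_infinite_ball by simp
  qed
  then have sph: "\<zeta> \<in> sphere 0 1" using \<zeta>(1) by simp
  have "orbit_pt ` A \<subseteq> (\<lambda>g. cayley (act g \<i>)) ` G"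
    by (auto simp: A_def orbit_pt_def)
  then have "\<zeta> \<in> limit_set G"
    using sph islimpt_subset[OF \<zeta>(2)] by (simp add: limit_set_def)
  then have "\<zeta> \<in> V" using V by blast
  moreover have "\<zeta> islimpt (- V)"
    by (rule islimpt_subset[OF \<zeta>(2)]) (auto simp: A_def)
  then have "\<zeta> \<in> - V" using V(1) by (metis closed_limpt closed_Compl)
  ultimately show False by simp
qed

text \<open>Orbit points near \<zeta> may have arbitrarily large norm. From one of norm at least t =
  \<rho>^(-1/2), quasiconvexity goes back to some h at parameter t; as |h| is at least t / C, the
  distance formula puts the two orbit points within a multiple of t^(-2) = \<rho>.\<close>

lemma (in nonparabolic_group) conical:
  "\<exists>C>0. \<forall>\<zeta>\<in>limit_set G. \<forall>\<rho>. 0 < \<rho> \<longrightarrow> \<rho> \<le> 1 \<longrightarrow>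
     (\<exists>g\<in>G. frobenius_norm g \<le> C / sqrt \<rho> \<and> cmod (orbit_pt g - \<zeta>) \<le> C * \<rho>)"
proof -
  obtain C where C: "C > 0" and qc: "\<forall>g\<in>G. \<forall>t. 1 \<le> t \<longrightarrow> t \<le> frobenius_norm g \<longrightarrow>
     (\<exists>h\<in>G. frobenius_norm h \<le> C * t \<and> frobenius_norm (adj h ** g) \<le> C * frobenius_norm g / t)"
    using quasiconvex by (elim exE conjE)
  have "\<exists>g\<in>G. frobenius_norm g \<le> (C + 2 * C\<^sup>2 + 1) / sqrt \<rho> \<and> cmod (orbit_pt g - \<zeta>) \<le> (C + 2 * C\<^sup>2 + 1) * \<rho>"
    if \<zeta>: "\<zeta> \<in> limit_set G" and \<rho>: "0 < \<rho>" "\<rho> \<le> 1" for \<zeta> \<rho>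
  proof -
    define t where "t = 1 / sqrt \<rho>"
    have t: "1 \<le> t" using \<rho> by (simp add: t_def)
    have t2: "t\<^sup>2 = 1 / \<rho>" using \<rho> by (simp add: t_def power_divide)
    have "\<zeta> islimpt orbit_pt ` G" using \<zeta> by (simp add: limit_set_def orbit_pt_def[abs_def])
    then have "infinite (orbit_pt ` G \<inter> ball \<zeta> \<rho>)" using \<rho> by (simp add: islimpt_eq_infinite_ball)
    moreover have "finite (orbit_pt ` {g. frobenius_norm g < t})"
      by (intro finite_imageI finite_frobenius_norm_less)
    ultimately have "\<not> orbit_pt ` G \<inter> ball \<zeta> \<rho> \<subseteq> orbit_pt ` {g. frobenius_norm g < t}"
      using finite_subset by blast
    then obtain g where g: "g \<in> G" "orbit_pt g \<in> ball \<zeta> \<rho>" "t \<le> frobenius_norm g"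
      by (force simp: not_less)
    define L where "L = frobenius_norm g"
    have L: "0 < L" using frobenius_norm_pos[OF det_G[OF g(1)]] by (simp add: L_def)
    obtain h where h: "h \<in> G" "frobenius_norm h \<le> C * t" "frobenius_norm (adj h ** g) \<le> C * L / t"
      using qc g(1,3) t unfolding L_def by blast
    define H where "H = frobenius_norm h"
    have H: "0 < H" using frobenius_norm_pos[OF det_G[OF h(1)]] by (simp add: H_def)
    have "L \<le> H * frobenius_norm (adj h ** g)"
      using frobenius_norm_mult_left[of "adj h" g] det_G[OF h(1)] by (simp add: L_def H_def)
    also have "\<dots> \<le> H * (C * L / t)" using h(3) H by (intro mult_left_mono) auto
    finally have "L * t \<le> (H * C) * L" using t by (simp add: field_simps)
    then have tH: "t \<le> H * C" using L by (simp add: mult.commute)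
    have "(cmod (orbit_pt h - orbit_pt g))\<^sup>2 * (H\<^sup>2 * L\<^sup>2) \<le> (cmod (orbit_pt h - orbit_pt g))\<^sup>2 * ((H\<^sup>2 + 2) * (L\<^sup>2 + 2))"
      by (intro mult_left_mono mult_mono) auto
    also have "\<dots> = 4 * ((frobenius_norm (adj h ** g))\<^sup>2 - 2)"
      using cmod_orbit_pt_diff[OF det_G[OF h(1)] det_G[OF g(1)]] by (simp add: H_def L_def)
    also have "\<dots> \<le> 4 * (C * L / t)\<^sup>2"
      using power_mono[OF h(3) frobenius_norm_nonneg, of 2] by simp
    finally have "((cmod (orbit_pt h - orbit_pt g)) * H)\<^sup>2 * L\<^sup>2 \<le> (2 * C / t)\<^sup>2 * L\<^sup>2"
      by (simp add: power_mult_distrib power_divide mult_ac)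
    then have "((cmod (orbit_pt h - orbit_pt g)) * H)\<^sup>2 \<le> (2 * C / t)\<^sup>2" using L by simp
    then have "cmod (orbit_pt h - orbit_pt g) * H \<le> 2 * C / t"
      by (rule power2_le_imp_le) (use C t in auto)
    then have "(cmod (orbit_pt h - orbit_pt g) * H) * C \<le> (2 * C / t) * C"
      using C by (intro mult_right_mono) auto
    moreover have "cmod (orbit_pt h - orbit_pt g) * t \<le> cmod (orbit_pt h - orbit_pt g) * (H * C)"
      using tH by (intro mult_left_mono) auto
    ultimately have "cmod (orbit_pt h - orbit_pt g) * t \<le> (2 * C / t) * C"
      by (simp add: mult.assoc)
    then have "cmod (orbit_pt h - orbit_pt g) \<le> 2 * C\<^sup>2 / t\<^sup>2"
      using t by (simp add: field_simps power2_eq_square)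
    then have d: "cmod (orbit_pt h - orbit_pt g) \<le> 2 * C\<^sup>2 * \<rho>" by (simp add: t2)
    have "cmod (orbit_pt h - \<zeta>) \<le> cmod (orbit_pt h - orbit_pt g) + cmod (orbit_pt g - \<zeta>)" by norm
    also have "\<dots> \<le> 2 * C\<^sup>2 * \<rho> + 1 * \<rho>" using d g(2) by (simp add: dist_norm norm_minus_commute)
    also have "\<dots> \<le> (C + 2 * C\<^sup>2 + 1) * \<rho>" unfolding distrib_right using C \<rho> by simp
    finally have 1: "cmod (orbit_pt h - \<zeta>) \<le> (C + 2 * C\<^sup>2 + 1) * \<rho>" .
    have "frobenius_norm h \<le> C / sqrt \<rho>" using h(2) by (simp add: t_def)
    also have "\<dots> \<le> (C + 2 * C\<^sup>2 + 1) / sqrt \<rho>" using \<rho> by (intro divide_right_mono) auto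
    finally show ?thesis using 1 h(1) by blast
  qed
  moreover have "C + 2 * C\<^sup>2 + 1 > 0" using C by (simp add: add_pos_pos)
  ultimately show ?thesis by blast
qed

section \<open>Growth of the group\<close>

context nonparabolic_group begin

definition ball_count :: "real \<Rightarrow> nat" where
  "ball_count T = card {g \<in> G. frobenius_norm g < T}"

lemma finite_ball: "finite {g \<in> G. frobenius_norm g < T}"
  by (rule finite_subset[OF _ finite_frobenius_norm_less[of T]]) auto

lemma ball_count_small: "T \<le> 1 \<Longrightarrow> ball_count T = 0"
proof -
  assume "T \<le> 1"
  then have "{g \<in> G. frobenius_norm g < T} = {}" using frobenius_norm_gt_1 det_G by fastforce
  then show ?thesis unfolding ball_count_def by (simp only: card.empty)
qed

text \<open>All but finitely many orbit points lie in one of the balls covering the limit set, and an orbit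
  point in the \<open>j\<close>-th ball is the product of a fixed element \<open>g\<^sub>j\<close> of norm about \<open>\<rho>\<^sub>j\<^sup>-\<^sup>1\<^sup>/\<^sup>2\<close> with an
  element that is smaller by the same factor.\<close>

lemma ball_count_recursion:
  assumes s: "0 < s" and null: "hausdorff_measure s (limit_set G) = 0"
  obtains J :: "nat set" and c :: "nat \<Rightarrow> real" and N0 :: nat
  where "finite J" "\<And>j. j \<in> J \<Longrightarrow> 0 < c j" "\<And>j. j \<in> J \<Longrightarrow> c j \<le> 1/2" "(\<Sum>j\<in>J. c j powr (2 * s)) \<le> 1/2"
    "\<And>T. ball_count T \<le> N0 + (\<Sum>j\<in>J. ball_count (c j * T))"
proof -
  obtain C where C: "C > 0" and con: "\<forall>\<zeta>\<in>limit_set G. \<forall>\<rho>. 0 < \<rho> \<longrightarrow> \<rho> \<le> 1 \<longrightarrow>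
     (\<exists>g\<in>G. frobenius_norm g \<le> C / sqrt \<rho> \<and> cmod (orbit_pt g - \<zeta>) \<le> C * \<rho>)"
    using conical by (elim exE conjE)
  define K where "K = sqrt (2 + (C + 1)\<^sup>2 * C\<^sup>2)"
  have K: "K > 0" by (simp add: K_def add_pos_nonneg)
  \<comment> \<open>\<open>r\<close> forces every factor \<open>c j\<close> below 1/2, and
    \<open>\<eta>\<close> forces the sum of \<open>c j powr (2 * s)\<close> below 1/2.\<close>
  define r where "r = min 1 ((1 / (2 * K))\<^sup>2)"
  have r: "0 < r" "r \<le> 1" "r \<le> (1 / (2 * K))\<^sup>2" using K by (auto simp: r_def)
  define \<eta> where "\<eta> = 1 / (2 * K powr (2 * s))"
  have \<eta>: "\<eta> > 0" using K by (simp add: \<eta>_def)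
  obtain J :: "nat set" and z \<rho> where J: "finite J" "\<And>j. j \<in> J \<Longrightarrow> z j \<in> limit_set G"
    "\<And>j. j \<in> J \<Longrightarrow> 0 < \<rho> j" "\<And>j. j \<in> J \<Longrightarrow> \<rho> j \<le> r"
    "limit_set G \<subseteq> (\<Union>j\<in>J. ball (z j) (\<rho> j))" "(\<Sum>j\<in>J. \<rho> j powr s) \<le> \<eta>"
    using hausdorff_null_cover[OF null s compact_limit_set r(1) \<eta>] by blast
  define c where "c j = K * sqrt (\<rho> j)" for j
  have c: "0 < c j" "c j \<le> 1/2" if "j \<in> J" for j
  proof -
    show "0 < c j" using K J(3)[OF that] by (simp add: c_def)
    have "sqrt (\<rho> j) \<le> sqrt ((1 / (2 * K))\<^sup>2)" using J(4)[OF that] r by (intro real_sqrt_le_mono) simp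
    then have "sqrt (\<rho> j) \<le> 1 / (2 * K)" using K by simp
    then have "K * sqrt (\<rho> j) \<le> K * (1 / (2 * K))" using K by (intro mult_left_mono) auto
    then show "c j \<le> 1/2" using K by (simp add: c_def)
  qed
  have csum: "(\<Sum>j\<in>J. c j powr (2 * s)) \<le> 1/2"
  proof -
    have "(\<Sum>j\<in>J. c j powr (2 * s)) = (\<Sum>j\<in>J. K powr (2 * s) * \<rho> j powr s)"
    proof (rule sum.cong)
      fix j assume j: "j \<in> J"
      have "sqrt (\<rho> j) powr (2 * s) = \<rho> j powr s"
        using J(3)[OF j] by (simp add: powr_half_sqrt[symmetric] powr_powr)
      then show "c j powr (2 * s) = K powr (2 * s) * \<rho> j powr s"
        using K J(3)[OF j] by (simp add: c_def powr_mult)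
    qed simp
    also have "\<dots> = K powr (2 * s) * (\<Sum>j\<in>J. \<rho> j powr s)" by (simp add: sum_distrib_left)
    also have "\<dots> \<le> K powr (2 * s) * \<eta>" using J(6) by (intro mult_left_mono) auto
    also have "\<dots> = 1/2" using K by (simp add: \<eta>_def)
    finally show ?thesis .
  qed
  define V where "V = (\<Union>j\<in>J. ball (z j) (\<rho> j))"
  define F where "F = {g \<in> G. orbit_pt g \<notin> V}"
  have F: "finite F" unfolding F_def by (rule finite_orbit_outside) (use J(5) in \<open>auto simp: V_def\<close>)
  have "ball_count T \<le> card F + (\<Sum>j\<in>J. ball_count (c j * T))" for T
  proof -
    define S where "S j = {h \<in> G. frobenius_norm h < T \<and> orbit_pt h \<in> ball (z j) (\<rho> j)}" for j
    have finS: "finite (S j)" for j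
      by (rule finite_subset[OF _ finite_ball[of T]]) (auto simp: S_def)
    have cardS: "card (S j) \<le> ball_count (c j * T)" if j: "j \<in> J" for j
    proof -
      have "\<rho> j \<le> 1" using J(4)[OF j] r(2) by simp
      then obtain g where g: "g \<in> G" "frobenius_norm g \<le> C / sqrt (\<rho> j)" "cmod (orbit_pt g - z j) \<le> C * \<rho> j"
        using con J(2,3)[OF j] by blast
      have zj: "cmod (z j) = 1" using J(2)[OF j] by (simp add: limit_set_def)
      have inj: "inj_on (\<lambda>h. adj g ** h) (S j)"
        by (rule inj_on_inverseI[of _ "\<lambda>h. g ** h"]) (simp add: adj_mult_cancel(2)[OF det_G[OF g(1)]])
      have "(\<lambda>h. adj g ** h) ` S j \<subseteq> {h \<in> G. frobenius_norm h < c j * T}"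
      proof (rule image_subsetI)
        fix h assume h: "h \<in> S j"
        then have hG: "h \<in> G" and hT: "frobenius_norm h < T" and hz: "cmod (orbit_pt h - z j) < \<rho> j"
          by (auto simp: S_def dist_norm norm_minus_commute)
        have "frobenius_norm (adj g ** h) \<le> c j * frobenius_norm h"
          using norm_shadow[OF det_G[OF g(1)] det_G[OF hG] zj J(3)[OF j] less_imp_le[OF C] g(3) hz g(2)]
          by (simp add: c_def K_def)
        also have "\<dots> < c j * T" using hT c(1)[OF j] by simp
        finally show "adj g ** h \<in> {h \<in> G. frobenius_norm h < c j * T}"
          using mult_G[OF adj_G[OF g(1)] hG] by simp
      qed
      then have "card ((\<lambda>h. adj g ** h) ` S j) \<le> ball_count (c j * T)"
        unfolding ball_count_def by (intro card_mono finite_ball)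
      then show ?thesis using card_image[OF inj] by simp
    qed
    have "{g \<in> G. frobenius_norm g < T} \<subseteq> F \<union> (\<Union>j\<in>J. S j)"
      by (auto simp: F_def S_def V_def)
    then have "ball_count T \<le> card (F \<union> (\<Union>j\<in>J. S j))"
      unfolding ball_count_def using F J(1) finS by (intro card_mono) auto
    also have "\<dots> \<le> card F + card (\<Union>j\<in>J. S j)" by (rule card_Un_le)
    also have "card (\<Union>j\<in>J. S j) \<le> (\<Sum>j\<in>J. card (S j))" by (rule card_UN_le[OF J(1)])
    also have "\<dots> \<le> (\<Sum>j\<in>J. ball_count (c j * T))" by (intro sum_mono cardS)
    finally show ?thesis by simp
  qed
  then show ?thesis using that[of J c "card F"] J(1) c csum by blast
qed

text \<open>Induction over dyadic T: since \<open>c j\<close> is at most 1/2, the recursion refers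
  to the previous scale. Its sum takes at most half of the bound, and the other half covers
  \<open>N0\<close>, whence \<open>A = 2 * real N0\<close>. For T at most 1 the ball is empty, as
  all norms exceed 1.\<close>

lemma ball_count_bound_null:
  assumes s: "0 < s" and null: "hausdorff_measure s (limit_set G) = 0"
  shows "\<exists>A\<ge>0. \<forall>T>0. real (ball_count T) \<le> A * T powr (2 * s)"
proof -
  obtain J :: "nat set" and c N0 where J: "finite J" and c: "\<And>j. j \<in> J \<Longrightarrow> 0 < c j" "\<And>j. j \<in> J \<Longrightarrow> c j \<le> 1/2"
    and csum: "(\<Sum>j\<in>J. c j powr (2 * s)) \<le> 1/2"
    and rec: "\<And>T. ball_count T \<le> N0 + (\<Sum>j\<in>J. ball_count (c j * T))"
    using ball_count_recursion[OF s null] by blast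
  define A where "A = 2 * real N0"
  have A: "A \<ge> 0" by (simp add: A_def)
  have "\<forall>T>0. T \<le> 2^k \<longrightarrow> real (ball_count T) \<le> A * T powr (2 * s)" for k :: nat
  proof (induction k)
    case 0
    show ?case using ball_count_small A by auto
  next
    case (Suc k)
    show ?case
    proof (intro allI impI)
      fix T :: real assume T: "T > 0" "T \<le> 2^Suc k"
      show "real (ball_count T) \<le> A * T powr (2 * s)"
      proof (cases "T \<le> 1")
        case True
        then show ?thesis using ball_count_small A by simp
      next
        case False
        then have T1: "1 \<le> T powr (2 * s)" using s by (intro ge_one_powr_ge_zero) auto
        have "real (ball_count T) \<le> real N0 + (\<Sum>j\<in>J. real (ball_count (c j * T)))"
          using rec[of T] by (metis of_nat_add of_nat_le_iff of_nat_sum)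
        also have "(\<Sum>j\<in>J. real (ball_count (c j * T))) \<le> (\<Sum>j\<in>J. A * T powr (2 * s) * c j powr (2 * s))"
        proof (rule sum_mono)
          fix j assume j: "j \<in> J"
          have "c j * T \<le> 1/2 * 2^Suc k" using c[OF j] T by (intro mult_mono) auto
          then have "c j * T \<le> 2^k" by simp
          then have "real (ball_count (c j * T)) \<le> A * (c j * T) powr (2 * s)"
            using Suc c(1)[OF j] T by simp
          then show "real (ball_count (c j * T)) \<le> A * T powr (2 * s) * c j powr (2 * s)"
            using c(1)[OF j] T by (simp add: powr_mult mult_ac)
        qed
        also have "\<dots> = A * T powr (2 * s) * (\<Sum>j\<in>J. c j powr (2 * s))" by (simp add: sum_distrib_left)
        also have "\<dots> \<le> A * T powr (2 * s) * (1/2)" using csum A by (intro mult_left_mono) auto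
        also have "real N0 = A / 2 * 1" by (simp add: A_def)
        also have "A / 2 * 1 \<le> A / 2 * T powr (2 * s)" using T1 A by (intro mult_left_mono) auto
        finally show ?thesis by simp
      qed
    qed
  qed
  then have "\<forall>T>0. real (ball_count T) \<le> A * T powr (2 * s)"
    by (meson less_imp_le real_arch_pow one_less_numeral_iff semiring_norm(76))
  then show ?thesis using A by blast
qed

lemma ball_count_bound:
  assumes "hausdorff_dim (limit_set G) < ereal s"
  shows "\<exists>A\<ge>0. \<forall>T>0. real (ball_count T) \<le> A * T powr (2 * s)"
proof -
  obtain s1 where s1: "0 < s1" "hausdorff_measure s1 (limit_set G) = 0" "s1 < s"
    using assms unfolding hausdorff_dim_def INF_less_iff by auto
  obtain A where A: "A \<ge> 0" "\<And>T. T > 0 \<Longrightarrow> real (ball_count T) \<le> A * T powr (2 * s1)"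
    using ball_count_bound_null[OF s1(1,2)] by blast
  have "real (ball_count T) \<le> A * T powr (2 * s)" if T: "T > 0" for T
  proof (cases "T \<le> 1")
    case True
    then show ?thesis using ball_count_small A by simp
  next
    case False
    have "A * T powr (2 * s1) \<le> A * T powr (2 * s)"
      using A(1) False s1 by (intro mult_left_mono powr_mono) auto
    then show ?thesis using A(2)[OF T] by simp
  qed
  then show ?thesis using A(1) by blast
qed

end

section \<open>Factorizations of a group element\<close>

text \<open>The determinant of column a of p and column b of c; up to sign, these are the entries of
  p^(-1) c.\<close>

definition col_det :: "int^2^2 \<Rightarrow> 2 \<Rightarrow> int^2^2 \<Rightarrow> 2 \<Rightarrow> int" where
  "col_det p a c b = p$1$a * c$2$b - p$2$a * c$1$b"

lemma abs_entry_le: "\<bar>real_of_int (A $ i $ j)\<bar> \<le> frobenius_norm A"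
proof -
  have "(A$i$j)\<^sup>2 \<le> frob_sq A"
    using exhaust_2[of i] exhaust_2[of j] by (auto simp: frob_sq_def)
  then have "(real_of_int (A$i$j))\<^sup>2 \<le> real_of_int (frob_sq A)"
    by (metis of_int_le_iff of_int_power)
  then show ?thesis unfolding frobenius_norm_eq by (rule real_le_rsqrt[of "\<bar>_\<bar>", unfolded power2_abs])
qed

lemma adj_mult_nth:
  "(adj p ** c)$1$1 = - col_det p 2 c 1" "(adj p ** c)$1$2 = - col_det p 2 c 2"
  "(adj p ** c)$2$1 = col_det p 1 c 1" "(adj p ** c)$2$2 = col_det p 1 c 2"
  by (simp_all add: mult_nth adj_def col_det_def)

lemma abs_col_det_le: "\<bar>real_of_int (col_det p a c b)\<bar> \<le> frobenius_norm (adj p ** c)"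
proof -
  have "(a = 1 \<or> a = 2) \<and> (b = 1 \<or> b = 2)" using exhaust_2 by blast
  then show ?thesis
    using abs_entry_le[of "adj p ** c" 1 1] abs_entry_le[of "adj p ** c" 1 2]
      abs_entry_le[of "adj p ** c" 2 1] abs_entry_le[of "adj p ** c" 2 2]
    unfolding adj_mult_nth by auto
qed

text \<open>Three vectors of the plane satisfy a Pluecker relation; here they are columns of p, c
  and g. It bounds each of the 16 products of an entry of p^(-1) c with an entry of g by the bracket
  on the right, and 4 is the square root of 16.\<close>

lemma norm_ptolemy:
  "frobenius_norm (adj p ** c) * frobenius_norm g
     \<le> 4 * (frobenius_norm p * frobenius_norm (adj c ** g) + frobenius_norm (adj p ** g) * frobenius_norm c)"
proof (rule power2_le_imp_le)
  define R where "R = frobenius_norm p * frobenius_norm (adj c ** g) + frobenius_norm (adj p ** g) * frobenius_norm c"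
  have R: "0 \<le> R" by (simp add: R_def)
  have pl: "col_det p a c b * g$k$l = - (p$k$a * col_det c b g l) + col_det p a g l * c$k$b" for a b k l
  proof -
    have "k = 1 \<or> k = 2" using exhaust_2 by blast
    then show ?thesis by (auto simp: col_det_def algebra_simps)
  qed
  have h: "(real_of_int (col_det p a c b))\<^sup>2 * (real_of_int (g$k$l))\<^sup>2 \<le> R\<^sup>2" for a b k l
  proof -
    have "\<bar>real_of_int (col_det p a c b) * real_of_int (g$k$l)\<bar>
       \<le> \<bar>real_of_int (p$k$a)\<bar> * \<bar>real_of_int (col_det c b g l)\<bar> + \<bar>real_of_int (col_det p a g l)\<bar> * \<bar>real_of_int (c$k$b)\<bar>"
      unfolding of_int_mult[symmetric] pl unfolding abs_mult[symmetric] of_int_add of_int_minus of_int_mult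
      using abs_triangle_ineq[of "- (real_of_int (p$k$a) * real_of_int (col_det c b g l))" "real_of_int (col_det p a g l) * real_of_int (c$k$b)"]
      by simp
    also have "\<dots> \<le> R"
      unfolding R_def by (intro add_mono mult_mono abs_entry_le abs_col_det_le) auto
    finally have "\<bar>real_of_int (col_det p a c b) * real_of_int (g$k$l)\<bar>\<^sup>2 \<le> R\<^sup>2" by (intro power_mono) auto
    then show ?thesis by (simp add: power_mult_distrib)
  qed
  have e1: "(frobenius_norm (adj p ** c))\<^sup>2 = (real_of_int (col_det p 1 c 1))\<^sup>2 + (real_of_int (col_det p 1 c 2))\<^sup>2
     + (real_of_int (col_det p 2 c 1))\<^sup>2 + (real_of_int (col_det p 2 c 2))\<^sup>2"
    unfolding frobenius_norm_sq frob_sq_def adj_mult_nth by simp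
  have e2: "(frobenius_norm g)\<^sup>2 = (real_of_int (g$1$1))\<^sup>2 + (real_of_int (g$1$2))\<^sup>2 + (real_of_int (g$2$1))\<^sup>2 + (real_of_int (g$2$2))\<^sup>2"
    unfolding frobenius_norm_sq frob_sq_def by simp
  have four: "x * (frobenius_norm g)\<^sup>2 \<le> 4 * R\<^sup>2"
    if "\<And>k l. x * (real_of_int (g$k$l))\<^sup>2 \<le> R\<^sup>2" for x
    unfolding e2 distrib_left using that[of 1 1] that[of 1 2] that[of 2 1] that[of 2 2] by linarith
  have "(frobenius_norm (adj p ** c))\<^sup>2 * (frobenius_norm g)\<^sup>2 \<le> 16 * R\<^sup>2"
    unfolding e1 distrib_right
    using four[OF h[of 1 1]] four[OF h[of 1 2]] four[OF h[of 2 1]] four[OF h[of 2 2]] by linarith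
  then show "(frobenius_norm (adj p ** c) * frobenius_norm g)\<^sup>2
     \<le> (4 * (frobenius_norm p * frobenius_norm (adj c ** g) + frobenius_norm (adj p ** g) * frobenius_norm c))\<^sup>2"
    unfolding R_def[symmetric] by (simp add: power_mult_distrib)
qed simp

context nonparabolic_group begin

text \<open>A factorization of g with norms below A and B is recorded by its first factor c; the
  second one is \<open>adj c ** g\<close>.\<close>

definition rep_count :: "real \<Rightarrow> real \<Rightarrow> int^2^2 \<Rightarrow> nat" where
  "rep_count A B g = card {c \<in> G. frobenius_norm c < A \<and> frobenius_norm (adj c ** g) < B}"

lemma card_le_ball_count:
  assumes inj: "inj_on f S" and sub: "f ` S \<subseteq> {g \<in> G. frobenius_norm g < T}"
  shows "card S \<le> ball_count T"
  using card_image[OF inj] card_mono[OF finite_ball sub] by (simp add: ball_count_def)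

text \<open>If \<open>g = \<gamma> \<xi>\<close> then, by the Ptolemy inequality, \<open>\<gamma>\<close> is close to the point \<open>p\<close> of the orbit at
  distance \<open>t = (A |g| / B)\<^sup>1\<^sup>/\<^sup>2\<close> along the geodesic from \<open>1\<close> to \<open>g\<close>.\<close>

lemma rep_count_bound:
  assumes dim: "hausdorff_dim (limit_set G) < ereal s" and s: "0 < s"
  shows "\<exists>K\<ge>0. \<forall>A>0. \<forall>B>0. \<forall>g\<in>G. real (rep_count A B g) \<le> K * (A * B / frobenius_norm g) powr s"
proof -
  obtain N where N: "N \<ge> 0" "\<And>T. T > 0 \<Longrightarrow> real (ball_count T) \<le> N * T powr (2 * s)"
    using ball_count_bound[OF dim] by blast
  obtain C where C: "C > 0" and qc: "\<forall>g\<in>G. \<forall>t. 1 \<le> t \<longrightarrow> t \<le> frobenius_norm g \<longrightarrow>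
     (\<exists>h\<in>G. frobenius_norm h \<le> C * t \<and> frobenius_norm (adj h ** g) \<le> C * frobenius_norm g / t)"
    using quasiconvex by (elim exE conjE)
  define K where "K = N * max 1 ((9 * C) powr (2 * s))"
  have K: "K \<ge> 0" "N \<le> K" "N * (9 * C) powr (2 * s) \<le> K"
    using N(1) mult_left_mono[of 1 "max 1 ((9 * C) powr (2 * s))" N] by (auto simp: K_def intro: mult_left_mono)
  have sq: "x powr (2 * s) = (x\<^sup>2) powr s" if "x > 0" for x :: real
    using that by (simp add: powr_powr flip: powr_numeral)
  have trivial: "real n \<le> K * (A * B / L) powr s" if "n \<le> ball_count T" "T > 0" "T\<^sup>2 \<le> A * B / L" for n T A B L
  proof -
    have "real n \<le> N * T powr (2 * s)" using that(1) N(2)[OF that(2)] by linarith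
    also have "\<dots> \<le> K * (A * B / L) powr s"
      unfolding sq[OF that(2)] using K that s by (intro mult_mono powr_mono2) auto
    finally show ?thesis .
  qed
  have "real (rep_count A B g) \<le> K * (A * B / frobenius_norm g) powr s" if A: "A > 0" and B: "B > 0" and g: "g \<in> G" for A B g
  proof -
    define S where "S = {c \<in> G. frobenius_norm c < A \<and> frobenius_norm (adj c ** g) < B}"
    have rep: "rep_count A B g = card S" by (simp add: rep_count_def S_def)
    define L where "L = frobenius_norm g"
    have dg: "det g = 1" by (rule det_G[OF g])
    have L: "0 < L" using frobenius_norm_pos[OF dg] by (simp add: L_def)
    define t where "t = sqrt (A * L / B)"
    have t: "t > 0" using A B L by (simp add: t_def)
    \<comment> \<open>In the first two cases t would leave the interval from 1 to L. There one
      factor alone determines the factorization, and the ball containing it is already small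
      enough.\<close>
    consider "A * L \<le> B" | "B * L \<le> A" | "B < A * L" "A < B * L" by linarith
    then show ?thesis
    proof cases
      case 1
      have "card S \<le> ball_count A" by (rule card_le_ball_count[of id]) (auto simp: S_def)
      moreover have "A\<^sup>2 \<le> A * B / L"
        using mult_left_mono[OF 1, of A] A L by (simp add: pos_le_divide_eq power2_eq_square mult.assoc)
      ultimately show ?thesis unfolding rep L_def[symmetric] using trivial[of "card S" A A B L] A by simp
    next
      case 2
      have "card S \<le> ball_count B"
      proof (rule card_le_ball_count)
        show "inj_on (\<lambda>c. adj c ** g) S"
          by (rule inj_on_inverseI[of _ "\<lambda>c. adj (c ** adj g)"]) (simp add: adj_mult_cancel(3)[OF dg])
        show "(\<lambda>c. adj c ** g) ` S \<subseteq> {g \<in> G. frobenius_norm g < B}"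
          using mult_G[OF adj_G g] by (auto simp: S_def)
      qed
      moreover have "B\<^sup>2 \<le> A * B / L"
        using mult_left_mono[OF 2, of B] B L by (simp add: pos_le_divide_eq power2_eq_square mult_ac)
      ultimately show ?thesis unfolding rep L_def[symmetric] using trivial[of "card S" B A B L] B by simp
    next
      case 3
      have t2: "t\<^sup>2 = A * L / B" using A B L by (simp add: t_def)
      have "1 \<le> t" using 3 A B L by (simp add: t_def)
      moreover have "t \<le> L"
      proof (rule power2_le_imp_le)
        have "A * L \<le> (B * L) * L" using 3 L by (intro mult_right_mono) auto
        then show "t\<^sup>2 \<le> L\<^sup>2" unfolding t2 using B by (simp add: pos_divide_le_eq power2_eq_square mult_ac)
      qed (use L in simp)
      ultimately obtain p where p: "p \<in> G" "frobenius_norm p \<le> C * t" "frobenius_norm (adj p ** g) \<le> C * L / t"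
        using qc g unfolding L_def by blast
      \<comment> \<open>The choice of \<open>t\<close> makes both terms of the Ptolemy bound equal
        and yields 8 C A / t; the 9 makes the inequality strict.\<close>
      define T where "T = 9 * C * (A / t)"
      have T: "T > 0" using C A t by (simp add: T_def)
      have "card S \<le> ball_count T"
      proof (rule card_le_ball_count)
        show "inj_on (\<lambda>c. adj p ** c) S"
          by (rule inj_on_inverseI[of _ "\<lambda>c. p ** c"]) (simp add: adj_mult_cancel(2)[OF det_G[OF p(1)]])
        show "(\<lambda>c. adj p ** c) ` S \<subseteq> {g \<in> G. frobenius_norm g < T}"
        proof (rule image_subsetI)
          fix c assume c: "c \<in> S"
          have "frobenius_norm (adj p ** c) * L
             \<le> 4 * (frobenius_norm p * frobenius_norm (adj c ** g) + frobenius_norm (adj p ** g) * frobenius_norm c)"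
            unfolding L_def by (rule norm_ptolemy)
          also have "\<dots> \<le> 4 * ((C * t) * B + (C * L / t) * A)"
            using c p C t L B A by (intro mult_left_mono add_mono mult_mono) (auto simp: S_def)
          also have "t * B = A * L / t"
            using t2 t B by (simp add: field_simps power2_eq_square)
          then have "(C * t) * B = C * (A * L / t)" by (simp only: mult.assoc)
          also have "4 * (C * (A * L / t) + (C * L / t) * A) = (8 * C * (A / t)) * L"
            using t by (simp add: field_simps)
          finally have "frobenius_norm (adj p ** c) * L \<le> (8 * C * (A / t)) * L" .
          then have "frobenius_norm (adj p ** c) \<le> 8 * C * (A / t)" using L by (rule mult_right_le_imp_le)
          also have "\<dots> < T" unfolding T_def using C A t by (intro mult_strict_right_mono) auto
          finally show "adj p ** c \<in> {g \<in> G. frobenius_norm g < T}"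
            using mult_G[OF adj_G[OF p(1)]] c by (simp add: S_def)
        qed
      qed
      then have "real (card S) \<le> N * T powr (2 * s)" using N(2)[OF T] by linarith
      also have "\<dots> = N * (9 * C) powr (2 * s) * (A / t) powr (2 * s)"
        unfolding T_def by (subst powr_mult) (use C A t in auto)
      also have "(A / t) powr (2 * s) = (A * B / L) powr s"
      proof -
        have "(A / t)\<^sup>2 = A * B / L" unfolding power_divide t2 using A B L by (simp add: power2_eq_square)
        then show ?thesis using sq[of "A / t"] A t by simp
      qed
      also have "N * (9 * C) powr (2 * s) * (A * B / L) powr s \<le> K * (A * B / L) powr s"
        using K(3) by (intro mult_right_mono) auto
      finally show ?thesis unfolding rep L_def .
    qed
  qed
  then show ?thesis using K(1) by blast
qed

text \<open>The exponent is critical: each dyadic shell contributes at most the same constant, and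
  the k shells later become a logarithm.\<close>

lemma sum_norm_powr_bound:
  assumes N: "N \<ge> 0" "\<And>T. T > 0 \<Longrightarrow> real (ball_count T) \<le> N * T powr (2 * s)" and s: "0 < s"
  shows "(\<Sum>g | g \<in> G \<and> frobenius_norm g < 2^k. frobenius_norm g powr (- 2 * s)) \<le> real k * (N * 4 powr s)"
proof (induction k)
  case 0
  have "{g. g \<in> G \<and> frobenius_norm g < 2^0} = {}" using frobenius_norm_gt_1 det_G by fastforce
  then show ?case by (simp only: sum.empty)
next
  case (Suc k)
  define S where "S = {g. g \<in> G \<and> frobenius_norm g < 2^k}"
  define S' where "S' = {g. g \<in> G \<and> 2^k \<le> frobenius_norm g \<and> frobenius_norm g < 2^Suc k}"
  have fin: "finite S" "finite S'"
    unfolding S_def S'_def by (rule finite_subset[OF _ finite_ball[of "2^k"]], blast, rule finite_subset[OF _ finite_ball[of "2^Suc k"]], blast)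
  have "card S' \<le> ball_count (2^Suc k)"
    by (rule card_le_ball_count[of id]) (auto simp: S'_def)
  then have cS: "real (card S') \<le> N * (2^Suc k) powr (2 * s)"
    using N(2)[of "2^Suc k"] by (smt (verit) of_nat_mono zero_less_power)
  have "{g. g \<in> G \<and> frobenius_norm g < 2^Suc k} = S \<union> S'"
  proof (rule Set.set_eqI)
    fix g
    have "(2::real)^k \<le> 2^Suc k" by simp
    then show "g \<in> {g. g \<in> G \<and> frobenius_norm g < 2^Suc k} \<longleftrightarrow> g \<in> S \<union> S'"
      unfolding S_def S'_def Un_iff mem_Collect_eq by linarith
  qed
  moreover have "S \<inter> S' = {}" by (auto simp: S_def S'_def)
  ultimately have "(\<Sum>g | g \<in> G \<and> frobenius_norm g < 2^Suc k. frobenius_norm g powr (- 2 * s))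
     = (\<Sum>g\<in>S. frobenius_norm g powr (- 2 * s)) + (\<Sum>g\<in>S'. frobenius_norm g powr (- 2 * s))"
    by (simp only: sum.union_disjoint[OF fin])
  also have "(\<Sum>g\<in>S. frobenius_norm g powr (- 2 * s)) \<le> real k * (N * 4 powr s)" using Suc by (simp add: S_def)
  also have "(\<Sum>g\<in>S'. frobenius_norm g powr (- 2 * s)) \<le> real (card S') * (2^k) powr (- 2 * s)"
    by (rule sum_bounded_above) (use s in \<open>auto simp: S'_def intro!: powr_mono2'\<close>)
  also have "\<dots> \<le> N * (2^Suc k) powr (2 * s) * (2^k) powr (- 2 * s)"
    using cS by (intro mult_right_mono) auto
  also have "\<dots> = N * 4 powr s"
  proof -
    have "(2^Suc k) powr (2 * s) = 4 powr s * (2^k) powr (2 * s)"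
    proof -
      have "(2^Suc k) powr (2 * s) = 2 powr (2 * s) * (2^k) powr (2 * s)" by (simp add: powr_mult)
      moreover have "(2::real) powr (2 * s) = (2 powr 2) powr s" by (simp only: powr_powr)
      ultimately show ?thesis by simp
    qed
    then show ?thesis by (simp add: powr_minus field_simps)
  qed
  finally show ?case by (simp add: distrib_right)
qed

lemma rep_count_eq_0:
  assumes "A * B \<le> frobenius_norm g"
  shows "rep_count A B g = 0"
proof -
  have False if c: "c \<in> G" "frobenius_norm c < A" "frobenius_norm (adj c ** g) < B" for c
  proof -
    have "frobenius_norm g \<le> frobenius_norm c * frobenius_norm (adj c ** g)"
      using frobenius_norm_mult_left[of "adj c" g] det_G[OF c(1)] by simp
    also have "\<dots> \<le> frobenius_norm c * B" using c by (intro mult_left_mono) auto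
    also have "\<dots> < A * B"
      using c frobenius_norm_nonneg[of "adj c ** g"] by (intro mult_strict_right_mono) linarith+
    finally show False using assms by simp
  qed
  then have "{c \<in> G. frobenius_norm c < A \<and> frobenius_norm (adj c ** g) < B} = {}" by blast
  then show ?thesis unfolding rep_count_def by (simp only: card.empty)
qed

text \<open>By \<open>ball_count_bound\<close> the number of pairs of factors is itself of order at
  most (A B)^(2s), so multiplicities cost only a logarithm. The square of the bound for
  \<open>rep_count\<close> leaves the critical sum of |g|^(-2s) over |g| < A B; larger g have no
  factorization.\<close>

lemma sum_rep_count_sq_bound:
  assumes dim: "hausdorff_dim (limit_set G) < ereal s" and s: "0 < s"
  shows "\<exists>K\<ge>0. \<forall>A\<ge>1. \<forall>B\<ge>1. \<forall>S. finite S \<longrightarrow> S \<subseteq> G \<longrightarrow>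
     (\<Sum>g\<in>S. (real (rep_count A B g))\<^sup>2) \<le> K * (A * B) powr (2 * s) * (log 2 (A * B) + 1)"
proof -
  obtain N where N: "N \<ge> 0" "\<And>T. T > 0 \<Longrightarrow> real (ball_count T) \<le> N * T powr (2 * s)"
    using ball_count_bound[OF dim] by blast
  obtain K where K: "K \<ge> 0" "\<forall>A>0. \<forall>B>0. \<forall>g\<in>G. real (rep_count A B g) \<le> K * (A * B / frobenius_norm g) powr s"
    using rep_count_bound[OF dim s] by (elim exE conjE)
  have "(\<Sum>g\<in>S. (real (rep_count A B g))\<^sup>2) \<le> (K\<^sup>2 * (N * 4 powr s)) * (A * B) powr (2 * s) * (log 2 (A * B) + 1)"
    if A: "A \<ge> 1" and B: "B \<ge> 1" and S: "finite S" "S \<subseteq> G" for A B S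
  proof -
    have AB: "A * B \<ge> 1" using mult_mono[of 1 A 1 B] A B by simp
    define k where "k = nat \<lceil>log 2 (A * B)\<rceil>"
    have lnn: "0 \<le> log 2 (A * B)" using AB by simp
    have k: "real k \<le> log 2 (A * B) + 1" using lnn unfolding k_def by linarith
    have "A * B = 2 powr (log 2 (A * B))" using AB by simp
    also have "\<dots> \<le> 2 powr (real k)" using lnn unfolding k_def by (intro powr_mono) linarith+
    finally have ABk: "A * B \<le> 2^k" by (simp add: powr_realpow)
    define U where "U = {g. g \<in> G \<and> frobenius_norm g < 2^k}"
    have U: "finite U" unfolding U_def by (rule finite_ball)
    have term_le: "(real (rep_count A B g))\<^sup>2 \<le> K\<^sup>2 * (A * B) powr (2 * s) * frobenius_norm g powr (- 2 * s)" if "g \<in> G" for g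
    proof -
      have L: "0 < frobenius_norm g" using frobenius_norm_pos det_G that by blast
      have "real (rep_count A B g) \<le> K * (A * B / frobenius_norm g) powr s" using K(2) A B that by simp
      then have "(real (rep_count A B g))\<^sup>2 \<le> (K * (A * B / frobenius_norm g) powr s)\<^sup>2" by (intro power_mono) auto
      also have "\<dots> = K\<^sup>2 * (A * B / frobenius_norm g) powr (2 * s)"
        by (simp add: power_mult_distrib power2_eq_square flip: powr_add)
      also have "(A * B / frobenius_norm g) powr (2 * s) = (A * B) powr (2 * s) * frobenius_norm g powr (- 2 * s)"
        using L AB A B by (simp add: powr_divide powr_minus field_simps)
      finally show ?thesis by (simp add: mult.assoc)
    qed
    have "(\<Sum>g\<in>S. (real (rep_count A B g))\<^sup>2) \<le> (\<Sum>g\<in>U. (real (rep_count A B g))\<^sup>2)"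
    proof -
      have "rep_count A B g = 0" if "g \<in> S - U" for g
        using that S ABk by (intro rep_count_eq_0) (auto simp: U_def)
      then have "(\<Sum>g\<in>S. (real (rep_count A B g))\<^sup>2) = (\<Sum>g\<in>S \<inter> U. (real (rep_count A B g))\<^sup>2)"
        by (intro sum.mono_neutral_right S(1)) auto
      also have "\<dots> \<le> (\<Sum>g\<in>U. (real (rep_count A B g))\<^sup>2)" by (rule sum_mono2[OF U]) auto
      finally show ?thesis .
    qed
    also have "\<dots> \<le> (\<Sum>g\<in>U. K\<^sup>2 * (A * B) powr (2 * s) * frobenius_norm g powr (- 2 * s))"
      by (rule sum_mono) (rule term_le, simp add: U_def)
    also have "\<dots> = K\<^sup>2 * (A * B) powr (2 * s) * (\<Sum>g\<in>U. frobenius_norm g powr (- 2 * s))"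
      by (simp only: sum_distrib_left)
    also have "\<dots> \<le> K\<^sup>2 * (A * B) powr (2 * s) * (real k * (N * 4 powr s))"
      unfolding U_def using sum_norm_powr_bound[OF N s, of k] by (intro mult_left_mono) auto
    also have "\<dots> \<le> K\<^sup>2 * (A * B) powr (2 * s) * ((log 2 (A * B) + 1) * (N * 4 powr s))"
      using k N(1) by (intro mult_left_mono mult_right_mono) auto
    finally show ?thesis by (simp add: mult_ac)
  qed
  moreover have "K\<^sup>2 * (N * 4 powr s) \<ge> 0" using N by simp
  ultimately show ?thesis by blast
qed

end

section \<open>A large sieve inequality\<close>

lemma unit_exp_add: "unit_exp (x + y) = unit_exp x * unit_exp y"
  by (simp add: unit_exp_def distrib_left exp_add)

lemma norm_unit_exp [simp]: "cmod (unit_exp x) = 1"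
  by (simp add: unit_exp_def norm_exp_eq_Re)

lemma cnj_unit_exp: "cnj (unit_exp x) = unit_exp (- x)"
  by (simp add: unit_exp_def exp_cnj)

lemma Re_unit_exp: "Re (unit_exp x) = cos (2 * pi * x)"
  by (simp add: unit_exp_def Re_exp)

lemma unit_exp_eq_1: "unit_exp x = 1 \<longleftrightarrow> x \<in> \<int>"
proof -
  have "unit_exp x = 1 \<longleftrightarrow> (\<exists>n::int. 2 * pi * x = of_int (2 * n) * pi)"
    by (simp add: unit_exp_def exp_eq_1)
  also have "\<dots> \<longleftrightarrow> (\<exists>n::int. x = of_int n)" by (simp add: mult_ac)
  also have "\<dots> \<longleftrightarrow> x \<in> \<int>" by (auto elim: Ints_cases)
  finally show ?thesis .
qed

lemma int_div_in_Ints: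
  assumes "P > 0"
  shows "real_of_int m / real P \<in> \<int> \<longleftrightarrow> int P dvd m"
proof
  assume "real_of_int m / real P \<in> \<int>"
  then obtain n where "real_of_int m / real P = of_int n" by (rule Ints_cases)
  then have "real_of_int m = real_of_int (n * int P)" using assms by (simp add: field_simps)
  then show "int P dvd m" by (metis dvd_triv_right of_int_eq_iff)
qed (use assms in auto)

text \<open>Shifting the full period by one multiplies the sum by \<open>z\<close>, which is 1 only
  if P divides m.\<close>

lemma unit_exp_orthogonal:
  assumes P: "P > 0"
  shows "(\<Sum>x\<in>{h..<h + int P}. unit_exp (of_int x * (of_int m / real P))) = (if int P dvd m then of_nat P else 0)"
proof (cases "int P dvd m")
  case True
  have "unit_exp (of_int x * (of_int m / real P)) = 1" for x
    using True P unfolding unit_exp_eq_1 by (intro Ints_mult) (auto simp: int_div_in_Ints)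
  then show ?thesis using True by simp
next
  case False
  define f where "f x = unit_exp (of_int x * (of_int m / real P))" for x
  define z where "z = unit_exp (of_int m / real P)"
  have z: "z \<noteq> 1" using False P by (simp add: z_def unit_exp_eq_1 int_div_in_Ints)
  have fz: "f (x + 1) = z * f x" for x
    by (simp add: f_def z_def algebra_simps add_divide_distrib flip: unit_exp_add)
  have per: "f (h + int P) = f h"
  proof -
    have "f (h + int P) = unit_exp (of_int h * (of_int m / real P) + of_int m)"
      using P by (simp add: f_def field_simps)
    also have "\<dots> = f h * unit_exp (of_int m)" by (simp add: unit_exp_add f_def)
    also have "unit_exp (of_int m) = 1" by (simp add: unit_exp_eq_1)
    finally show ?thesis by simp
  qed
  have "z * (\<Sum>x\<in>{h..<h + int P}. f x) = (\<Sum>x\<in>{h..<h + int P}. f (x + 1))"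
    by (simp add: fz sum_distrib_left)
  also have "\<dots> = (\<Sum>x\<in>{h + 1..<h + 1 + int P}. f x)"
    by (rule sum.reindex_bij_witness[of _ "\<lambda>x. x - 1" "\<lambda>x. x + 1"]) auto
  also have "{h + 1..<h + 1 + int P} = insert (h + int P) {h + 1..<h + int P}" using P by auto
  also have "(\<Sum>x\<in>insert (h + int P) {h + 1..<h + int P}. f x) = f h + (\<Sum>x\<in>{h + 1..<h + int P}. f x)"
    by (simp add: per)
  also have "\<dots> = (\<Sum>x\<in>insert h {h + 1..<h + int P}. f x)" by simp
  also have "insert h {h + 1..<h + int P} = {h..<h + int P}" using P by auto
  finally have "(z - 1) * (\<Sum>x\<in>{h..<h + int P}. f x) = 0" by (simp add: algebra_simps)
  then show ?thesis using z False by (simp add: f_def)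
qed

text \<open>Opening the square and summing over a full period in both variables leaves the pairs
  whose frequencies agree modulo P.\<close>

lemma discrete_plancherel_le:
  fixes c :: "'i \<Rightarrow> complex" and u v :: "'i \<Rightarrow> int"
  assumes I: "finite I" and c: "\<And>i. i \<in> I \<Longrightarrow> cmod (c i) \<le> 1" and P: "P > 0"
  shows "(\<Sum>x\<in>{h..<h + int P}. \<Sum>y\<in>{h..<h + int P}.
       (cmod (\<Sum>i\<in>I. c i * unit_exp (of_int x * (of_int (u i) / real P) + of_int y * (of_int (v i) / real P))))\<^sup>2)
     \<le> (real P)\<^sup>2 * real (card {(i, j) \<in> I \<times> I. int P dvd u i - u j \<and> int P dvd v i - v j})"
proof -
  define R where "R = {h..<h + int P}"
  define E where "E i x y = unit_exp (of_int x * (of_int (u i) / real P) + of_int y * (of_int (v i) / real P))" for i x y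
  define a where "a i j = (\<Sum>x\<in>R. unit_exp (of_int x * (of_int (u i - u j) / real P)))" for i j
  define b where "b i j = (\<Sum>y\<in>R. unit_exp (of_int y * (of_int (v i - v j) / real P)))" for i j
  have ab: "a i j = (if int P dvd u i - u j then of_nat P else 0)" "b i j = (if int P dvd v i - v j then of_nat P else 0)" for i j
    unfolding a_def b_def R_def by (rule unit_exp_orthogonal[OF P])+
  define S where "S = {(i, j) \<in> I \<times> I. int P dvd u i - u j \<and> int P dvd v i - v j}"
  have S: "finite S" unfolding S_def by (rule finite_subset[of _ "I \<times> I"]) (use I in auto)
  have EE: "E i x y * cnj (E j x y) = unit_exp (of_int x * (of_int (u i - u j) / real P)) * unit_exp (of_int y * (of_int (v i - v j) / real P))" for i j x y
    unfolding E_def cnj_unit_exp unit_exp_add[symmetric]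
    by (rule arg_cong[of _ _ unit_exp]) (simp add: algebra_simps diff_divide_distrib)
  have sq: "complex_of_real ((cmod (\<Sum>i\<in>I. c i * E i x y))\<^sup>2)
     = (\<Sum>i\<in>I. \<Sum>j\<in>I. c i * cnj (c j) * (E i x y * cnj (E j x y)))" for x y
    unfolding complex_norm_square cnj_sum sum_product complex_cnj_mult by (simp add: mult_ac)
  have "complex_of_real (\<Sum>x\<in>R. \<Sum>y\<in>R. (cmod (\<Sum>i\<in>I. c i * E i x y))\<^sup>2)
     = (\<Sum>x\<in>R. \<Sum>y\<in>R. \<Sum>i\<in>I. \<Sum>j\<in>I. c i * cnj (c j) * (E i x y * cnj (E j x y)))"
    unfolding of_real_sum sq ..
  also have "\<dots> = (\<Sum>i\<in>I. \<Sum>j\<in>I. \<Sum>x\<in>R. \<Sum>y\<in>R. c i * cnj (c j) * (E i x y * cnj (E j x y)))"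
    by (subst (2) sum.swap, subst sum.swap, rule sum.cong[OF refl], subst (2) sum.swap, subst sum.swap, rule refl)
  also have "\<dots> = (\<Sum>i\<in>I. \<Sum>j\<in>I. c i * cnj (c j) * (a i j * b i j))"
    unfolding EE a_def b_def sum_product by (simp only: sum_distrib_left)
  also have "\<dots> = (\<Sum>(i,j)\<in>I \<times> I. c i * cnj (c j) * (a i j * b i j))"
    by (rule sum.cartesian_product)
  also have "\<dots> = (\<Sum>(i,j)\<in>S. c i * cnj (c j) * (of_nat P)\<^sup>2)"
  proof (rule sum.mono_neutral_cong_right)
    show "finite (I \<times> I)" using I by simp
    show "S \<subseteq> I \<times> I" by (auto simp: S_def)
  qed (auto simp: S_def ab power2_eq_square split: if_splits)
  finally have eq: "complex_of_real (\<Sum>x\<in>R. \<Sum>y\<in>R. (cmod (\<Sum>i\<in>I. c i * E i x y))\<^sup>2)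
     = (\<Sum>(i,j)\<in>S. c i * cnj (c j) * (of_nat P)\<^sup>2)" .
  have "(\<Sum>x\<in>R. \<Sum>y\<in>R. (cmod (\<Sum>i\<in>I. c i * E i x y))\<^sup>2)
     \<le> cmod (complex_of_real (\<Sum>x\<in>R. \<Sum>y\<in>R. (cmod (\<Sum>i\<in>I. c i * E i x y))\<^sup>2))"
    by (simp only: norm_of_real abs_ge_self)
  also have "\<dots> = cmod (\<Sum>(i,j)\<in>S. c i * cnj (c j) * (of_nat P)\<^sup>2)" unfolding eq ..
  also have "\<dots> \<le> (\<Sum>p\<in>S. (real P)\<^sup>2)"
  proof (rule sum_norm_le)
    fix p assume "p \<in> S"
    then obtain i j where p: "p = (i, j)" "i \<in> I" "j \<in> I" by (auto simp: S_def)
    have "cmod (c i) * cmod (c j) \<le> 1 * 1" using c p by (intro mult_mono) auto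
    then have "cmod (c i) * cmod (c j) * (real P)\<^sup>2 \<le> 1 * (real P)\<^sup>2" by (intro mult_right_mono) auto
    then show "cmod (case p of (i, j) \<Rightarrow> c i * cnj (c j) * (of_nat P)\<^sup>2) \<le> (real P)\<^sup>2"
      by (simp add: p(1) norm_mult norm_power)
  qed
  finally show ?thesis by (simp add: R_def E_def S_def mult.commute)
qed

lemma cos_ge_half:
  assumes "\<bar>t\<bar> \<le> pi / 3" shows "1/2 \<le> cos t"
proof -
  have "cos (pi / 3) \<le> cos \<bar>t\<bar>" using assms by (intro cos_monotone_0_pi_le) auto
  then show ?thesis by (simp add: cos_60)
qed

text \<open>Each frequency is rounded to a grid of mesh \<open>1 / P\<close> and replaced by a block of \<open>J\<^sup>2\<close> neighbouring
  grid points. This multiplies the trigonometric sum by a factor of modulus at least \<open>(J / 2)\<^sup>2\<close> on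
  the short vectors, and blocks of frequencies that are not near each other are disjoint.\<close>

lemma large_sieve_grid:
  fixes c :: "'k \<Rightarrow> complex" and \<phi> \<psi> :: "'k \<Rightarrow> real" and M J :: nat
  assumes W: "finite W" and c: "\<And>k. k \<in> W \<Longrightarrow> cmod (c k) \<le> 1" and M: "M \<ge> 1" and J: "J \<ge> 1"
  defines "P \<equiv> 8 * M * J"
  shows "(\<Sum>x\<in>{- int M..int M}. \<Sum>y\<in>{- int M..int M}.
      (cmod (\<Sum>k\<in>W. c k * unit_exp (of_int x * (of_int \<lfloor>real P * \<phi> k\<rfloor> / real P) + of_int y * (of_int \<lfloor>real P * \<psi> k\<rfloor> / real P))))\<^sup>2)
    \<le> 1024 * (real M)\<^sup>2 * real (card {(k, l) \<in> W \<times> W.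
        (\<exists>n::int. \<bar>\<phi> k - \<phi> l - n\<bar> \<le> 1 / M) \<and> (\<exists>n::int. \<bar>\<psi> k - \<psi> l - n\<bar> \<le> 1 / M)})"
proof -
  define near where "near = {(k, l) \<in> W \<times> W.
        (\<exists>n::int. \<bar>\<phi> k - \<phi> l - n\<bar> \<le> 1 / M) \<and> (\<exists>n::int. \<bar>\<psi> k - \<psi> l - n\<bar> \<le> 1 / M)}"
  have near_fin: "finite near" unfolding near_def by (rule finite_subset[of _ "W \<times> W"]) (use W in auto)
  have P: "P > 0" using M J by (simp add: P_def)
  have "1 * J \<le> (8 * M) * J" using M by (intro mult_le_mono1) simp
  then have JP: "int J \<le> int P" by (simp only: P_def mult_1 of_nat_le_iff)
  have MJ: "8 * M \<le> P" using J by (simp add: P_def)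
  define Q where "Q = {0..<int J}"
  have Q: "finite Q" "card Q = J" by (auto simp: Q_def)
  define T where "T x y = (\<Sum>k\<in>W. c k * unit_exp (of_int x * (of_int \<lfloor>real P * \<phi> k\<rfloor> / real P) + of_int y * (of_int \<lfloor>real P * \<psi> k\<rfloor> / real P)))" for x y :: int
  define D where "D x = (\<Sum>j\<in>Q. unit_exp (of_int x * (of_int j / real P)))" for x :: int
  define I where "I = W \<times> Q \<times> Q"
  define u where "u = (\<lambda>(k, i, j :: int). \<lfloor>real P * \<phi> k\<rfloor> + i :: int)"
  define v where "v = (\<lambda>(k, i :: int, j). \<lfloor>real P * \<psi> k\<rfloor> + j :: int)"
  have I: "finite I" using W Q by (simp add: I_def)
  have factor: "(\<Sum>i\<in>I. c (fst i) * unit_exp (of_int x * (of_int (u i) / real P) + of_int y * (of_int (v i) / real P)))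
     = T x y * (D x * D y)" for x y
  proof -
    have "(\<Sum>i\<in>I. c (fst i) * unit_exp (of_int x * (of_int (u i) / real P) + of_int y * (of_int (v i) / real P)))
      = (\<Sum>k\<in>W. \<Sum>i\<in>Q. \<Sum>j\<in>Q. c k * unit_exp (of_int x * (of_int \<lfloor>real P * \<phi> k\<rfloor> / real P) + of_int y * (of_int \<lfloor>real P * \<psi> k\<rfloor> / real P))
         * (unit_exp (of_int x * (of_int i / real P)) * unit_exp (of_int y * (of_int j / real P))))"
      unfolding I_def sum.cartesian_product
      by (intro sum.cong refl) (auto simp: u_def v_def mult.assoc algebra_simps add_divide_distrib simp flip: unit_exp_add)
    also have "\<dots> = T x y * (D x * D y)"
      unfolding T_def D_def sum_product sum_distrib_right by (simp only: sum_distrib_left)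
    finally show ?thesis .
  qed
  \<comment> \<open>The 8 in \<open>P\<close> keeps x j / P within 1/8, so the angles stay within
    pi/4 and all real parts are at least 1/2. It also lets the box fit into one period.\<close>
  have Dge: "real J / 2 \<le> cmod (D x)" if "x \<in> {- int M..int M}" for x
  proof -
    have "real J / 2 = (\<Sum>j\<in>Q. 1/2)" by (simp add: Q(2))
    also have "\<dots> \<le> (\<Sum>j\<in>Q. Re (unit_exp (of_int x * (of_int j / real P))))"
    proof (rule sum_mono)
      fix j assume j: "j \<in> Q"
      have "\<bar>x * j\<bar> \<le> int M * int J"
        using that j unfolding abs_mult by (intro mult_mono) (auto simp: Q_def)
      then have "8 * \<bar>real_of_int x * real_of_int j\<bar> \<le> real P"
        unfolding P_def by (simp add: flip: of_int_mult of_int_abs) (metis of_int_le_iff of_int_mult of_int_of_nat_eq)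
      then have "\<bar>of_int x * (of_int j / real P)\<bar> \<le> 1/8"
        using P by (simp add: abs_mult field_simps)
      then have "2 * pi * \<bar>of_int x * (of_int j / real P)\<bar> \<le> 2 * pi * (1/8)"
        by (intro mult_left_mono) auto
      also have "\<dots> \<le> pi / 3" by simp
      finally have "\<bar>2 * pi * (of_int x * (of_int j / real P))\<bar> \<le> pi / 3"
        by (simp add: abs_mult)
      then show "1/2 \<le> Re (unit_exp (of_int x * (of_int j / real P)))"
        unfolding Re_unit_exp by (rule cos_ge_half)
    qed
    also have "\<dots> = Re (D x)" by (simp add: D_def)
    also have "\<dots> \<le> cmod (D x)" by (rule complex_Re_le_cmod)
    finally show ?thesis .
  qed
  define S where "S = {(i, j) \<in> I \<times> I. int P dvd u i - u j \<and> int P dvd v i - v j}"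
  \<comment> \<open>Roundings differ by less than 1 and offsets by at most J - 1, so colliding
    phases agree modulo 1 up to J / P = 1 / (8 M).\<close>
  have close: "\<exists>n::int. \<bar>\<alpha> - \<beta> - n\<bar> \<le> 1 / M"
    if d: "int P dvd (\<lfloor>real P * \<alpha>\<rfloor> + i) - (\<lfloor>real P * \<beta>\<rfloor> + j)" and i: "i \<in> Q" and j: "j \<in> Q" for \<alpha> \<beta> :: real and i j
  proof -
    obtain n where n: "\<lfloor>real P * \<alpha>\<rfloor> + i - (\<lfloor>real P * \<beta>\<rfloor> + j) = int P * n" using d by (auto simp: dvd_def)
    then have n': "real_of_int \<lfloor>real P * \<alpha>\<rfloor> + i - (\<lfloor>real P * \<beta>\<rfloor> + j) = real P * n"
      by (metis of_int_add of_int_diff of_int_mult of_int_of_nat_eq)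
    have "\<bar>real_of_int j - i\<bar> \<le> real J - 1" using i j J by (auto simp: Q_def)
    then have "\<bar>real P * \<alpha> - real P * \<beta> - real P * n\<bar> \<le> real J"
      using n' by linarith
    then have "\<bar>real P * (\<alpha> - \<beta> - n)\<bar> \<le> real J" by (simp only: right_diff_distrib)
    then have "real P * \<bar>\<alpha> - \<beta> - n\<bar> \<le> real J" by (simp only: abs_mult abs_of_nat)
    then have "real M * (8 * real J) * \<bar>\<alpha> - \<beta> - n\<bar> \<le> 8 * real J" using J by (simp add: P_def mult_ac)
    then have "(8 * real J) * (real M * \<bar>\<alpha> - \<beta> - n\<bar>) \<le> (8 * real J) * 1" by (simp add: mult_ac)
    then have "real M * \<bar>\<alpha> - \<beta> - n\<bar> \<le> 1" using J by (subst (asm) mult_le_cancel_left_pos) auto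
    then show ?thesis using M by (intro exI[of _ n]) (simp add: field_simps)
  qed
  \<comment> \<open>A collision is determined by its near pair and the offsets of the first member:
    the other offsets are then fixed modulo P, and they range over J \<le> P values.\<close>
  have cardS: "card S \<le> card near * J\<^sup>2"
  proof -
    define F where "F = (\<lambda>p :: ('k \<times> int \<times> int) \<times> ('k \<times> int \<times> int). ((fst (fst p), fst (snd p)), snd (fst p)))"
    have uniq: "a = b" if "int P dvd w - (z + a)" "int P dvd w - (z + b)" "a \<in> Q" "b \<in> Q" for w z a b :: int
    proof -
      have "int P dvd (w - (z + a)) - (w - (z + b))" using that(1,2) by (rule dvd_diff)
      then have "int P dvd b - a" by (simp add: algebra_simps)
      moreover have "\<bar>b - a\<bar> < int P" using that JP by (auto simp: Q_def)
      ultimately have "b - a = 0" using dvd_imp_le_int[of "b - a" "int P"] by linarith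
      then show ?thesis by simp
    qed
    have inj: "inj_on F S"
    proof (rule inj_onI)
      fix p q assume p: "p \<in> S" and q: "q \<in> S" and e: "F p = F q"
      obtain k i j l i' j' where p': "p = ((k, i, j), (l, i', j'))" by (metis prod.collapse)
      obtain k2 i2 j2 l2 i2' j2' where q': "q = ((k2, i2, j2), (l2, i2', j2'))" by (metis prod.collapse)
      have e': "k2 = k" "i2 = i" "j2 = j" "l2 = l" using e by (auto simp: p' q' F_def)
      have "i' = i2'" using p q unfolding p' q' e' S_def I_def u_def by (intro uniq[of "\<lfloor>real P * \<phi> k\<rfloor> + i" "\<lfloor>real P * \<phi> l\<rfloor>"]) auto
      moreover have "j' = j2'" using p q unfolding p' q' e' S_def I_def v_def by (intro uniq[of "\<lfloor>real P * \<psi> k\<rfloor> + j" "\<lfloor>real P * \<psi> l\<rfloor>"]) auto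
      ultimately show "p = q" by (simp add: p' q' e')
    qed
    have img: "F ` S \<subseteq> near \<times> (Q \<times> Q)"
    proof (rule image_subsetI)
      fix p assume p: "p \<in> S"
      obtain k i j l i' j' where p': "p = ((k, i, j), (l, i', j'))" by (metis prod.collapse)
      have "\<exists>n::int. \<bar>\<phi> k - \<phi> l - n\<bar> \<le> 1 / M"
        using p unfolding p' S_def I_def u_def by (intro close[of _ i _ i']; simp)
      moreover have "\<exists>n::int. \<bar>\<psi> k - \<psi> l - n\<bar> \<le> 1 / M"
        using p unfolding p' S_def I_def v_def by (intro close[of _ j _ j']; simp)
      ultimately show "F p \<in> near \<times> (Q \<times> Q)" using p by (auto simp: p' F_def S_def I_def near_def)
    qed
    have "card S \<le> card (near \<times> (Q \<times> Q))"
      by (rule card_inj_on_le[OF inj img]) (use near_fin Q in simp)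
    then show ?thesis by (simp add: card_cartesian_product Q power2_eq_square)
  qed
  define B where "B = {- int M..int M}"
  define R where "R = {- int M..<- int M + int P}"
  have BR: "B \<subseteq> R" using MJ M by (auto simp: B_def R_def)
  have "(\<Sum>x\<in>B. \<Sum>y\<in>B. (cmod (T x y))\<^sup>2) * (real J / 2)^4
     = (\<Sum>x\<in>B. \<Sum>y\<in>B. (cmod (T x y))\<^sup>2 * ((real J / 2)\<^sup>2 * (real J / 2)\<^sup>2))"
    unfolding sum_distrib_right by (simp add: power4_eq_xxxx power2_eq_square mult_ac)
  also have "\<dots> \<le> (\<Sum>x\<in>B. \<Sum>y\<in>B. (cmod (T x y * (D x * D y)))\<^sup>2)"
  proof (intro sum_mono)
    fix x y assume xy: "x \<in> B" "y \<in> B"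
    have "(real J / 2)\<^sup>2 * (real J / 2)\<^sup>2 \<le> (cmod (D x))\<^sup>2 * (cmod (D y))\<^sup>2"
      using Dge xy unfolding B_def by (intro mult_mono power_mono) auto
    then have "(cmod (T x y))\<^sup>2 * ((real J / 2)\<^sup>2 * (real J / 2)\<^sup>2) \<le> (cmod (T x y))\<^sup>2 * ((cmod (D x))\<^sup>2 * (cmod (D y))\<^sup>2)"
      by (intro mult_left_mono) auto
    then show "(cmod (T x y))\<^sup>2 * ((real J / 2)\<^sup>2 * (real J / 2)\<^sup>2) \<le> (cmod (T x y * (D x * D y)))\<^sup>2"
      by (simp only: norm_mult power_mult_distrib)
  qed
  also have "\<dots> \<le> (\<Sum>x\<in>R. \<Sum>y\<in>R. (cmod (T x y * (D x * D y)))\<^sup>2)"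
  proof -
    have "(\<Sum>x\<in>B. \<Sum>y\<in>B. (cmod (T x y * (D x * D y)))\<^sup>2) \<le> (\<Sum>x\<in>B. \<Sum>y\<in>R. (cmod (T x y * (D x * D y)))\<^sup>2)"
      by (intro sum_mono sum_mono2 BR) (auto simp: R_def)
    also have "\<dots> \<le> (\<Sum>x\<in>R. \<Sum>y\<in>R. (cmod (T x y * (D x * D y)))\<^sup>2)"
      by (intro sum_mono2 BR) (auto simp: R_def intro!: sum_nonneg)
    finally show ?thesis .
  qed
  also have "\<dots> \<le> (real P)\<^sup>2 * real (card S)"
    unfolding factor[symmetric] R_def S_def
    by (rule discrete_plancherel_le[OF I _ P]) (use c in \<open>auto simp: I_def\<close>)
  also have "\<dots> \<le> (real P)\<^sup>2 * (real (card near) * (real J)\<^sup>2)"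
    using cardS by (intro mult_left_mono) (auto simp flip: of_nat_power of_nat_mult)
  \<comment> \<open>Here 1024 is 8^2 times 2^4. All powers of J cancel, which permits refining the
    grid.\<close>
  also have "\<dots> = 1024 * (real M)\<^sup>2 * real (card near) * (real J / 2)^4"
    by (simp add: P_def power2_eq_square power4_eq_xxxx)
  finally have "(\<Sum>x\<in>B. \<Sum>y\<in>B. (cmod (T x y))\<^sup>2) \<le> 1024 * (real M)\<^sup>2 * real (card near)"
    by (rule mult_right_le_imp_le) (use J in simp)
  then show ?thesis by (simp add: B_def T_def near_def)
qed

text \<open>The bound on the grid is independent of J, because near pairs are defined by the exact
  phases. As J grows the rounded phases converge, and the finite sum on the left depends
  continuously on them.\<close>

lemma large_sieve:
  fixes c :: "'k \<Rightarrow> complex" and \<phi> \<psi> :: "'k \<Rightarrow> real" and M :: nat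
  assumes W: "finite W" and c: "\<And>k. k \<in> W \<Longrightarrow> cmod (c k) \<le> 1" and M: "M \<ge> 1"
  shows "(\<Sum>x\<in>{- int M..int M}. \<Sum>y\<in>{- int M..int M}.
      (cmod (\<Sum>k\<in>W. c k * unit_exp (of_int x * \<phi> k + of_int y * \<psi> k)))\<^sup>2)
    \<le> 1024 * (real M)\<^sup>2 * real (card {(k, l) \<in> W \<times> W.
        (\<exists>n::int. \<bar>\<phi> k - \<phi> l - n\<bar> \<le> 1 / M) \<and> (\<exists>n::int. \<bar>\<psi> k - \<psi> l - n\<bar> \<le> 1 / M)})" (is "?L \<le> ?R")
proof -
  define P where "P n = 8 * M * Suc n" for n
  have approx: "(\<lambda>n. of_int \<lfloor>real (P n) * \<alpha>\<rfloor> / real (P n)) \<longlonglongrightarrow> \<alpha>" for \<alpha> :: real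
  proof (rule LIM_zero_cancel, rule Lim_null_comparison)
    have "\<bar>of_int \<lfloor>real (P n) * \<alpha>\<rfloor> / real (P n) - \<alpha>\<bar> \<le> 1 / real (Suc n)" for n
    proof -
      have "1 * Suc n \<le> (8 * M) * Suc n" using M by (intro mult_le_mono1) simp
      then have "Suc n \<le> P n" by (simp only: P_def mult_1)
      then have Pn: "real (P n) > 0" "real (Suc n) \<le> real (P n)" by (linarith, simp only: of_nat_le_iff)
      have "\<bar>of_int \<lfloor>real (P n) * \<alpha>\<rfloor> - real (P n) * \<alpha>\<bar> \<le> 1" by linarith
      then have "\<bar>of_int \<lfloor>real (P n) * \<alpha>\<rfloor> - real (P n) * \<alpha>\<bar> / real (P n) \<le> 1 / real (P n)"
        using Pn by (intro divide_right_mono) auto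
      also have "\<bar>of_int \<lfloor>real (P n) * \<alpha>\<rfloor> - real (P n) * \<alpha>\<bar> / real (P n) = \<bar>of_int \<lfloor>real (P n) * \<alpha>\<rfloor> / real (P n) - \<alpha>\<bar>"
      proof -
        have "of_int \<lfloor>real (P n) * \<alpha>\<rfloor> / real (P n) - \<alpha> = (of_int \<lfloor>real (P n) * \<alpha>\<rfloor> - real (P n) * \<alpha>) / real (P n)"
          using Pn by (simp add: diff_divide_distrib)
        then show ?thesis using Pn by (simp only: abs_divide abs_of_pos)
      qed
      also have "1 / real (P n) \<le> 1 / real (Suc n)" using Pn by (intro divide_left_mono) auto
      finally show ?thesis .
    qed
    then show "\<forall>\<^sub>F n in sequentially. norm (of_int \<lfloor>real (P n) * \<alpha>\<rfloor> / real (P n) - \<alpha>) \<le> 1 / real (Suc n)"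
      by simp
    show "(\<lambda>n. 1 / real (Suc n)) \<longlonglongrightarrow> 0" by (rule LIMSEQ_Suc[OF lim_1_over_n])
  qed
  have lim: "(\<lambda>n. \<Sum>x\<in>{- int M..int M}. \<Sum>y\<in>{- int M..int M}.
      (cmod (\<Sum>k\<in>W. c k * unit_exp (of_int x * (of_int \<lfloor>real (P n) * \<phi> k\<rfloor> / real (P n)) + of_int y * (of_int \<lfloor>real (P n) * \<psi> k\<rfloor> / real (P n)))))\<^sup>2)
    \<longlonglongrightarrow> ?L"
    unfolding unit_exp_def by (intro tendsto_intros approx)
  have bound: "(\<Sum>x\<in>{- int M..int M}. \<Sum>y\<in>{- int M..int M}.
      (cmod (\<Sum>k\<in>W. c k * unit_exp (of_int x * (of_int \<lfloor>real (P n) * \<phi> k\<rfloor> / real (P n)) + of_int y * (of_int \<lfloor>real (P n) * \<psi> k\<rfloor> / real (P n)))))\<^sup>2)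
    \<le> ?R" for n
    using large_sieve_grid[OF W c M, where J = "Suc n" and \<phi> = \<phi> and \<psi> = \<psi>] unfolding P_def by simp
  show ?thesis by (rule LIMSEQ_le_const2[OF lim]) (use bound in blast)
qed

section \<open>Divisors\<close>

lemma card_divisors_prime_power_mult:
  fixes m :: nat
  assumes p: "prime p" and m: "m > 0" and co: "\<not> p dvd m"
  shows "card {d. d dvd p^k * m} \<le> (k + 1) * card {d. d dvd m}"
proof -
  have "{d. d dvd p^k * m} \<subseteq> (\<lambda>(i, c). p^i * c) ` ({..k} \<times> {c. c dvd m})"
  proof
    fix d assume "d \<in> {d. d dvd p^k * m}"
    then obtain b c where bc: "d = b * c" "b dvd p^k" "c dvd m" using division_decomp by blast
    then obtain i where "i \<le> k" "b = p^i" using p divides_primepow_nat by blast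
    then show "d \<in> (\<lambda>(i, c). p^i * c) ` ({..k} \<times> {c. c dvd m})"
      using bc by (intro image_eqI[of _ _ "(i, c)"]) auto
  qed
  then have "card {d. d dvd p^k * m} \<le> card ({..k} \<times> {c. c dvd m})"
    using m by (intro surj_card_le) auto
  then show ?thesis by (simp add: card_cartesian_product)
qed

text \<open>Splitting off a full prime power p^k costs a factor k + 1. If p is at least B, so that
  p^\<epsilon> \<ge> 2, then k + 1 \<le> 2^k \<le> p^(\<epsilon> k) without loss; every smaller
  prime costs one further factor \<open>A\<close>, and \<open>\<omega>\<close> counts these primes,
  of which there are at most B.\<close>

lemma card_divisors_bound:
  fixes \<epsilon> :: real
  assumes \<epsilon>: "\<epsilon> > 0"
  shows "\<exists>C\<ge>1. \<forall>n::nat. n > 0 \<longrightarrow> real (card {d. d dvd n}) \<le> C * real n powr \<epsilon>"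
proof -
  define c where "c = \<epsilon> * ln 2"
  have c: "c > 0" using \<epsilon> by (simp add: c_def)
  \<comment> \<open>With this value k + 1 \<le> A (1 + c k) \<le> A exp(c k).\<close>
  define A where "A = 1 + 1 / c"
  have A: "A \<ge> 1" using c by (simp add: A_def)
  obtain B :: nat where B: "2 powr (1 / \<epsilon>) \<le> real B" using real_arch_simple by blast
  define \<omega> where "\<omega> n = card {p. prime p \<and> p dvd n \<and> p < B}" for n :: nat
  have fin: "finite {p. prime p \<and> p dvd n \<and> p < B}" for n :: nat
    by (rule finite_subset[of _ "{..<B}"]) auto
  have small: "real (k + 1) \<le> A * 2 powr (\<epsilon> * real k)" for k
  proof -
    have "1 + c * k \<le> 2 powr (\<epsilon> * real k)"
      using exp_ge_add_one_self[of "c * k"] by (simp add: powr_def c_def mult_ac)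
    then have "A * (1 + c * k) \<le> A * 2 powr (\<epsilon> * real k)" using A by (intro mult_left_mono) auto
    moreover have "A * (1 + c * k) = 1 + k + (1 / c + c * k)" using c by (simp add: A_def field_simps)
    moreover have "1 / c + c * k \<ge> 0" using c by simp
    ultimately show ?thesis by simp
  qed
  have main: "real (card {d. d dvd n}) \<le> A ^ \<omega> n * real n powr \<epsilon>" if "n > 0" for n
    using that
  proof (induction n rule: less_induct)
    case (less n)
    show ?case
    proof (cases "n = 1")
      case True
      have "{d. d dvd (1::nat)} = {1}" by auto
      then have "card {d. d dvd n} = 1" using True by simp
      then show ?thesis using True A by (simp add: one_le_power)
    next
      case False
      then obtain p where p: "prime p" "p dvd n" using prime_factor_nat by blast
      define k where "k = multiplicity p n"
      obtain m where m: "n = p^k * m" "\<not> p dvd m"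
        using multiplicity_decompose'[of n p] less.prems p(1) not_prime_unit unfolding k_def by blast
      have m0: "m > 0" using m less.prems by (cases m) auto
      have k: "k \<ge> 1" using p less.prems unfolding k_def by (simp add: Suc_le_eq prime_multiplicity_gt_zero_iff)
      have p2: "p \<ge> 2" using p(1) by (rule prime_ge_2_nat)
      have "1 < p^k" using p2 k by (intro one_less_power) auto
      then have mn: "m < n" using m m0 by simp
      have IH: "real (card {d. d dvd m}) \<le> A ^ \<omega> m * real m powr \<epsilon>" by (rule less.IH[OF mn m0])
      have np: "real n powr \<epsilon> = real p powr (\<epsilon> * real k) * real m powr \<epsilon>"
        using p2 unfolding m(1) by (simp add: powr_mult powr_powr mult_ac flip: powr_realpow)
      have "card {d. d dvd n} \<le> (k + 1) * card {d. d dvd m}"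
        unfolding m(1) by (rule card_divisors_prime_power_mult[OF p(1) m0 m(2)])
      then have "real (card {d. d dvd n}) \<le> real (k + 1) * real (card {d. d dvd m})"
        by (metis of_nat_le_iff of_nat_mult)
      also have "\<dots> \<le> real (k + 1) * (A ^ \<omega> m * real m powr \<epsilon>)" using IH by (intro mult_left_mono) auto
      also have "real (k + 1) * A ^ \<omega> m \<le> A ^ \<omega> n * real p powr (\<epsilon> * real k)"
      proof (cases "p < B")
        case True
        have sub: "insert p {p. prime p \<and> p dvd m \<and> p < B} \<subseteq> {p. prime p \<and> p dvd n \<and> p < B}"
          using p True m(1) by auto
        have "card (insert p {p. prime p \<and> p dvd m \<and> p < B}) \<le> \<omega> n"
          unfolding \<omega>_def by (rule card_mono[OF fin sub])
        then have "Suc (\<omega> m) \<le> \<omega> n" using fin m(2) by (simp add: \<omega>_def)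
        then have "A ^ Suc (\<omega> m) \<le> A ^ \<omega> n" using A by (rule power_increasing)
        then have AA: "A * A ^ \<omega> m \<le> A ^ \<omega> n" by simp
        have "2 powr (\<epsilon> * real k) \<le> real p powr (\<epsilon> * real k)"
          using p2 \<epsilon> by (intro powr_mono2) auto
        then have "A * 2 powr (\<epsilon> * real k) \<le> A * real p powr (\<epsilon> * real k)"
          using A by (intro mult_left_mono) auto
        then have "real (k + 1) \<le> A * real p powr (\<epsilon> * real k)"
          using small[of k] by (rule order_trans[rotated])
        then have "real (k + 1) * A ^ \<omega> m \<le> (A * real p powr (\<epsilon> * real k)) * A ^ \<omega> m"
          using A by (intro mult_right_mono) auto
        moreover have "(A * A ^ \<omega> m) * real p powr (\<epsilon> * real k) \<le> A ^ \<omega> n * real p powr (\<epsilon> * real k)"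
          using AA by (intro mult_right_mono) auto
        ultimately show ?thesis by (simp add: mult_ac)
      next
        case False
        have "2 = (2 powr (1 / \<epsilon>)) powr \<epsilon>" using \<epsilon> by (simp add: powr_powr)
        also have "\<dots> \<le> real p powr \<epsilon>" using B False \<epsilon> by (intro powr_mono2) auto
        finally have "2 ^ k \<le> (real p powr \<epsilon>) ^ k" by (intro power_mono) auto
        moreover have "(real p powr \<epsilon>) ^ k = real p powr (\<epsilon> * real k)"
          using p2 by (simp add: powr_powr flip: powr_realpow)
        moreover have "real (k + 1) \<le> 2 ^ k"
        proof -
          have "k < 2 ^ k" by (rule less_exp)
          then have "k + 1 \<le> 2 ^ k" by (simp only: Suc_eq_plus1[symmetric] Suc_le_eq)
          then show ?thesis by (metis of_nat_le_iff of_nat_numeral of_nat_power)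
        qed
        ultimately have 1: "real (k + 1) \<le> real p powr (\<epsilon> * real k)" by linarith
        have "\<omega> m \<le> \<omega> n" unfolding \<omega>_def by (rule card_mono[OF fin]) (auto simp: m(1))
        then have "A ^ \<omega> m \<le> A ^ \<omega> n" using A by (intro power_increasing)
        then have "real (k + 1) * A ^ \<omega> m \<le> real p powr (\<epsilon> * real k) * A ^ \<omega> n"
          using 1 A by (intro mult_mono) auto
        then show ?thesis by (simp add: mult.commute)
      qed
      then have "real (k + 1) * (A ^ \<omega> m * real m powr \<epsilon>) \<le> (A ^ \<omega> n * real p powr (\<epsilon> * real k)) * real m powr \<epsilon>"
        by (metis mult.assoc mult_right_mono powr_ge_zero)
      finally show ?thesis unfolding np by (simp add: mult_ac)
    qed
  qed
  have "real (card {d. d dvd n}) \<le> A ^ B * real n powr \<epsilon>" if "n > 0" for n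
  proof -
    have "\<omega> n \<le> card {..<B}" unfolding \<omega>_def by (rule card_mono) auto
    then have "A ^ \<omega> n \<le> A ^ B" using A by (intro power_increasing) auto
    then have "A ^ \<omega> n * real n powr \<epsilon> \<le> A ^ B * real n powr \<epsilon>" by (intro mult_right_mono) auto
    then show ?thesis using main[OF that] by linarith
  qed
  moreover have "A ^ B \<ge> 1" using A by (rule one_le_power)
  ultimately show ?thesis by blast
qed

text \<open>The value at 0, which every integer divides, is set to the empty set; this keeps all
  these sets finite and one bound valid for all wedge products. Vanishing products are treated as
  separate cases.\<close>

definition pos_divisors :: "int \<Rightarrow> int set" where
  "pos_divisors w = (if w = 0 then {} else {q. 0 < q \<and> q dvd w})"

lemma finite_pos_divisors [simp]: "finite (pos_divisors w)"
  unfolding pos_divisors_def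
  by (auto intro: finite_subset[of _ "{0..\<bar>w\<bar>}"] simp: dvd_imp_le_int)

lemma card_pos_divisors: "card (pos_divisors w) \<le> card {d. d dvd nat \<bar>w\<bar>}" if "w \<noteq> 0"
proof -
  have "pos_divisors w \<subseteq> int ` {d. d dvd nat \<bar>w\<bar>}"
  proof
    fix q assume "q \<in> pos_divisors w"
    then have "0 < q" "q dvd w" using that by (auto simp: pos_divisors_def)
    then have "nat q dvd nat \<bar>w\<bar>" by (simp add: nat_dvd_iff)
    then show "q \<in> int ` {d. d dvd nat \<bar>w\<bar>}" using \<open>0 < q\<close> by (intro image_eqI[of _ _ "nat q"]) auto
  qed
  moreover have "finite {d. d dvd nat \<bar>w\<bar>}" by (rule finite_divisors_nat) (use that in simp)
  ultimately show ?thesis by (rule surj_card_le[rotated])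
qed

section \<open>Sums of greatest common divisors over a box\<close>

lemma harmonic_le:
  "n \<ge> 1 \<Longrightarrow> (\<Sum>g = 1..n. 1 / real g) \<le> 1 + ln (real n)"
proof (induction n rule: nat_induct_at_least)
  case base
  show ?case by simp
next
  case (Suc n)
  have "ln (real n / real (Suc n)) \<le> real n / real (Suc n) - 1"
    using Suc by (intro ln_le_minus_one) auto
  then have "ln (real n) - ln (real (Suc n)) \<le> - 1 / real (Suc n)"
    using Suc by (simp add: ln_div field_simps)
  then show ?case using Suc by simp
qed

definition punctured_box :: "real \<Rightarrow> (int \<times> int) set" where
  "punctured_box Z = {z. z \<noteq> (0, 0) \<and> \<bar>real_of_int (fst z)\<bar> \<le> Z \<and> \<bar>real_of_int (snd z)\<bar> \<le> Z}"

lemma finite_punctured_box [simp]: "finite (punctured_box Z)"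
proof (rule finite_subset)
  show "punctured_box Z \<subseteq> {-\<lfloor>Z\<rfloor>..\<lfloor>Z\<rfloor>} \<times> {-\<lfloor>Z\<rfloor>..\<lfloor>Z\<rfloor>}"
    by (auto simp: punctured_box_def abs_le_iff le_floor_iff minus_le_iff)
qed simp

text \<open>The gcd is at most the sum of all common divisors g up to n. After exchanging the sums,
  at most (3n/g)^2 vectors are divisible by g, which leaves a harmonic sum. The 3 comes from 2k + 1
  \<le> 3k for k = n div g, which is positive.\<close>

lemma sum_gcd_box:
  assumes Z: "0 \<le> Z"
  shows "(\<Sum>z\<in>punctured_box Z. real_of_int (gcd (fst z) (snd z))) \<le> 9 * Z\<^sup>2 * (1 + ln (1 + Z))"
proof (cases "Z < 1")
  case True
  have "punctured_box Z = {}" using True by (auto simp: punctured_box_def)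
  then show ?thesis using Z by simp
next
  case False
  define n where "n = nat \<lfloor>Z\<rfloor>"
  have n: "n \<ge> 1" "real n \<le> Z" using False unfolding n_def by linarith+
  have box: "punctured_box Z = {z. z \<noteq> (0, 0) \<and> \<bar>fst z\<bar> \<le> int n \<and> \<bar>snd z\<bar> \<le> int n}"
    unfolding punctured_box_def n_def using False by (auto simp: abs_le_iff le_floor_iff minus_le_iff)
  define M where "M g = {x::int. \<bar>x\<bar> \<le> int n \<and> int g dvd x}" for g
  have finM: "finite (M g)" for g
    by (rule finite_subset[of _ "{- int n..int n}"]) (auto simp: M_def)
  have cardM: "real (card (M g)) \<le> 3 * n / g" if g: "g \<in> {1..n}" for g
  proof -
    have "M g \<subseteq> (\<lambda>k. int g * k) ` {- int (n div g)..int (n div g)}"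
    proof
      fix x assume "x \<in> M g"
      then obtain k where k: "x = int g * k" "\<bar>x\<bar> \<le> int n" by (auto simp: M_def elim: dvdE)
      have "\<bar>k\<bar> * int g \<le> int n" using k by (simp add: abs_mult mult.commute)
      then have "(\<bar>k\<bar> * int g) div int g \<le> int n div int g" using g by (intro zdiv_mono1) auto
      then have "\<bar>k\<bar> \<le> int n div int g" using g by simp
      then show "x \<in> (\<lambda>k. int g * k) ` {- int (n div g)..int (n div g)}"
        using k by (intro image_eqI[of _ _ k]) (auto simp: zdiv_int)
    qed
    then have "card (M g) \<le> card {- int (n div g)..int (n div g)}" by (intro surj_card_le) auto
    also have "\<dots> = 2 * (n div g) + 1" by simp
    finally have "real (card (M g)) \<le> 2 * real (n div g) + 1" by linarith
    also have "\<dots> \<le> 3 * real (n div g)"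
    proof -
      have "1 \<le> n div g" using g by (simp add: Suc_le_eq div_greater_zero_iff)
      then show ?thesis by linarith
    qed
    also have "\<dots> \<le> 3 * (real n / real g)"
    proof -
      have "real (n div g * g) \<le> real n" by (simp only: of_nat_le_iff div_times_less_eq_dividend)
      then show ?thesis using g by (simp add: pos_le_divide_eq)
    qed
    finally show ?thesis by simp
  qed
  have "(\<Sum>z\<in>punctured_box Z. real_of_int (gcd (fst z) (snd z)))
     \<le> (\<Sum>z\<in>punctured_box Z. \<Sum>g\<in>{1..n}. if int g dvd fst z \<and> int g dvd snd z then real g else 0)"
  proof (rule sum_mono)
    fix z assume z: "z \<in> punctured_box Z"
    define g where "g = nat (gcd (fst z) (snd z))"
    have nz: "fst z \<noteq> 0 \<or> snd z \<noteq> 0" using z by (auto simp: punctured_box_def prod_eq_iff)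
    have "gcd (fst z) (snd z) \<le> int n"
    proof (cases "fst z = 0")
      case True
      then show ?thesis using z by (simp add: box)
    next
      case False
      have "gcd (fst z) (snd z) \<le> \<bar>fst z\<bar>" using dvd_imp_le_int[OF False, of "gcd (fst z) (snd z)"] by simp
      also have "\<dots> \<le> int n" using z by (simp add: box)
      finally show ?thesis .
    qed
    moreover have "gcd (fst z) (snd z) > 0" using nz by simp
    moreover have "nat x \<in> {1..n} \<and> int (nat x) = x" if "x \<le> int n" "x > 0" for x using that by auto
    ultimately have g: "g \<in> {1..n}" "int g = gcd (fst z) (snd z)" unfolding g_def by blast+
    have "real_of_int (gcd (fst z) (snd z)) = (\<Sum>h\<in>{g}. if int h dvd fst z \<and> int h dvd snd z then real h else 0)"
    proof -
      have "int g dvd fst z" "int g dvd snd z" unfolding g(2) by auto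
      moreover have "real_of_int (gcd (fst z) (snd z)) = real g" unfolding g(2)[symmetric] by simp
      ultimately show ?thesis by simp
    qed
    also have "\<dots> \<le> (\<Sum>h\<in>{1..n}. if int h dvd fst z \<and> int h dvd snd z then real h else 0)"
      using g(1) by (intro sum_mono2) auto
    finally show "real_of_int (gcd (fst z) (snd z)) \<le> (\<Sum>h\<in>{1..n}. if int h dvd fst z \<and> int h dvd snd z then real h else 0)" .
  qed
  also have "\<dots> = (\<Sum>g\<in>{1..n}. \<Sum>z\<in>punctured_box Z. if int g dvd fst z \<and> int g dvd snd z then real g else 0)"
    by (rule sum.swap)
  also have "\<dots> \<le> (\<Sum>g\<in>{1..n}. 9 * (real n)\<^sup>2 * (1 / real g))"
  proof (rule sum_mono)
    fix g assume g: "g \<in> {1..n}"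
    have "(\<Sum>z\<in>punctured_box Z. if int g dvd fst z \<and> int g dvd snd z then real g else 0)
       = (\<Sum>z\<in>{z \<in> punctured_box Z. int g dvd fst z \<and> int g dvd snd z}. real g)"
      by (rule sum.inter_filter[symmetric]) simp
    also have "\<dots> = real (card {z \<in> punctured_box Z. int g dvd fst z \<and> int g dvd snd z}) * real g" by simp
    also have "\<dots> \<le> real (card (M g \<times> M g)) * real g"
      using finM by (intro mult_right_mono of_nat_mono card_mono) (auto simp: box M_def)
    also have "\<dots> = real (card (M g)) * real (card (M g)) * real g" by (simp add: card_cartesian_product)
    also have "\<dots> \<le> (3 * n / g) * (3 * n / g) * real g"
      using cardM[OF g] by (intro mult_right_mono mult_mono) auto
    also have "\<dots> = 9 * (real n)\<^sup>2 * (1 / real g)" using g by (simp add: power2_eq_square)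
    finally show "(\<Sum>z\<in>punctured_box Z. if int g dvd fst z \<and> int g dvd snd z then real g else 0) \<le> 9 * (real n)\<^sup>2 * (1 / real g)" .
  qed
  also have "\<dots> = 9 * (real n)\<^sup>2 * (\<Sum>g = 1..n. 1 / real g)" by (simp only: sum_distrib_left)
  also have "\<dots> \<le> 9 * Z\<^sup>2 * (1 + ln (1 + Z))"
  proof (intro mult_mono power_mono)
    have "ln (real n) \<le> ln (1 + Z)" using n by (subst ln_le_cancel_iff) auto
    then show "(\<Sum>g = 1..n. 1 / real g) \<le> 1 + ln (1 + Z)" using harmonic_le[OF n(1)] by linarith
  qed (use n in \<open>auto intro!: sum_nonneg\<close>)
  finally show ?thesis .
qed

section \<open>Pairs of nearby frequencies\<close>

definition wedge :: "int \<times> int \<Rightarrow> int \<times> int \<Rightarrow> int" where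
  "wedge y z = fst y * snd z - snd y * fst z"

text \<open>With denominators cleared, y a / q - y' a' / q' agrees with z / (q q') modulo 1 in both
  coordinates.\<close>

definition cross_cong :: "int \<times> int \<Rightarrow> int \<times> int \<Rightarrow> int \<times> int \<Rightarrow> int \<Rightarrow> int \<Rightarrow> int \<Rightarrow> int \<Rightarrow> bool" where
  "cross_cong y y' z a q a' q' \<longleftrightarrow>
     q * q' dvd fst y * a * q' - fst y' * a' * q - fst z \<and>
     q * q' dvd snd y * a * q' - snd y' * a' * q - snd z"

lemma dvd_of_coprime_pair:
  fixes y1 y2 m q :: int
  assumes co: "coprime y1 y2" and "q dvd y1 * m" "q dvd y2 * m"
  shows "q dvd m"
proof -
  have "q dvd gcd (y1 * m) (y2 * m)" using assms by simp
  also have "gcd (y1 * m) (y2 * m) = \<bar>m\<bar>" unfolding mult.commute[of _ m] using co by (simp add: gcd_mult_left)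
  finally show ?thesis by simp
qed

lemma cross_cong_swap:
  "cross_cong y y' z a q a' q' \<Longrightarrow> cross_cong y' y (- fst z, - snd z) a' q' a q"
  unfolding cross_cong_def
  by (subst (1 2) dvd_minus_iff[symmetric]) (simp add: algebra_simps)

text \<open>Modulo q the term with y' disappears, so z becomes a multiple of y.\<close>

lemma cross_cong_dvd:
  assumes R: "cross_cong y y' z a q a' q'"
  shows "q dvd fst y * (a * q') - fst z" "q dvd snd y * (a * q') - snd z" "q dvd wedge y z"
proof -
  obtain n1 where n1: "fst y * a * q' - fst y' * a' * q - fst z = q * q' * n1" using R by (auto simp: cross_cong_def)
  obtain n2 where n2: "snd y * a * q' - snd y' * a' * q - snd z = q * q' * n2" using R by (auto simp: cross_cong_def)
  have e1: "fst y * (a * q') - fst z = q * (q' * n1 + fst y' * a')" using n1 by (simp add: algebra_simps)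
  have e2: "snd y * (a * q') - snd z = q * (q' * n2 + snd y' * a')" using n2 by (simp add: algebra_simps)
  show "q dvd fst y * (a * q') - fst z" "q dvd snd y * (a * q') - snd z"
    unfolding e1 e2 by simp_all
  have "wedge y z = snd y * (fst y * (a * q') - fst z) - fst y * (snd y * (a * q') - snd z)"
    by (simp add: wedge_def algebra_simps)
  then show "q dvd wedge y z" unfolding e1 e2 by (metis dvd_diff dvd_mult dvd_triv_left)
qed

lemma cross_cong_dvd':
  assumes R: "cross_cong y y' z a q a' q'"
  shows "q' dvd wedge y' z" "gcd q q' dvd fst z" "gcd q q' dvd snd z"
proof -
  have "q' dvd wedge y' (- fst z, - snd z)" using cross_cong_dvd(3)[OF cross_cong_swap[OF R]] .
  then have "q' dvd - wedge y' z" by (simp add: wedge_def)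
  then show "q' dvd wedge y' z" by simp
  have g: "gcd q q' dvd q" "gcd q q' dvd q'" by simp_all
  have "gcd q q' dvd fst y * (a * q') - fst z" "gcd q q' dvd snd y * (a * q') - snd z"
    using cross_cong_dvd(1,2)[OF R] g(1) by (meson dvd_trans)+
  moreover have "gcd q q' dvd fst y * (a * q')" "gcd q q' dvd snd y * (a * q')" using g(2) by simp_all
  ultimately show "gcd q q' dvd fst z" "gcd q q' dvd snd z"
    by (metis dvd_diff_right_iff)+
qed

text \<open>Modulo q, the vector z fixes y a q'. As y is primitive and a is invertible, this fixes
  q'.\<close>

lemma cross_cong_unique_denominator:
  assumes co: "coprime (fst y) (snd y)" and aq: "coprime a q"
    and R: "cross_cong y y' z a q a' q'" "cross_cong y y' z a q a'' q''"
  shows "q dvd q' - q''"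
proof -
  have "q dvd (fst y * (a * q') - fst z) - (fst y * (a * q'') - fst z)"
    "q dvd (snd y * (a * q') - snd z) - (snd y * (a * q'') - snd z)"
    using cross_cong_dvd(1,2)[OF R(1)] cross_cong_dvd(1,2)[OF R(2)] by (meson dvd_diff)+
  then have "q dvd fst y * (a * (q' - q''))" "q dvd snd y * (a * (q' - q''))"
    by (simp_all add: algebra_simps)
  then have "q dvd a * (q' - q'')" using co by (rule dvd_of_coprime_pair[rotated 1])
  then show ?thesis using aq by (simp add: coprime_commute coprime_dvd_mult_right_iff)
qed

lemma cross_cong_unique_numerator:
  assumes co: "coprime (fst y') (snd y')" and q: "q \<noteq> 0"
    and R: "cross_cong y y' z a q a' q'" "cross_cong y y' z a q a'' q'"
  shows "q' dvd a' - a''"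
proof -
  have "q * q' dvd (fst y * a * q' - fst y' * a'' * q - fst z) - (fst y * a * q' - fst y' * a' * q - fst z)"
    "q * q' dvd (snd y * a * q' - snd y' * a'' * q - snd z) - (snd y * a * q' - snd y' * a' * q - snd z)"
    using R unfolding cross_cong_def by (meson dvd_diff)+
  then have "q * q' dvd q * (fst y' * (a' - a''))" "q * q' dvd q * (snd y' * (a' - a''))"
    by (simp_all add: algebra_simps)
  then have "q' dvd fst y' * (a' - a'')" "q' dvd snd y' * (a' - a'')" using q by simp_all
  then show ?thesis using co by (rule dvd_of_coprime_pair[rotated 1])
qed

text \<open>Modulo q the product a q' is fixed; cancelling the gcd of q and q' fixes a modulo the
  quotient.\<close>

lemma cross_cong_numerator_mod:
  assumes co: "coprime (fst y) (snd y)" and q: "q > 0"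
    and R: "cross_cong y y' z a q a' q'" "cross_cong y y' z b q b' q'"
  shows "q div gcd q q' dvd a - b"
proof -
  have "q dvd (fst y * (a * q') - fst z) - (fst y * (b * q') - fst z)"
    "q dvd (snd y * (a * q') - snd z) - (snd y * (b * q') - snd z)"
    using cross_cong_dvd(1,2)[OF R(1)] cross_cong_dvd(1,2)[OF R(2)] by (meson dvd_diff)+
  then have "q dvd fst y * ((a - b) * q')" "q dvd snd y * ((a - b) * q')"
    by (simp_all add: algebra_simps)
  then have 1: "q dvd (a - b) * q'" using co by (rule dvd_of_coprime_pair[rotated 1])
  define g where "g = gcd q q'"
  have g: "g \<noteq> 0" using q by (simp add: g_def)
  have "coprime (q div g) (q' div g)" unfolding g_def using q by (intro div_gcd_coprime) simp
  moreover have "g * (q div g) dvd g * ((a - b) * (q' div g))"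
  proof -
    have e: "g * (q div g) = q" "g * ((a - b) * (q' div g)) = (a - b) * q'"
      by (simp_all add: g_def mult.left_commute)
    show ?thesis unfolding e by (rule 1)
  qed
  then have "q div g dvd (a - b) * (q' div g)" using g by simp
  ultimately show ?thesis unfolding g_def by (simp add: coprime_dvd_mult_left_iff)
qed

text \<open>Primitivity makes q and q' divide each other. Dividing the congruence by q then leaves y
  a equal to y' a' modulo q, so y and y' are parallel modulo q.\<close>

lemma cross_cong_zero:
  assumes co: "coprime (fst y) (snd y)" "coprime (fst y') (snd y')" "coprime a q" "coprime a' q'"
    and q: "q > 0" "q' > 0" and R: "cross_cong y y' (0, 0) a q a' q'"
  shows "q = q'" "q dvd wedge y y'"
proof -
  have dv: "r dvd r'" if "coprime (fst x) (snd x)" "coprime b r" "cross_cong x x' (0, 0) b r b' r'" for x x' b r b' r'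
  proof -
    have "r dvd fst x * (b * r')" "r dvd snd x * (b * r')" using cross_cong_dvd(1,2)[OF that(3)] by simp_all
    then have "r dvd b * r'" using that(1) by (rule dvd_of_coprime_pair[rotated 1])
    then show ?thesis using that(2) by (simp add: coprime_commute coprime_dvd_mult_right_iff)
  qed
  have "q dvd q'" "q' dvd q" using dv[OF co(1,3) R] dv[OF co(2,4)] cross_cong_swap[OF R] by simp_all
  then show eq: "q = q'" using q by (simp add: zdvd_antisym_nonneg)
  have "q * q dvd q * (fst y * a - fst y' * a')" "q * q dvd q * (snd y * a - snd y' * a')"
    using R unfolding cross_cong_def eq[symmetric] by (simp_all add: algebra_simps)
  then have "q dvd fst y * a - fst y' * a'" "q dvd snd y * a - snd y' * a'" using q by simp_all
  then have "q dvd snd y' * (fst y * a - fst y' * a') - fst y' * (snd y * a - snd y' * a')"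
    by (rule dvd_diff[OF dvd_mult dvd_mult])
  then have "q dvd a * wedge y y'" by (simp add: wedge_def algebra_simps)
  then show "q dvd wedge y y'" using co(3) by (simp add: coprime_commute coprime_dvd_mult_right_iff)
qed

lemma wedge_eq_0:
  assumes co: "coprime (fst y) (snd y)" and w: "wedge y z = 0"
  obtains m where "z = (m * fst y, m * snd y)" "\<bar>m\<bar> = gcd (fst z) (snd z)"
proof -
  obtain u v where uv: "u * fst y + v * snd y = 1"
    using bezout_int[of "fst y" "snd y"] co by (auto simp: coprime_iff_gcd_eq_1)
  define m where "m = u * fst z + v * snd z"
  have w': "fst y * snd z = snd y * fst z" using w by (simp add: wedge_def)
  have "m * fst y = (u * fst y + v * snd y) * fst z" using w' by (simp add: m_def algebra_simps)
  then have z1: "fst z = m * fst y" using uv by simp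
  have "m * snd y = (u * fst y + v * snd y) * snd z" using w' by (simp add: m_def algebra_simps)
  then have z2: "snd z = m * snd y" using uv by simp
  have "gcd (fst z) (snd z) = \<bar>m\<bar>" unfolding z1 z2 using co by (simp add: gcd_mult_left)
  then show ?thesis using that[of m] z1 z2 by (metis prod.collapse)
qed

lemma primitive_parallel:
  assumes co: "coprime (fst y) (snd y)" "coprime (fst y') (snd y')" and z: "z \<noteq> (0, 0)"
    and w: "wedge y z = 0" "wedge y' z = 0"
  shows "y' = y \<or> y' = (- fst y, - snd y)"
proof -
  obtain m where m: "z = (m * fst y, m * snd y)" "\<bar>m\<bar> = gcd (fst z) (snd z)" by (rule wedge_eq_0[OF co(1) w(1)])
  obtain k where k: "z = (k * fst y', k * snd y')" "\<bar>k\<bar> = gcd (fst z) (snd z)" by (rule wedge_eq_0[OF co(2) w(2)])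
  have "m \<noteq> 0" using m z by auto
  have "k = m \<or> k = - m" using m(2) k(2) by linarith
  then show ?thesis
  proof
    assume "k = m"
    then have "m * fst y = m * fst y'" "m * snd y = m * snd y'" using m(1) k(1) by auto
    then show ?thesis using \<open>m \<noteq> 0\<close> by (simp add: prod_eq_iff)
  next
    assume "k = - m"
    then have "m * fst y = m * (- fst y')" "m * snd y = m * (- snd y')" using m(1) k(1) by auto
    then have "fst y = - fst y'" "snd y = - snd y'" using \<open>m \<noteq> 0\<close> by (simp_all only: mult_cancel_left) auto
    then show ?thesis by (simp add: prod_eq_iff)
  qed
qed

section \<open>Counting near pairs\<close>

lemma card_Sigma_bound:
  assumes "finite A" "\<And>a. a \<in> A \<Longrightarrow> finite (B a)" "\<And>a. a \<in> A \<Longrightarrow> real (card (B a)) \<le> c a"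
  shows "real (card (Sigma A B)) \<le> (\<Sum>a\<in>A. c a)"
  using assms by (simp add: card_SigmaI sum_mono)

lemma card_Sigma_const_bound:
  assumes "finite A" "\<And>a. a \<in> A \<Longrightarrow> finite (B a)" "\<And>a. a \<in> A \<Longrightarrow> real (card (B a)) \<le> c"
  shows "real (card (Sigma A B)) \<le> real (card A) * c"
  using card_Sigma_bound[of A B "\<lambda>_. c"] assms by simp

definition farey_pairs :: "real \<Rightarrow> (int \<times> int) set" where
  "farey_pairs Q = {(a, q). Q / 2 \<le> real_of_int q \<and> real_of_int q < Q \<and> 0 \<le> a \<and> a < q \<and> coprime a q}"

definition near_pairs :: "(int \<times> int) set \<Rightarrow> real \<Rightarrow> real \<Rightarrow> real \<Rightarrow>
    (((int \<times> int) \<times> int \<times> int) \<times> ((int \<times> int) \<times> int \<times> int)) set" where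
  "near_pairs Y Q \<beta> K = {((y, a, q), (y', a', q')) \<in> (Y \<times> farey_pairs Q) \<times> (Y \<times> farey_pairs Q).
     (\<exists>n::int. \<bar>fst y * (a / q + \<beta>) - fst y' * (a' / q' + \<beta>) - n\<bar> \<le> 1 / K) \<and>
     (\<exists>n::int. \<bar>snd y * (a / q + \<beta>) - snd y' * (a' / q' + \<beta>) - n\<bar> \<le> 1 / K)}"

text \<open>z is what remains after clearing denominators and subtracting the nearest integer. The
  shift \<beta> does not enter the congruence; it is moved into the size of z, which therefore
  depends on the difference of the coordinates.\<close>

lemma near_residue:
  fixes y y' a q a' q' :: int and \<beta> K Q :: real
  assumes q: "0 < q" "0 < q'" "real_of_int q < Q" "real_of_int q' < Q" and K: "K > 0"
    and near: "\<exists>n::int. \<bar>y * (a / q + \<beta>) - y' * (a' / q' + \<beta>) - n\<bar> \<le> 1 / K"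
  shows "\<exists>z::int. q * q' dvd y * a * q' - y' * a' * q - z \<and> \<bar>real_of_int z\<bar> \<le> Q\<^sup>2 * (1 / K + \<bar>\<beta>\<bar> * \<bar>real_of_int (y - y')\<bar>)"
proof -
  obtain n :: int where n: "\<bar>y * (a / q + \<beta>) - y' * (a' / q' + \<beta>) - n\<bar> \<le> 1 / K" using near by blast
  define z where "z = y * a * q' - y' * a' * q - q * q' * n"
  have qq: "real_of_int q * real_of_int q' > 0" using q by simp
  have "real_of_int z / (real_of_int q * real_of_int q') = y * (a / q) - y' * (a' / q') - n"
    using q by (simp add: z_def field_simps)
  also have "\<dots> = (y * (a / q + \<beta>) - y' * (a' / q' + \<beta>) - n) - \<beta> * real_of_int (y - y')"
    by (simp add: algebra_simps)
  finally have eq: "real_of_int z / (real_of_int q * real_of_int q')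
     = (y * (a / q + \<beta>) - y' * (a' / q' + \<beta>) - n) - \<beta> * real_of_int (y - y')" .
  have tri: "\<bar>u - w\<bar> \<le> c + \<bar>w\<bar>" if "\<bar>u\<bar> \<le> c" for u w c :: real using that by linarith
  have "\<bar>real_of_int z / (real_of_int q * real_of_int q')\<bar> \<le> 1 / K + \<bar>\<beta>\<bar> * \<bar>real_of_int (y - y')\<bar>"
    unfolding eq abs_mult[symmetric] by (rule tri[OF n])
  then have "\<bar>real_of_int z\<bar> / (real_of_int q * real_of_int q') \<le> 1 / K + \<bar>\<beta>\<bar> * \<bar>real_of_int (y - y')\<bar>"
    using q by (simp add: abs_mult)
  then have "\<bar>real_of_int z\<bar> \<le> (1 / K + \<bar>\<beta>\<bar> * \<bar>real_of_int (y - y')\<bar>) * (real_of_int q * real_of_int q')"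
    using qq by (simp only: pos_divide_le_eq)
  also have "\<dots> \<le> (1 / K + \<bar>\<beta>\<bar> * \<bar>real_of_int (y - y')\<bar>) * (Q * Q)"
    using q K by (intro mult_left_mono mult_mono) auto
  finally have "\<bar>real_of_int z\<bar> \<le> Q\<^sup>2 * (1 / K + \<bar>\<beta>\<bar> * \<bar>real_of_int (y - y')\<bar>)"
    by (simp add: power2_eq_square mult.commute)
  moreover have "y * a * q' - y' * a' * q - z = q * q' * n" by (simp add: z_def)
  ultimately show ?thesis by (metis dvd_triv_left)
qed

text \<open>Each near pair satisfies the congruence \<open>y a q' \<equiv> y' a' q + z\<close> modulo \<open>q q'\<close> with a short vector \<open>z\<close>.
  Both \<open>(y, y', z, q, a)\<close> and \<open>(y, y', z, q, q')\<close> together with one of at most \<open>gcd z\<close> classes of \<open>a\<close>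
  determine the pair. As \<open>q\<close> divides \<open>wedge y z\<close> and \<open>q'\<close> divides \<open>wedge y' z\<close>, the generic
  pairs are counted by the divisor bound; the other cases are \<open>z = 0\<close> and the vanishing of one or
  both of the wedge products.\<close>

lemma near_pairs_bound:
  fixes Y :: "(int \<times> int) set" and Q \<beta> K Y0 d Z m0 :: real
  assumes finY: "finite Y" and coY: "\<And>y. y \<in> Y \<Longrightarrow> coprime (fst y) (snd y)"
    and bdY: "\<And>y. y \<in> Y \<Longrightarrow> \<bar>real_of_int (fst y)\<bar> \<le> Y0 \<and> \<bar>real_of_int (snd y)\<bar> \<le> Y0"
    and Q: "Q > 0" and K: "K > 0" and Y0: "Y0 \<ge> 0" and d: "d \<ge> 0"
    and div: "\<And>w. w \<noteq> 0 \<Longrightarrow> \<bar>real_of_int w\<bar> \<le> 2 * Y0 * (Y0 + Q\<^sup>2 * (1 / K + 2 * \<bar>\<beta>\<bar> * Y0)) \<Longrightarrow> real (card (pos_divisors w)) \<le> d"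
  defines "Z \<equiv> Q\<^sup>2 * (1 / K + 2 * \<bar>\<beta>\<bar> * Y0)"
  defines "m0 \<equiv> Q\<^sup>2 * (1 / K + 2 * \<bar>\<beta>\<bar>)"
  shows "real (card (near_pairs Y Q \<beta> K)) \<le> 2 * real (card Y) * (2 * m0 + 1) * Q\<^sup>2 + (real (card Y))\<^sup>2 * d * Q
     + ((real (card Y))\<^sup>2 * d\<^sup>2 + 4 * real (card Y) * Q * d) * (9 * Z\<^sup>2 * (1 + ln (1 + Z)))"
proof -
  define E where "E = near_pairs Y Q \<beta> K"
  define good where "good p z \<longleftrightarrow> (case p of ((y, a, q), (y', a', q')) \<Rightarrow> cross_cong y y' z a q a' q' \<and>
      \<bar>real_of_int (fst z)\<bar> \<le> Q\<^sup>2 * (1 / K + \<bar>\<beta>\<bar> * \<bar>real_of_int (fst y - fst y')\<bar>) \<and>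
      \<bar>real_of_int (snd z)\<bar> \<le> Q\<^sup>2 * (1 / K + \<bar>\<beta>\<bar> * \<bar>real_of_int (snd y - snd y')\<bar>))"
    for p :: "((int \<times> int) \<times> int \<times> int) \<times> ((int \<times> int) \<times> int \<times> int)" and z
  have Z: "Z \<ge> 0" using K Y0 by (simp add: Z_def)
  have m0: "m0 \<ge> 0" using K by (simp add: m0_def)
  have memE: "y \<in> Y \<and> y' \<in> Y \<and> Q / 2 \<le> q \<and> q < Q \<and> 0 \<le> a \<and> a < q \<and> coprime a q
      \<and> Q / 2 \<le> q' \<and> q' < Q \<and> 0 \<le> a' \<and> a' < q' \<and> coprime a' q' \<and> 0 < q \<and> 0 < q'"
    if "((y, a, q), (y', a', q')) \<in> E" for y a q y' a' q'
    using that by (auto simp: E_def near_pairs_def farey_pairs_def)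
  have "\<exists>z. good p z" if p: "p \<in> E" for p
  proof -
    obtain y a q y' a' q' where p': "p = ((y, a, q), (y', a', q'))" by (metis prod.collapse)
    have qs: "0 < q" "0 < q'" "real_of_int q < Q" "real_of_int q' < Q" using memE p p' by auto
    have n: "\<exists>n::int. \<bar>fst y * (a / q + \<beta>) - fst y' * (a' / q' + \<beta>) - n\<bar> \<le> 1 / K"
      "\<exists>n::int. \<bar>snd y * (a / q + \<beta>) - snd y' * (a' / q' + \<beta>) - n\<bar> \<le> 1 / K"
      using p unfolding p' E_def near_pairs_def by simp_all
    obtain z1 z2 where "q * q' dvd fst y * a * q' - fst y' * a' * q - z1"
        "\<bar>real_of_int z1\<bar> \<le> Q\<^sup>2 * (1 / K + \<bar>\<beta>\<bar> * \<bar>real_of_int (fst y - fst y')\<bar>)"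
        "q * q' dvd snd y * a * q' - snd y' * a' * q - z2"
        "\<bar>real_of_int z2\<bar> \<le> Q\<^sup>2 * (1 / K + \<bar>\<beta>\<bar> * \<bar>real_of_int (snd y - snd y')\<bar>)"
      using near_residue[OF qs K n(1)] near_residue[OF qs K n(2)] by blast
    then have "good p (z1, z2)" by (simp add: good_def p' cross_cong_def)
    then show ?thesis ..
  qed
  then have "\<forall>p\<in>E. \<exists>z. good p z" by blast
  from bchoice[OF this] obtain zf where zf: "\<forall>p\<in>E. good p (zf p)" ..
  have zgood: "cross_cong y y' (zf p) a q a' q'"
      "\<bar>real_of_int (fst (zf p))\<bar> \<le> Q\<^sup>2 * (1 / K + \<bar>\<beta>\<bar> * \<bar>real_of_int (fst y - fst y')\<bar>)"
      "\<bar>real_of_int (snd (zf p))\<bar> \<le> Q\<^sup>2 * (1 / K + \<bar>\<beta>\<bar> * \<bar>real_of_int (snd y - snd y')\<bar>)"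
    if "p \<in> E" "p = ((y, a, q), (y', a', q'))" for p y a q y' a' q'
    using zf that by (auto simp: good_def)
  have zZ: "\<bar>real_of_int (fst (zf p))\<bar> \<le> Z \<and> \<bar>real_of_int (snd (zf p))\<bar> \<le> Z" if p: "p \<in> E" for p
  proof -
    obtain y a q y' a' q' where p': "p = ((y, a, q), (y', a', q'))" by (metis prod.collapse)
    have yy: "y \<in> Y" "y' \<in> Y" using memE p p' by auto
    have le: "Q\<^sup>2 * (1 / K + \<bar>\<beta>\<bar> * \<bar>real_of_int (u - v)\<bar>) \<le> Z" if "\<bar>real_of_int u\<bar> \<le> Y0" "\<bar>real_of_int v\<bar> \<le> Y0" for u v
    proof -
      have "\<bar>real_of_int (u - v)\<bar> \<le> 2 * Y0" using that by simp
      then have "\<bar>\<beta>\<bar> * \<bar>real_of_int (u - v)\<bar> \<le> \<bar>\<beta>\<bar> * (2 * Y0)" by (intro mult_left_mono) auto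
      then have "1 / K + \<bar>\<beta>\<bar> * \<bar>real_of_int (u - v)\<bar> \<le> 1 / K + 2 * \<bar>\<beta>\<bar> * Y0" by simp
      then show ?thesis unfolding Z_def by (intro mult_left_mono) auto
    qed
    show ?thesis
      using zgood(2,3)[OF p p'] le bdY yy by (meson order_trans)
  qed
  \<comment> \<open>\<open>H\<close> keeps a and forgets q'. \<open>F\<close> keeps both
    denominators, but of a only the index of its block of length \<open>q div gcd q q'\<close>;
    inside a block the congruence fixes a.\<close>
  define F where "F p = (case p of ((y, a, q), (y', a', q')) \<Rightarrow> (y, y', zf p, q, q', a div (q div gcd q q')))" for p
  define H where "H p = (case p of ((y, a, q), (y', a', q')) \<Rightarrow> (y, y', zf p, q, a))" for p
  have inj_H: "inj_on H E"
  proof (rule inj_onI)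
    fix p r assume p: "p \<in> E" and r: "r \<in> E" and e: "H p = H r"
    obtain y a q y' a' q' where p': "p = ((y, a, q), (y', a', q'))" by (metis prod.collapse)
    obtain x b t x' a'' q'' where r0: "r = ((x, b, t), (x', a'', q''))" by (metis prod.collapse)
    have "H r = (x, x', zf r, t, b)" "H p = (y, y', zf p, q, a)" by (simp_all add: H_def p' r0)
    then have "(x, x', zf r, t, b) = (y, y', zf p, q, a)" using e by (simp only:)
    then have "x = y" "x' = y'" "t = q" "b = a" and zz: "zf r = zf p" unfolding prod.inject by blast+
    then have r': "r = ((y, a, q), (y', a'', q''))" using r0 by simp
    note mp = memE[OF p[unfolded p']] and mr = memE[OF r[unfolded r']]
    have R: "cross_cong y y' (zf p) a q a' q'" "cross_cong y y' (zf p) a q a'' q''"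
      using zgood(1)[OF p p'] zgood(1)[OF r r'] zz by simp_all
    \<comment> \<open>The dyadic range matters here: q' and q'' lie in [Q/2, Q), so they differ by
      less than Q/2, which is at most q.\<close>
    have "q dvd q' - q''" by (rule cross_cong_unique_denominator[OF _ _ R]) (use mp coY in auto)
    moreover have "\<bar>q' - q''\<bar> < q" using mp mr by linarith
    ultimately have qq: "q'' = q'" using dvd_imp_le_int[of "q' - q''" q] mp by linarith
    have "q' dvd a' - a''" by (rule cross_cong_unique_numerator[OF _ _ R(1) R(2)[unfolded qq]]) (use mp coY in auto)
    moreover have "\<bar>a' - a''\<bar> < q'" using mp mr qq by linarith
    ultimately have "a'' = a'" using dvd_imp_le_int[of "a' - a''" q'] mp by linarith
    then show "p = r" by (simp add: p' r' qq)
  qed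
  have inj_F: "inj_on F E"
  proof (rule inj_onI)
    fix p r assume p: "p \<in> E" and r: "r \<in> E" and e: "F p = F r"
    obtain y a q y' a' q' where p': "p = ((y, a, q), (y', a', q'))" by (metis prod.collapse)
    obtain x b t x' b' t' where r0: "r = ((x, b, t), (x', b', t'))" by (metis prod.collapse)
    have "F r = (x, x', zf r, t, t', b div (t div gcd t t'))" "F p = (y, y', zf p, q, q', a div (q div gcd q q'))"
      by (simp_all add: F_def p' r0)
    then have "(x, x', zf r, t, t', b div (t div gcd t t')) = (y, y', zf p, q, q', a div (q div gcd q q'))"
      using e by (simp only:)
    then have c: "x = y" "x' = y'" "t = q" "t' = q'" and zz: "zf r = zf p"
        and "b div (t div gcd t t') = a div (q div gcd q q')" unfolding prod.inject by blast+
    then have r': "r = ((y, b, q), (y', b', q'))" and dd: "a div (q div gcd q q') = b div (q div gcd q q')"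
      using r0 by simp_all
    note mp = memE[OF p[unfolded p']] and mr = memE[OF r[unfolded r']]
    have R: "cross_cong y y' (zf p) a q a' q'" "cross_cong y y' (zf p) b q b' q'"
      using zgood(1)[OF p p'] zgood(1)[OF r r'] zz by simp_all
    have "q div gcd q q' dvd a - b"
      by (rule cross_cong_numerator_mod[OF _ _ R]) (use mp coY in auto)
    then have "a mod (q div gcd q q') = b mod (q div gcd q q')" by (simp add: mod_eq_dvd_iff)
    then have "a = b" using dd by (metis div_mult_mod_eq)
    then have "H p = H r" using zz by (simp add: H_def p' r')
    then show "p = r" using inj_H p r by (auto dest: inj_onD)
  qed
  \<comment> \<open>There are gcd q q' blocks, and this number divides both coordinates of
    z.\<close>
  have index: "0 \<le> a div (q div gcd q q')" "a div (q div gcd q q') < gcd (fst (zf p)) (snd (zf p))"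
    if p: "p \<in> E" and p': "p = ((y, a, q), (y', a', q'))" and z0: "zf p \<noteq> (0, 0)" for p y a q y' a' q'
  proof -
    note mp = memE[OF p[unfolded p']]
    define g where "g = gcd q q'"
    have g: "g > 0" using mp by (simp add: g_def)
    have gq: "(q div g) * g = q" by (simp add: g_def)
    have qg: "q div g > 0" using mp g gq by (metis mult_zero_left not_less_iff_gr_or_eq pos_imp_zdiv_neg_iff)
    show "0 \<le> a div (q div gcd q q')" using mp qg unfolding g_def by (simp add: pos_imp_zdiv_nonneg_iff)
    have "a div (q div g) < g"
    proof (rule ccontr)
      assume "\<not> a div (q div g) < g"
      then have "(q div g) * g \<le> (q div g) * (a div (q div g))" using qg by (intro mult_left_mono) auto
      also have "\<dots> \<le> a" using qg mult_div_mod_eq[of "q div g" a] pos_mod_sign[OF qg, of a] by linarith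
      finally show False using gq mp by linarith
    qed
    also have "g \<le> gcd (fst (zf p)) (snd (zf p))"
    proof -
      have "g dvd gcd (fst (zf p)) (snd (zf p))"
        using cross_cong_dvd'(2,3)[OF zgood(1)[OF p p']] by (simp add: g_def)
      moreover have "gcd (fst (zf p)) (snd (zf p)) > 0" using z0 by (auto simp: prod_eq_iff)
      ultimately show ?thesis by (rule zdvd_imp_le)
    qed
    finally show "a div (q div gcd q q') < gcd (fst (zf p)) (snd (zf p))" by (simp add: g_def)
  qed
  define Qs where "Qs = {1..\<lfloor>Q\<rfloor>}"
  have Qs: "finite Qs" "real (card Qs) \<le> Q" using Q by (auto simp: Qs_def)
  have qQs: "q \<in> Qs" if "0 < q" "real_of_int q < Q" for q using that by (auto simp: Qs_def le_floor_iff)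
  define G where "G = 9 * Z\<^sup>2 * (1 + ln (1 + Z))"
  have sumG: "(\<Sum>z\<in>punctured_box Z. real_of_int (gcd (fst z) (snd z))) \<le> G"
    unfolding G_def by (rule sum_gcd_box[OF Z])
  have wedge_le: "\<bar>real_of_int (wedge y z)\<bar> \<le> 2 * Y0 * (Y0 + Z)"
    if "y \<in> Y" "\<bar>real_of_int (fst z)\<bar> \<le> Y0 + Z" "\<bar>real_of_int (snd z)\<bar> \<le> Y0 + Z" for y z
  proof -
    have "\<bar>real_of_int (wedge y z)\<bar> \<le> \<bar>real_of_int (fst y) * real_of_int (snd z)\<bar> + \<bar>real_of_int (snd y) * real_of_int (fst z)\<bar>"
      unfolding wedge_def of_int_diff of_int_mult by (rule abs_triangle_ineq4)
    also have "\<dots> \<le> Y0 * (Y0 + Z) + Y0 * (Y0 + Z)"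
      unfolding abs_mult using that bdY Y0 Z by (intro add_mono mult_mono) auto
    finally show ?thesis by simp
  qed
  have dYZ: "real (card (pos_divisors (wedge y z))) \<le> d" if "y \<in> Y" "z \<in> punctured_box Z" for y z
  proof (cases "wedge y z = 0")
    case False
    have "\<bar>real_of_int (fst z)\<bar> \<le> Y0 + Z" "\<bar>real_of_int (snd z)\<bar> \<le> Y0 + Z"
      using that Y0 by (auto simp: punctured_box_def)
    then show ?thesis using div[OF False] wedge_le[OF that(1)] unfolding Z_def by blast
  qed (simp add: pos_divisors_def d)
  have dYY: "real (card (pos_divisors (wedge y y'))) \<le> d" if "y \<in> Y" "y' \<in> Y" for y y'
  proof (cases "wedge y y' = 0")
    case False
    have "\<bar>real_of_int (fst y')\<bar> \<le> Y0 + Z" "\<bar>real_of_int (snd y')\<bar> \<le> Y0 + Z"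
      using bdY[OF that(2)] Z by auto
    then show ?thesis using div[OF False] wedge_le[OF that(1)] unfolding Z_def by blast
  qed (simp add: pos_divisors_def d)
  \<comment> \<open>\<open>E1\<close> collects all degenerate pairs: if z = 0 with y and y'
    parallel, or if both wedge products with a nonzero z vanish, then primitivity forces y' = y or
    y' = -y. \<open>E2\<close> is the rest of z = 0, \<open>E3\<close> is generic, and in
    \<open>E4\<close> and \<open>E5\<close> exactly one wedge product vanishes.\<close>
  define E1 where "E1 = {p \<in> E. case p of ((y, a, q), (y', a', q')) \<Rightarrow> (y' = y \<or> y' = (- fst y, - snd y)) \<and> wedge y (zf p) = 0}"
  define E2 where "E2 = {p \<in> E. case p of ((y, a, q), (y', a', q')) \<Rightarrow> wedge y y' \<noteq> 0 \<and> zf p = (0, 0)}"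
  define E3 where "E3 = {p \<in> E. case p of ((y, a, q), (y', a', q')) \<Rightarrow> zf p \<noteq> (0, 0) \<and> wedge y (zf p) \<noteq> 0 \<and> wedge y' (zf p) \<noteq> 0}"
  define E4 where "E4 = {p \<in> E. case p of ((y, a, q), (y', a', q')) \<Rightarrow> zf p \<noteq> (0, 0) \<and> wedge y (zf p) = 0 \<and> wedge y' (zf p) \<noteq> 0}"
  define E5 where "E5 = {p \<in> E. case p of ((y, a, q), (y', a', q')) \<Rightarrow> zf p \<noteq> (0, 0) \<and> wedge y (zf p) \<noteq> 0 \<and> wedge y' (zf p) = 0}"
  have cover: "E \<subseteq> E1 \<union> E2 \<union> E3 \<union> E4 \<union> E5"
  proof
    fix p assume p: "p \<in> E"
    obtain y a q y' a' q' where p': "p = ((y, a, q), (y', a', q'))" by (metis prod.collapse)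
    note mp = memE[OF p[unfolded p']]
    have co: "coprime (fst y) (snd y)" "coprime (fst y') (snd y')" using mp coY by auto
    show "p \<in> E1 \<union> E2 \<union> E3 \<union> E4 \<union> E5"
    proof (cases "zf p = (0, 0)")
      case True
      have "y' = y \<or> y' = (- fst y, - snd y)" if "wedge y y' = 0"
      proof (rule primitive_parallel[OF co])
        show "y' \<noteq> (0, 0)" using co(2) by auto
        show "wedge y y' = 0" by (rule that)
        show "wedge y' y' = 0" by (simp add: wedge_def)
      qed
      moreover have "wedge y (zf p) = 0" using True by (simp add: wedge_def)
      ultimately show ?thesis using p True by (auto simp: E1_def E2_def p')
    next
      case False
      have "y' = y \<or> y' = (- fst y, - snd y)" if "wedge y (zf p) = 0" "wedge y' (zf p) = 0"
        by (rule primitive_parallel[OF co False that])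
      then show ?thesis using p False unfolding E1_def E3_def E4_def E5_def p' by auto
    qed
  qed
  have c1: "real (card E1) \<le> 2 * card Y * (2 * m0 + 1) * Q\<^sup>2"
  proof -
    define T where "T = (SIGMA y:Y. SIGMA s:{1, -1::int}. SIGMA m:{-\<lfloor>m0\<rfloor>..\<lfloor>m0\<rfloor>}. SIGMA q:Qs. {0..<q})"
    define f where "f = (\<lambda>(y :: int \<times> int, s, m, q :: int, a :: int). (y, (s * fst y, s * snd y), (m * fst y, m * snd y), q, a))"
    have finT: "finite T" unfolding T_def using finY Qs by (intro finite_SigmaI) auto
    have "H ` E1 \<subseteq> f ` T"
    proof (rule image_subsetI)
      fix p assume pE: "p \<in> E1"
      then have p: "p \<in> E" by (simp add: E1_def)
      obtain y a q y' a' q' where p': "p = ((y, a, q), (y', a', q'))" by (metis prod.collapse)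
      note mp = memE[OF p[unfolded p']]
      have yy: "y' = y \<or> y' = (- fst y, - snd y)" and w: "wedge y (zf p) = 0" using pE by (auto simp: E1_def p')
      obtain s :: int where s: "s \<in> {1, -1}" "y' = (s * fst y, s * snd y)"
        using yy that[of 1] that[of "-1"] by auto
      have coy: "coprime (fst y) (snd y)" using mp coY by simp
      obtain m where m: "zf p = (m * fst y, m * snd y)" by (rule wedge_eq_0[OF coy w])
      \<comment> \<open>For y' = y or y' = -y the difference of the coordinates is at most twice
        |u|, and z = m y. Dividing by |u| \<ge> 1 removes the dependence on \<open>Y0\<close>, hence
        \<open>m0\<close> in place of \<open>Z\<close>.\<close>
      have bound: "\<bar>real_of_int m\<bar> \<le> m0"
        if u: "u \<noteq> 0" and le: "\<bar>real_of_int (m * u)\<bar> \<le> Q\<^sup>2 * (1 / K + \<bar>\<beta>\<bar> * \<bar>real_of_int (u - s * u)\<bar>)" for u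
      proof -
        have u1: "1 \<le> \<bar>real_of_int u\<bar>" using u by linarith
        have "\<bar>real_of_int (u - s * u)\<bar> \<le> 2 * \<bar>real_of_int u\<bar>" using s(1) by auto
        then have "\<bar>\<beta>\<bar> * \<bar>real_of_int (u - s * u)\<bar> \<le> \<bar>\<beta>\<bar> * (2 * \<bar>real_of_int u\<bar>)" by (intro mult_left_mono) auto
        moreover have "1 / K \<le> 1 / K * \<bar>real_of_int u\<bar>" using u1 K by (simp add: field_simps)
        ultimately have "1 / K + \<bar>\<beta>\<bar> * \<bar>real_of_int (u - s * u)\<bar> \<le> (1 / K + 2 * \<bar>\<beta>\<bar>) * \<bar>real_of_int u\<bar>"
          by (simp add: distrib_right)
        then have "Q\<^sup>2 * (1 / K + \<bar>\<beta>\<bar> * \<bar>real_of_int (u - s * u)\<bar>) \<le> Q\<^sup>2 * ((1 / K + 2 * \<bar>\<beta>\<bar>) * \<bar>real_of_int u\<bar>)"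
          by (intro mult_left_mono) auto
        then have "\<bar>real_of_int m\<bar> * \<bar>real_of_int u\<bar> \<le> m0 * \<bar>real_of_int u\<bar>"
          using le by (simp add: m0_def abs_mult mult.assoc)
        then show ?thesis by (rule mult_right_le_imp_le) (use u1 in linarith)
      qed
      have "fst y \<noteq> 0 \<or> snd y \<noteq> 0" using coy by auto
      then have "\<bar>real_of_int m\<bar> \<le> m0"
        using bound[of "fst y"] bound[of "snd y"] zgood(2,3)[OF p p'] unfolding m s(2) by auto
      then have "m \<in> {-\<lfloor>m0\<rfloor>..\<lfloor>m0\<rfloor>}" by (auto simp: abs_le_iff le_floor_iff minus_le_iff)
      then have "(y, s, m, q, a) \<in> T" using mp s(1) qQs by (auto simp: T_def)
      moreover have "H p = (y, y', zf p, q, a)" by (simp add: H_def p')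
      then have "H p = f (y, s, m, q, a)" unfolding f_def split_conv m s(2) .
      ultimately show "H p \<in> f ` T" by blast
    qed
    then have "card (H ` E1) \<le> card T" using finT by (rule surj_card_le[rotated])
    moreover have "card (H ` E1) = card E1"
      by (rule card_image) (rule inj_on_subset[OF inj_H], auto simp: E1_def)
    moreover have "real (card T) \<le> card Y * (2 * ((2 * m0 + 1) * (Q * Q)))"
      unfolding T_def
    proof (rule card_Sigma_const_bound)
      fix y assume "y \<in> Y"
      have "real (card (SIGMA s:{1, -1::int}. SIGMA m:{-\<lfloor>m0\<rfloor>..\<lfloor>m0\<rfloor>}. SIGMA q:Qs. {0..<q}))
         \<le> real (card {1, -1::int}) * ((2 * m0 + 1) * (Q * Q))"
      proof (rule card_Sigma_const_bound)
        fix s :: int assume "s \<in> {1, -1}"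
        have "real (card (SIGMA m:{-\<lfloor>m0\<rfloor>..\<lfloor>m0\<rfloor>}. SIGMA q:Qs. {0..<q})) \<le> real (card {-\<lfloor>m0\<rfloor>..\<lfloor>m0\<rfloor>}) * (Q * Q)"
        proof (rule card_Sigma_const_bound)
          fix m assume "m \<in> {-\<lfloor>m0\<rfloor>..\<lfloor>m0\<rfloor>}"
          have "real (card (SIGMA q:Qs. {0..<q})) \<le> real (card Qs) * Q"
            by (rule card_Sigma_const_bound) (use Qs in \<open>auto simp: Qs_def le_floor_iff\<close>)
          also have "\<dots> \<le> Q * Q" using Qs Q by (intro mult_right_mono) auto
          finally show "real (card (SIGMA q:Qs. {0..<q})) \<le> Q * Q" .
        qed (use Qs in auto)
        also have "\<dots> \<le> (2 * m0 + 1) * (Q * Q)"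
        proof (intro mult_right_mono)
          have "0 \<le> \<lfloor>m0\<rfloor>" using m0 by simp
          then have "real (card {-\<lfloor>m0\<rfloor>..\<lfloor>m0\<rfloor>}) = 2 * real_of_int \<lfloor>m0\<rfloor> + 1" by simp
          also have "\<dots> \<le> 2 * m0 + 1" by simp
          finally show "real (card {-\<lfloor>m0\<rfloor>..\<lfloor>m0\<rfloor>}) \<le> 2 * m0 + 1" .
        qed (use Q in auto)
        finally show "real (card (SIGMA m:{-\<lfloor>m0\<rfloor>..\<lfloor>m0\<rfloor>}. SIGMA q:Qs. {0..<q})) \<le> (2 * m0 + 1) * (Q * Q)" .
      qed (use Qs in auto)
      then show "real (card (SIGMA s:{1, -1::int}. SIGMA m:{-\<lfloor>m0\<rfloor>..\<lfloor>m0\<rfloor>}. SIGMA q:Qs. {0..<q})) \<le> 2 * ((2 * m0 + 1) * (Q * Q))"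
        by simp
    qed (use finY Qs in auto)
    ultimately show ?thesis by (simp add: power2_eq_square mult_ac)
  qed
  have c2: "real (card E2) \<le> (card Y)\<^sup>2 * d * Q"
  proof -
    define T where "T = (SIGMA y:Y. SIGMA y':Y. SIGMA q:pos_divisors (wedge y y') \<inter> Qs. {0..<q})"
    define f where "f = (\<lambda>(y :: int \<times> int, y' :: int \<times> int, q :: int, a :: int). (y, y', (0 :: int, 0 :: int), q, a))"
    have finT: "finite T" unfolding T_def using finY by (intro finite_SigmaI) auto
    have "H ` E2 \<subseteq> f ` T"
    proof (rule image_subsetI)
      fix p assume pE: "p \<in> E2"
      then have p: "p \<in> E" by (simp add: E2_def)
      obtain y a q y' a' q' where p': "p = ((y, a, q), (y', a', q'))" by (metis prod.collapse)
      note mp = memE[OF p[unfolded p']]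
      have w: "wedge y y' \<noteq> 0" and z: "zf p = (0, 0)" using pE by (auto simp: E2_def p')
      have "q dvd wedge y y'"
        by (rule cross_cong_zero(2)[where a = a and a' = a' and q' = q']) (use mp coY zgood(1)[OF p p'] z in auto)
      then have "(y, y', q, a) \<in> T" using mp w qQs by (auto simp: T_def pos_divisors_def)
      moreover have "H p = (y, y', zf p, q, a)" by (simp add: H_def p')
      then have "H p = f (y, y', q, a)" unfolding f_def split_conv z .
      ultimately show "H p \<in> f ` T" by blast
    qed
    then have "card (H ` E2) \<le> card T" using finT by (rule surj_card_le[rotated])
    moreover have "card (H ` E2) = card E2"
      by (rule card_image) (rule inj_on_subset[OF inj_H], auto simp: E2_def)
    moreover have "real (card T) \<le> card Y * (card Y * (d * Q))"
      unfolding T_def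
    proof (intro card_Sigma_const_bound)
      fix y y' assume y: "y \<in> Y" "y' \<in> Y"
      have "real (card (SIGMA q:pos_divisors (wedge y y') \<inter> Qs. {0..<q})) \<le> real (card (pos_divisors (wedge y y') \<inter> Qs)) * Q"
        by (rule card_Sigma_const_bound) (auto simp: Qs_def le_floor_iff)
      also have "\<dots> \<le> d * Q"
      proof (rule mult_right_mono)
        have "card (pos_divisors (wedge y y') \<inter> Qs) \<le> card (pos_divisors (wedge y y'))" by (rule card_mono) auto
        then show "real (card (pos_divisors (wedge y y') \<inter> Qs)) \<le> d" using dYY[OF y] by linarith
      qed (use Q in simp)
      finally show "real (card (SIGMA q:pos_divisors (wedge y y') \<inter> Qs. {0..<q})) \<le> d * Q" .
    qed (use finY in auto)
    ultimately show ?thesis by (simp add: power2_eq_square mult_ac)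
  qed
  have c3: "real (card E3) \<le> (card Y)\<^sup>2 * d\<^sup>2 * G"
  proof -
    define T where "T = (SIGMA y:Y. SIGMA y':Y. SIGMA z:punctured_box Z. SIGMA q:pos_divisors (wedge y z).
       SIGMA q':pos_divisors (wedge y' z). {0..<gcd (fst z) (snd z)})"
    have finT: "finite T" unfolding T_def using finY by (intro finite_SigmaI) auto
    have "F ` E3 \<subseteq> T"
    proof (rule image_subsetI)
      fix p assume pE: "p \<in> E3"
      then have p: "p \<in> E" by (simp add: E3_def)
      obtain y a q y' a' q' where p': "p = ((y, a, q), (y', a', q'))" by (metis prod.collapse)
      note mp = memE[OF p[unfolded p']]
      have w: "zf p \<noteq> (0, 0)" "wedge y (zf p) \<noteq> 0" "wedge y' (zf p) \<noteq> 0" using pE by (auto simp: E3_def p')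
      have "zf p \<in> punctured_box Z" using zZ[OF p] w by (simp add: punctured_box_def)
      moreover have "q \<in> pos_divisors (wedge y (zf p))" "q' \<in> pos_divisors (wedge y' (zf p))"
        using cross_cong_dvd(3)[OF zgood(1)[OF p p']] cross_cong_dvd'(1)[OF zgood(1)[OF p p']] w mp
        by (auto simp: pos_divisors_def)
      ultimately have "(y, y', zf p, q, q', a div (q div gcd q q')) \<in> T"
        using mp index[OF p p' w(1)] unfolding T_def by simp
      moreover have "F p = (y, y', zf p, q, q', a div (q div gcd q q'))" by (simp add: F_def p')
      ultimately show "F p \<in> T" by (simp only:)
    qed
    then have "card (F ` E3) \<le> card T" by (rule card_mono[OF finT])
    moreover have "card (F ` E3) = card E3"
      by (rule card_image) (rule inj_on_subset[OF inj_F], auto simp: E3_def)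
    moreover have "real (card T) \<le> card Y * (card Y * (d * d * G))"
      unfolding T_def
    proof (intro card_Sigma_const_bound)
      fix y y' assume y: "y \<in> Y" "y' \<in> Y"
      have "real (card (SIGMA z:punctured_box Z. SIGMA q:pos_divisors (wedge y z).
         SIGMA q':pos_divisors (wedge y' z). {0..<gcd (fst z) (snd z)}))
         \<le> (\<Sum>z\<in>punctured_box Z. d * (d * real_of_int (gcd (fst z) (snd z))))"
      proof (rule card_Sigma_bound)
        fix z assume z: "z \<in> punctured_box Z"
        have "real (card (SIGMA q:pos_divisors (wedge y z). SIGMA q':pos_divisors (wedge y' z). {0..<gcd (fst z) (snd z)}))
          \<le> real (card (pos_divisors (wedge y z))) * (real (card (pos_divisors (wedge y' z))) * real_of_int (gcd (fst z) (snd z)))"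
          by (intro card_Sigma_const_bound) auto
        also have "\<dots> \<le> d * (d * real_of_int (gcd (fst z) (snd z)))"
          using dYZ[OF y(1) z] dYZ[OF y(2) z] d by (intro mult_mono) auto
        finally show "real (card (SIGMA q:pos_divisors (wedge y z). SIGMA q':pos_divisors (wedge y' z). {0..<gcd (fst z) (snd z)}))
          \<le> d * (d * real_of_int (gcd (fst z) (snd z)))" .
      qed auto
      also have "\<dots> = d * d * (\<Sum>z\<in>punctured_box Z. real_of_int (gcd (fst z) (snd z)))"
        by (simp add: sum_distrib_left mult.assoc)
      also have "\<dots> \<le> d * d * G" using sumG d by (intro mult_left_mono) auto
      finally show "real (card (SIGMA z:punctured_box Z. SIGMA q:pos_divisors (wedge y z).
         SIGMA q':pos_divisors (wedge y' z). {0..<gcd (fst z) (snd z)})) \<le> d * d * G" .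
    qed (use finY in auto)
    ultimately show ?thesis by (simp add: power2_eq_square mult_ac)
  qed
  \<comment> \<open>A primitive vector parallel to z is z divided by its gcd, up to sign. In
    \<open>E4\<close> and \<open>E5\<close> one of the two vectors thus costs only a factor
    2.\<close>
  have direction: "\<exists>s\<in>{1, -1::int}. y = (s * (fst z div gcd (fst z) (snd z)), s * (snd z div gcd (fst z) (snd z)))"
    if y: "y \<in> Y" and z: "z \<noteq> (0, 0)" and w: "wedge y z = 0" for y z
  proof -
    obtain m where m: "z = (m * fst y, m * snd y)" "\<bar>m\<bar> = gcd (fst z) (snd z)" by (rule wedge_eq_0[OF coY[OF y] w])
    have m0: "m \<noteq> 0" using m z by auto
    define s where "s = sgn m"
    have s: "s \<in> {1, -1}" using m0 by (auto simp: s_def sgn_if)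
    have ms: "m = \<bar>m\<bar> * s" by (simp add: s_def abs_sgn sgn_if)
    have ss: "s * s = 1" using s by auto
    have "fst z = \<bar>m\<bar> * (s * fst y)" "snd z = \<bar>m\<bar> * (s * snd y)" using m(1) ms by (metis fst_conv mult.assoc, metis snd_conv mult.assoc)
    then have "fst z div \<bar>m\<bar> = s * fst y" "snd z div \<bar>m\<bar> = s * snd y" using m0 by simp_all
    then have "y = (s * (fst z div \<bar>m\<bar>), s * (snd z div \<bar>m\<bar>))" using ss by (simp add: prod_eq_iff flip: mult.assoc)
    then show ?thesis using s m(2) by auto
  qed
  have card_T45: "real (card (SIGMA y:Y. SIGMA z:punctured_box Z. SIGMA s:{1, -1::int}. SIGMA q:Qs.
       SIGMA q':pos_divisors (wedge y z). {0..<gcd (fst z) (snd z)})) \<le> card Y * (2 * Q * d * G)"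
  proof (intro card_Sigma_const_bound)
    fix y assume y: "y \<in> Y"
    have "real (card (SIGMA z:punctured_box Z. SIGMA s:{1, -1::int}. SIGMA q:Qs.
       SIGMA q':pos_divisors (wedge y z). {0..<gcd (fst z) (snd z)}))
       \<le> (\<Sum>z\<in>punctured_box Z. 2 * (Q * (d * real_of_int (gcd (fst z) (snd z)))))"
    proof (rule card_Sigma_bound)
      fix z assume z: "z \<in> punctured_box Z"
      have "real (card (SIGMA s:{1, -1::int}. SIGMA q:Qs. SIGMA q':pos_divisors (wedge y z). {0..<gcd (fst z) (snd z)}))
         \<le> real (card {1, -1::int}) * (real (card Qs) * (real (card (pos_divisors (wedge y z))) * real_of_int (gcd (fst z) (snd z))))"
        using Qs by (intro card_Sigma_const_bound) auto
      also have "\<dots> \<le> 2 * (Q * (d * real_of_int (gcd (fst z) (snd z))))"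
        using dYZ[OF y z] d Qs Q by (intro mult_mono) auto
      finally show "real (card (SIGMA s:{1, -1::int}. SIGMA q:Qs. SIGMA q':pos_divisors (wedge y z). {0..<gcd (fst z) (snd z)}))
         \<le> 2 * (Q * (d * real_of_int (gcd (fst z) (snd z))))" .
    qed (use Qs in auto)
    also have "\<dots> = 2 * Q * d * (\<Sum>z\<in>punctured_box Z. real_of_int (gcd (fst z) (snd z)))"
      by (simp add: sum_distrib_left mult.assoc)
    also have "\<dots> \<le> 2 * Q * d * G" using sumG d Q by (intro mult_left_mono) auto
    finally show "real (card (SIGMA z:punctured_box Z. SIGMA s:{1, -1::int}. SIGMA q:Qs.
       SIGMA q':pos_divisors (wedge y z). {0..<gcd (fst z) (snd z)})) \<le> 2 * Q * d * G" .
  qed (use finY Qs in auto)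
  define T where "T = (SIGMA y:Y. SIGMA z:punctured_box Z. SIGMA s:{1, -1::int}. SIGMA q:Qs.
       SIGMA q':pos_divisors (wedge y z). {0..<gcd (fst z) (snd z)})"
  have finT: "finite T" unfolding T_def using finY Qs by (intro finite_SigmaI) auto
  have c4: "real (card E4) \<le> card Y * (2 * Q * d * G)"
  proof -
    define f where "f = (\<lambda>(y' :: int \<times> int, z :: int \<times> int, s, q :: int, q' :: int, i :: int).
       ((s * (fst z div gcd (fst z) (snd z)), s * (snd z div gcd (fst z) (snd z))), y', z, q, q', i))"
    have "F ` E4 \<subseteq> f ` T"
    proof (rule image_subsetI)
      fix p assume pE: "p \<in> E4"
      then have p: "p \<in> E" by (simp add: E4_def)
      obtain y a q y' a' q' where p': "p = ((y, a, q), (y', a', q'))" by (metis prod.collapse)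
      note mp = memE[OF p[unfolded p']]
      have w: "zf p \<noteq> (0, 0)" "wedge y (zf p) = 0" "wedge y' (zf p) \<noteq> 0" using pE by (auto simp: E4_def p')
      obtain s where s: "s \<in> {1, -1::int}" "y = (s * (fst (zf p) div gcd (fst (zf p)) (snd (zf p))), s * (snd (zf p) div gcd (fst (zf p)) (snd (zf p))))"
        using direction[OF _ w(1,2)] mp by blast
      have "zf p \<in> punctured_box Z" using zZ[OF p] w by (simp add: punctured_box_def)
      moreover have "q' \<in> pos_divisors (wedge y' (zf p))"
        using cross_cong_dvd'(1)[OF zgood(1)[OF p p']] w mp by (auto simp: pos_divisors_def)
      ultimately have "(y', zf p, s, q, q', a div (q div gcd q q')) \<in> T"
        using mp index[OF p p' w(1)] s(1) qQs unfolding T_def by simp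
      moreover have "F p = f (y', zf p, s, q, q', a div (q div gcd q q'))"
      proof -
        have "F p = (y, y', zf p, q, q', a div (q div gcd q q'))" by (simp add: F_def p')
        also have "\<dots> = f (y', zf p, s, q, q', a div (q div gcd q q'))" unfolding f_def split_conv by (subst s(2)) (rule refl)
        finally show ?thesis .
      qed
      ultimately show "F p \<in> f ` T" by blast
    qed
    then have "card (F ` E4) \<le> card T" using finT by (rule surj_card_le[rotated])
    moreover have "card (F ` E4) = card E4"
      by (rule card_image) (rule inj_on_subset[OF inj_F], auto simp: E4_def)
    ultimately show ?thesis using card_T45 unfolding T_def by linarith
  qed
  have c5: "real (card E5) \<le> card Y * (2 * Q * d * G)"
  proof -
    define f where "f = (\<lambda>(y :: int \<times> int, z :: int \<times> int, s, q' :: int, q :: int, i :: int).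
       (y, (s * (fst z div gcd (fst z) (snd z)), s * (snd z div gcd (fst z) (snd z))), z, q, q', i))"
    have "F ` E5 \<subseteq> f ` T"
    proof (rule image_subsetI)
      fix p assume pE: "p \<in> E5"
      then have p: "p \<in> E" by (simp add: E5_def)
      obtain y a q y' a' q' where p': "p = ((y, a, q), (y', a', q'))" by (metis prod.collapse)
      note mp = memE[OF p[unfolded p']]
      have w: "zf p \<noteq> (0, 0)" "wedge y (zf p) \<noteq> 0" "wedge y' (zf p) = 0" using pE by (auto simp: E5_def p')
      obtain s where s: "s \<in> {1, -1::int}" "y' = (s * (fst (zf p) div gcd (fst (zf p)) (snd (zf p))), s * (snd (zf p) div gcd (fst (zf p)) (snd (zf p))))"
        using direction[OF _ w(1,3)] mp by blast
      have "zf p \<in> punctured_box Z" using zZ[OF p] w by (simp add: punctured_box_def)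
      moreover have "q \<in> pos_divisors (wedge y (zf p))"
        using cross_cong_dvd(3)[OF zgood(1)[OF p p']] w mp by (auto simp: pos_divisors_def)
      ultimately have "(y, zf p, s, q', q, a div (q div gcd q q')) \<in> T"
        using mp index[OF p p' w(1)] s(1) qQs unfolding T_def by simp
      moreover have "F p = f (y, zf p, s, q', q, a div (q div gcd q q'))"
      proof -
        have "F p = (y, y', zf p, q, q', a div (q div gcd q q'))" by (simp add: F_def p')
        also have "\<dots> = f (y, zf p, s, q', q, a div (q div gcd q q'))" unfolding f_def split_conv by (subst s(2)) (rule refl)
        finally show ?thesis .
      qed
      ultimately show "F p \<in> f ` T" by blast
    qed
    then have "card (F ` E5) \<le> card T" using finT by (rule surj_card_le[rotated])
    moreover have "card (F ` E5) = card E5"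
      by (rule card_image) (rule inj_on_subset[OF inj_F], auto simp: E5_def)
    ultimately show ?thesis using card_T45 unfolding T_def by linarith
  qed
  have finE: "finite E"
  proof -
    have "farey_pairs Q \<subseteq> Qs \<times> Qs \<union> {0} \<times> Qs"
      using qQs by (auto simp: farey_pairs_def)
    then have "finite (farey_pairs Q)" using Qs by (rule_tac finite_subset) auto
    then have "finite ((Y \<times> farey_pairs Q) \<times> (Y \<times> farey_pairs Q))" using finY by simp
    moreover have "E \<subseteq> (Y \<times> farey_pairs Q) \<times> (Y \<times> farey_pairs Q)" by (auto simp: E_def near_pairs_def)
    ultimately show ?thesis by (rule finite_subset[rotated])
  qed
  then have fin: "finite (E1 \<union> E2 \<union> E3 \<union> E4 \<union> E5)"
    by (rule rev_finite_subset) (auto simp: E1_def E2_def E3_def E4_def E5_def)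
  have "card E \<le> card (E1 \<union> E2 \<union> E3 \<union> E4 \<union> E5)" by (rule card_mono[OF fin cover])
  also have "\<dots> \<le> card E1 + card E2 + card E3 + card E4 + card E5"
    by (meson add_mono card_Un_le order_refl order_trans)
  finally have "real (card E) \<le> real (card E1) + real (card E2) + real (card E3) + real (card E4) + real (card E5)"
    by linarith
  also have "\<dots> \<le> 2 * card Y * (2 * m0 + 1) * Q\<^sup>2 + (card Y)\<^sup>2 * d * Q + (card Y)\<^sup>2 * d\<^sup>2 * G
     + card Y * (2 * Q * d * G) + card Y * (2 * Q * d * G)"
    using c1 c2 c3 c4 c5 by (intro add_mono)
  also have "\<dots> = 2 * card Y * (2 * m0 + 1) * Q\<^sup>2 + (card Y)\<^sup>2 * d * Q + ((card Y)\<^sup>2 * d\<^sup>2 + 4 * card Y * Q * d) * G"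
    by (simp add: algebra_simps)
  finally show ?thesis by (simp add: E_def G_def)
qed

section \<open>The exponential sum\<close>

lemma row_vec_nth:
  fixes v :: "int^2" and A :: "int^2^2"
  shows "(v v* A) $ j = v$1 * A$1$j + v$2 * A$2$j"
  by (simp add: vector_matrix_mult_def sum_2 mult.commute)

lemma col_vec_nth:
  fixes w :: "int^2" and A :: "int^2^2"
  shows "(A *v w) $ i = A$i$1 * w$1 + A$i$2 * w$2"
  by (simp add: matrix_vector_mult_def sum_2)

lemma pairing_mult:
  fixes A B :: "int^2^2" and v w :: "int^2"
  shows "pairing (v v* (A ** B)) w = (v v* A)$1 * (B *v w)$1 + (v v* A)$2 * (B *v w)$2"
  by (simp add: pairing_def sum_2 row_vec_nth col_vec_nth mult_nth algebra_simps)

lemma abs_row_vec_le: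
  fixes v :: "int^2"
  shows "\<bar>real_of_int ((v v* A) $ j)\<bar> \<le> (\<bar>real_of_int (v$1)\<bar> + \<bar>real_of_int (v$2)\<bar>) * frobenius_norm A"
proof -
  have "\<bar>real_of_int ((v v* A) $ j)\<bar> \<le> \<bar>real_of_int (v$1)\<bar> * \<bar>real_of_int (A$1$j)\<bar> + \<bar>real_of_int (v$2)\<bar> * \<bar>real_of_int (A$2$j)\<bar>"
    unfolding row_vec_nth of_int_add of_int_mult abs_mult[symmetric] by (rule abs_triangle_ineq)
  also have "\<dots> \<le> \<bar>real_of_int (v$1)\<bar> * frobenius_norm A + \<bar>real_of_int (v$2)\<bar> * frobenius_norm A"
    by (intro add_mono mult_left_mono abs_entry_le) auto
  finally show ?thesis by (simp add: distrib_right)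
qed

lemma abs_col_vec_le:
  fixes w :: "int^2"
  shows "\<bar>real_of_int ((A *v w) $ i)\<bar> \<le> (\<bar>real_of_int (w$1)\<bar> + \<bar>real_of_int (w$2)\<bar>) * frobenius_norm A"
proof -
  have "\<bar>real_of_int ((A *v w) $ i)\<bar> \<le> \<bar>real_of_int (A$i$1)\<bar> * \<bar>real_of_int (w$1)\<bar> + \<bar>real_of_int (A$i$2)\<bar> * \<bar>real_of_int (w$2)\<bar>"
    unfolding col_vec_nth of_int_add of_int_mult abs_mult[symmetric] by (rule abs_triangle_ineq)
  also have "\<dots> \<le> frobenius_norm A * \<bar>real_of_int (w$1)\<bar> + frobenius_norm A * \<bar>real_of_int (w$2)\<bar>"
    by (intro add_mono mult_right_mono abs_entry_le) auto
  finally show ?thesis by (simp add: algebra_simps)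
qed

lemma primitive_nonzero: "primitive v \<Longrightarrow> v$1 \<noteq> 0 \<or> v$2 \<noteq> 0"
  by (auto simp: primitive_def)

lemma primitive_col_vec:
  assumes A: "det A = 1" and w: "primitive w"
  shows "coprime ((A *v w)$1) ((A *v w)$2)"
proof (rule coprimeI)
  fix c assume c: "c dvd (A *v w)$1" "c dvd (A *v w)$2"
  have d: "A$1$1 * A$2$2 - A$1$2 * A$2$1 = 1" using A by (simp add: det_2)
  have "w$1 = (A$1$1 * A$2$2 - A$1$2 * A$2$1) * w$1" "w$2 = (A$1$1 * A$2$2 - A$1$2 * A$2$1) * w$2"
    unfolding d by simp_all
  then have "w$1 = A$2$2 * (A *v w)$1 - A$1$2 * (A *v w)$2" "w$2 = A$1$1 * (A *v w)$2 - A$2$1 * (A *v w)$1"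
    unfolding col_vec_nth by (simp_all add: algebra_simps)
  then have "c dvd w$1" "c dvd w$2" using c by (metis dvd_diff dvd_mult)+
  then show "is_unit c" using w unfolding primitive_def by (metis coprime_common_divisor)
qed

text \<open>The hypothesis says det(g - 1) = 0, and this determinant is 2 - trace g. It applies to
  every element that fixes a nonzero vector, and so yields the injectivity of g -> v g and g -> g
  w.\<close>

lemma (in nonparabolic_group) singular_imp_one:
  assumes g: "g \<in> G" and sing: "(g$1$1 - 1) * (g$2$2 - 1) - g$1$2 * g$2$1 = 0"
  shows "g = mat 1"
proof -
  have "trace g = 2"
    using sing det_G[OF g] by (simp add: trace_def sum_2 det_2 algebra_simps)
  moreover from this have "g \<noteq> - mat 1" by (auto simp: trace_def sum_2)
  ultimately show ?thesis using not_parabolic[OF g] by (auto simp: parabolic_def)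
qed

lemma kernel_imp_singular:
  fixes a b c d x y :: int
  assumes "a * x + b * y = 0" "c * x + d * y = 0" "x \<noteq> 0 \<or> y \<noteq> 0"
  shows "a * d - b * c = 0"
proof -
  have "x * (a * d - b * c) = d * (a * x + b * y) - b * (c * x + d * y)"
    "y * (a * d - b * c) = a * (c * x + d * y) - c * (a * x + b * y)"
    by (simp_all add: algebra_simps)
  then show ?thesis using assms by auto
qed

context nonparabolic_group begin

lemma inj_on_row_vec:
  assumes v: "primitive v"
  shows "inj_on (\<lambda>g. ((v v* g)$1, (v v* g)$2)) G"
proof (rule inj_onI)
  fix g h assume g: "g \<in> G" and h: "h \<in> G" and e: "((v v* g)$1, (v v* g)$2) = ((v v* h)$1, (v v* h)$2)"
  define k where "k = g ** adj h"
  have k: "k \<in> G" using mult_G[OF g adj_G[OF h]] by (simp add: k_def)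
  have gk: "g = k ** h" by (simp add: k_def adj_mult_cancel(4)[OF det_G[OF h]])
  have vg: "v v* g = v v* h" using e by (simp add: vec_eq_iff forall_2)
  have "(v v* k) v* h = (v v* mat 1) v* h" using vg unfolding gk by (simp add: vector_matrix_mul_assoc)
  then have "((v v* k) v* h) v* adj h = ((v v* mat 1) v* h) v* adj h" by simp
  then have "v v* k = v"
    by (simp add: vector_matrix_mul_assoc adj_mult_cancel(3)[OF det_G[OF h]] adj_mult[OF det_G[OF h]])
  then have "(v v* k)$1 = v$1" "(v v* k)$2 = v$2" by simp_all
  then have "(k$1$1 - 1) * v$1 + k$2$1 * v$2 = 0" "k$1$2 * v$1 + (k$2$2 - 1) * v$2 = 0"
    unfolding row_vec_nth by (simp_all add: algebra_simps)
  from kernel_imp_singular[OF this primitive_nonzero[OF v]]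
  have "(k$1$1 - 1) * (k$2$2 - 1) - k$1$2 * k$2$1 = 0" by (simp add: mult.commute)
  then have "k = mat 1" by (rule singular_imp_one[OF k])
  then show "g = h" using gk by simp
qed

lemma inj_on_col_vec:
  assumes w: "primitive w"
  shows "inj_on (\<lambda>g. ((g *v w)$1, (g *v w)$2)) G"
proof (rule inj_onI)
  fix g h assume g: "g \<in> G" and h: "h \<in> G" and e: "((g *v w)$1, (g *v w)$2) = ((h *v w)$1, (h *v w)$2)"
  define k where "k = adj h ** g"
  have k: "k \<in> G" using mult_G[OF adj_G[OF h] g] by (simp add: k_def)
  have gk: "g = h ** k" by (simp add: k_def adj_mult_cancel(2)[OF det_G[OF h]])
  have "g *v w = h *v w" using e by (simp add: vec_eq_iff forall_2)
  then have "k *v w = adj h *v (h *v w)" unfolding k_def by (simp flip: matrix_vector_mul_assoc)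
  then have "k *v w = w" by (simp add: matrix_vector_mul_assoc adj_mult[OF det_G[OF h]])
  then have "(k *v w)$1 = w$1" "(k *v w)$2 = w$2" by simp_all
  then have "(k$1$1 - 1) * w$1 + k$1$2 * w$2 = 0" "k$2$1 * w$1 + (k$2$2 - 1) * w$2 = 0"
    unfolding col_vec_nth by (simp_all add: algebra_simps)
  from kernel_imp_singular[OF this primitive_nonzero[OF w]]
  have "k = mat 1" by (rule singular_imp_one[OF k])
  then show "g = h" using gk by simp
qed

end

lemma finite_farey_pairs [simp]: "finite (farey_pairs Q)"
proof (rule finite_subset)
  show "farey_pairs Q \<subseteq> {0..\<lfloor>Q\<rfloor>} \<times> {0..\<lfloor>Q\<rfloor>}"
    by (auto simp: farey_pairs_def le_floor_iff)
qed simp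

lemma points_subset_farey:
  assumes "Q > 0"
  shows "points Q \<beta> \<subseteq> (\<lambda>(a, q). real_of_int a / real_of_int q + \<beta>) ` farey_pairs Q"
proof
  fix \<theta> assume "\<theta> \<in> points Q \<beta>"
  then obtain a q :: nat where aq: "\<theta> = real a / real q + \<beta>" "Q / 2 \<le> real q" "real q < Q" "a < q" "coprime a q"
    by (auto simp: points_def)
  then have "(int a, int q) \<in> farey_pairs Q" by (simp add: farey_pairs_def)
  then show "\<theta> \<in> (\<lambda>(a, q). real_of_int a / real_of_int q + \<beta>) ` farey_pairs Q"
    using aq(1) by (intro image_eqI[of _ _ "(int a, int q)"]) auto
qed

text \<open>Cauchy--Schwarz over the products \<open>g = \<gamma> \<xi>\<close>: since \<open>g \<mapsto> v\<^sub>0 g\<close> is injective on a group without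
  parabolic elements, the sum over \<open>g\<close> may be extended to all short integer vectors.\<close>

lemma (in nonparabolic_group) exp_sum_sq_bound:
  fixes M :: nat
  assumes v: "primitive v" and w: "primitive w" and Q: "Q > 0" and M: "M \<ge> 1"
    and \<Xi>: "\<Xi> \<subseteq> G" "\<And>\<xi>. \<xi> \<in> \<Xi> \<Longrightarrow> frobenius_norm \<xi> < B" and \<Omega>: "\<Omega> \<subseteq> G" "finite \<Omega>"
    and MB: "(\<bar>real_of_int (v$1)\<bar> + \<bar>real_of_int (v$2)\<bar>) * (N powr \<sigma> * B) \<le> real M"
  shows "\<exists>S. finite S \<and> S \<subseteq> G \<and> (\<Sum>\<theta>\<in>points Q \<beta>. cmod (exp_sum G v w \<sigma> \<Xi> \<Omega> N \<theta>))\<^sup>2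
     \<le> (\<Sum>g\<in>S. (real (rep_count (N powr \<sigma>) B g))\<^sup>2) *
       (1024 * (real M)\<^sup>2 * real (card (near_pairs ((\<lambda>\<omega>. ((\<omega> *v w)$1, (\<omega> *v w)$2)) ` \<Omega>) Q \<beta> M)))"
proof -
  define A where "A = N powr \<sigma>"
  have A: "0 \<le> A" by (simp add: A_def)
  define D where "D = {\<gamma>. \<gamma> \<in> G \<and> frobenius_norm \<gamma> < A}"
  have D: "finite D" unfolding D_def by (rule finite_ball)
  have fin\<Xi>: "finite \<Xi>" by (rule finite_subset[OF _ finite_frobenius_norm_less[of B]]) (use \<Xi> in auto)
  define F where "F = farey_pairs Q"
  have F: "finite F" by (simp add: F_def)
  define pt where "pt p = real_of_int (fst p) / real_of_int (snd p) + \<beta>" for p :: "int \<times> int"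
  define col where "col \<omega> = ((\<omega> *v w)$1, (\<omega> *v w)$2)" for \<omega> :: "int^2^2"
  define row where "row g = ((v v* g)$1, (v v* g)$2)" for g :: "int^2^2"
  define Y where "Y = col ` \<Omega>"
  have inj_col: "inj_on col \<Omega>"
    using inj_on_subset[OF inj_on_col_vec[OF w] \<Omega>(1)] by (simp add: col_def[abs_def])
  have inj_row: "inj_on row G" using inj_on_row_vec[OF v] by (simp add: row_def[abs_def])
  have Y: "finite Y" using \<Omega> by (simp add: Y_def)
  define W where "W = Y \<times> F"
  have W: "finite W" using Y F by (simp add: W_def)
  define es where "es = exp_sum G v w \<sigma> \<Xi> \<Omega> N"
  \<comment> \<open>The weight depends on the point p only. It turns the sum of absolute values into
    one trigonometric sum over the pairs (y, p), with coefficients of modulus at most 1.\<close>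
  define \<zeta> where "\<zeta> p = cnj (sgn (es (pt p)))" for p
  have \<zeta>: "cmod (\<zeta> p) \<le> 1" for p by (simp add: \<zeta>_def norm_sgn)
  define \<phi> where "\<phi> k = real_of_int (fst (fst k)) * pt (snd k)" for k :: "(int \<times> int) \<times> (int \<times> int)"
  define \<psi> where "\<psi> k = real_of_int (snd (fst k)) * pt (snd k)" for k :: "(int \<times> int) \<times> (int \<times> int)"
  define H where "H x = (\<Sum>k\<in>W. \<zeta> (snd k) * unit_exp (of_int (fst x) * \<phi> k + of_int (snd x) * \<psi> k))" for x :: "int \<times> int"
  have es: "es (pt p) = (\<Sum>(\<gamma>, \<xi>)\<in>D \<times> \<Xi>. \<Sum>y\<in>Y. unit_exp (of_int (fst (row (\<gamma> ** \<xi>))) * \<phi> (y, p) + of_int (snd (row (\<gamma> ** \<xi>))) * \<psi> (y, p)))" for p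
  proof -
    have "es (pt p) = (\<Sum>\<xi>\<in>\<Xi>. \<Sum>\<omega>\<in>\<Omega>. \<Sum>\<gamma>\<in>D. unit_exp (of_int (fst (row (\<gamma> ** \<xi>))) * \<phi> (col \<omega>, p) + of_int (snd (row (\<gamma> ** \<xi>))) * \<psi> (col \<omega>, p)))"
      unfolding es_def exp_sum_def D_def A_def pairing_mult
      by (simp add: row_def col_def \<phi>_def \<psi>_def algebra_simps)
    also have "\<dots> = (\<Sum>\<xi>\<in>\<Xi>. \<Sum>\<gamma>\<in>D. \<Sum>\<omega>\<in>\<Omega>. unit_exp (of_int (fst (row (\<gamma> ** \<xi>))) * \<phi> (col \<omega>, p) + of_int (snd (row (\<gamma> ** \<xi>))) * \<psi> (col \<omega>, p)))"
      by (intro sum.cong refl sum.swap)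
    also have "\<dots> = (\<Sum>\<gamma>\<in>D. \<Sum>\<xi>\<in>\<Xi>. \<Sum>\<omega>\<in>\<Omega>. unit_exp (of_int (fst (row (\<gamma> ** \<xi>))) * \<phi> (col \<omega>, p) + of_int (snd (row (\<gamma> ** \<xi>))) * \<psi> (col \<omega>, p)))"
      by (rule sum.swap)
    also have "\<dots> = (\<Sum>(\<gamma>, \<xi>)\<in>D \<times> \<Xi>. \<Sum>\<omega>\<in>\<Omega>. unit_exp (of_int (fst (row (\<gamma> ** \<xi>))) * \<phi> (col \<omega>, p) + of_int (snd (row (\<gamma> ** \<xi>))) * \<psi> (col \<omega>, p)))"
      by (rule sum.cartesian_product)
    also have "\<dots> = (\<Sum>(\<gamma>, \<xi>)\<in>D \<times> \<Xi>. \<Sum>y\<in>Y. unit_exp (of_int (fst (row (\<gamma> ** \<xi>))) * \<phi> (y, p) + of_int (snd (row (\<gamma> ** \<xi>))) * \<psi> (y, p)))"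
      unfolding Y_def by (simp add: sum.reindex[OF inj_col] o_def)
    finally show ?thesis .
  qed
  have norm_es: "complex_of_real (cmod (es (pt p))) = \<zeta> p * es (pt p)" for p
    by (simp add: \<zeta>_def sgn_div_norm scaleR_conv_of_real complex_norm_square[symmetric] power2_eq_square mult.commute[of "cnj _"] divide_simps flip: of_real_mult)
  have total: "complex_of_real (\<Sum>p\<in>F. cmod (es (pt p))) = (\<Sum>(\<gamma>, \<xi>)\<in>D \<times> \<Xi>. H (row (\<gamma> ** \<xi>)))"
  proof -
    have "complex_of_real (\<Sum>p\<in>F. cmod (es (pt p))) = (\<Sum>p\<in>F. \<zeta> p * es (pt p))"
      unfolding of_real_sum norm_es ..
    also have "\<dots> = (\<Sum>p\<in>F. \<Sum>(\<gamma>, \<xi>)\<in>D \<times> \<Xi>. \<Sum>y\<in>Y. \<zeta> p * unit_exp (of_int (fst (row (\<gamma> ** \<xi>))) * \<phi> (y, p) + of_int (snd (row (\<gamma> ** \<xi>))) * \<psi> (y, p)))"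
      unfolding es sum_distrib_left by (simp add: sum_distrib_left case_prod_unfold)
    also have "\<dots> = (\<Sum>(\<gamma>, \<xi>)\<in>D \<times> \<Xi>. \<Sum>p\<in>F. \<Sum>y\<in>Y. \<zeta> p * unit_exp (of_int (fst (row (\<gamma> ** \<xi>))) * \<phi> (y, p) + of_int (snd (row (\<gamma> ** \<xi>))) * \<psi> (y, p)))"
      unfolding case_prod_unfold by (rule sum.swap)
    also have "\<dots> = (\<Sum>(\<gamma>, \<xi>)\<in>D \<times> \<Xi>. H (row (\<gamma> ** \<xi>)))"
    proof (intro sum.cong refl, unfold case_prod_unfold)
      fix gx assume "gx \<in> D \<times> \<Xi>"
      define x where "x = row (fst gx ** snd gx)"
      have "(\<Sum>p\<in>F. \<Sum>y\<in>Y. \<zeta> p * unit_exp (of_int (fst x) * \<phi> (y, p) + of_int (snd x) * \<psi> (y, p)))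
         = (\<Sum>y\<in>Y. \<Sum>p\<in>F. \<zeta> p * unit_exp (of_int (fst x) * \<phi> (y, p) + of_int (snd x) * \<psi> (y, p)))"
        by (rule sum.swap)
      also have "\<dots> = H x" unfolding H_def W_def sum.cartesian_product by (simp add: case_prod_unfold)
      finally show "(\<Sum>p\<in>F. \<Sum>y\<in>Y. \<zeta> p * unit_exp (of_int (fst (row (fst gx ** snd gx))) * \<phi> (y, p) + of_int (snd (row (fst gx ** snd gx))) * \<psi> (y, p)))
         = H (row (fst gx ** snd gx))" by (simp only: x_def)
    qed
    finally show ?thesis .
  qed
  define S where "S = (\<lambda>(\<gamma>, \<xi>). \<gamma> ** \<xi>) ` (D \<times> \<Xi>)"
  have S: "finite S" "S \<subseteq> G"
    using D fin\<Xi> mult_G \<Xi>(1) by (auto simp: S_def D_def)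
  have Snorm: "frobenius_norm g \<le> A * B" if g: "g \<in> S" for g
  proof -
    obtain \<gamma> \<xi> where gx: "\<gamma> \<in> D" "\<xi> \<in> \<Xi>" "g = \<gamma> ** \<xi>" using g by (auto simp: S_def)
    have "frobenius_norm g \<le> frobenius_norm \<gamma> * frobenius_norm \<xi>" unfolding gx(3) by (rule frobenius_norm_mult)
    also have "\<dots> \<le> A * B"
      using A gx \<Xi>(2)[OF gx(2)] by (intro mult_mono) (auto simp: D_def intro: less_imp_le)
    finally show ?thesis .
  qed
  have "(\<Sum>p\<in>F. cmod (es (pt p))) \<le> (\<Sum>(\<gamma>, \<xi>)\<in>D \<times> \<Xi>. cmod (H (row (\<gamma> ** \<xi>))))"
  proof -
    have "(\<Sum>p\<in>F. cmod (es (pt p))) = cmod (complex_of_real (\<Sum>p\<in>F. cmod (es (pt p))))"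
      unfolding norm_of_real by (simp add: sum_nonneg)
    also have "\<dots> = cmod (\<Sum>(\<gamma>, \<xi>)\<in>D \<times> \<Xi>. H (row (\<gamma> ** \<xi>)))" unfolding total ..
    also have "\<dots> \<le> (\<Sum>(\<gamma>, \<xi>)\<in>D \<times> \<Xi>. cmod (H (row (\<gamma> ** \<xi>))))"
      unfolding case_prod_unfold by (rule norm_sum)
    finally show ?thesis .
  qed
  \<comment> \<open>Pairs are grouped by their product. In one fibre the first factor determines the
    pair, so its size is at most \<open>rep_count\<close>.\<close>
  also have "\<dots> = (\<Sum>g\<in>S. \<Sum>gx\<in>{gx \<in> D \<times> \<Xi>. (case gx of (\<gamma>, \<xi>) \<Rightarrow> \<gamma> ** \<xi>) = g}. (case gx of (\<gamma>, \<xi>) \<Rightarrow> cmod (H (row (\<gamma> ** \<xi>)))))"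
    unfolding S_def using D fin\<Xi> by (intro sum.image_gen) simp
  also have "\<dots> = (\<Sum>g\<in>S. real (card {gx \<in> D \<times> \<Xi>. (case gx of (\<gamma>, \<xi>) \<Rightarrow> \<gamma> ** \<xi>) = g}) * cmod (H (row g)))"
  proof (rule sum.cong[OF refl])
    fix g
    have "(\<Sum>gx\<in>{gx \<in> D \<times> \<Xi>. (case gx of (\<gamma>, \<xi>) \<Rightarrow> \<gamma> ** \<xi>) = g}. (case gx of (\<gamma>, \<xi>) \<Rightarrow> cmod (H (row (\<gamma> ** \<xi>)))))
       = (\<Sum>gx\<in>{gx \<in> D \<times> \<Xi>. (case gx of (\<gamma>, \<xi>) \<Rightarrow> \<gamma> ** \<xi>) = g}. cmod (H (row g)))"
      by (rule sum.cong) auto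
    then show "(\<Sum>gx\<in>{gx \<in> D \<times> \<Xi>. (case gx of (\<gamma>, \<xi>) \<Rightarrow> \<gamma> ** \<xi>) = g}. (case gx of (\<gamma>, \<xi>) \<Rightarrow> cmod (H (row (\<gamma> ** \<xi>)))))
       = real (card {gx \<in> D \<times> \<Xi>. (case gx of (\<gamma>, \<xi>) \<Rightarrow> \<gamma> ** \<xi>) = g}) * cmod (H (row g))" by simp
  qed
  also have "\<dots> \<le> (\<Sum>g\<in>S. real (rep_count A B g) * cmod (H (row g)))"
  proof (intro sum_mono mult_right_mono of_nat_mono)
    fix g
    have "inj_on fst {gx \<in> D \<times> \<Xi>. (case gx of (\<gamma>, \<xi>) \<Rightarrow> \<gamma> ** \<xi>) = g}"
    proof (rule inj_onI)
      fix p r assume p: "p \<in> {gx \<in> D \<times> \<Xi>. (case gx of (\<gamma>, \<xi>) \<Rightarrow> \<gamma> ** \<xi>) = g}"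
        and r: "r \<in> {gx \<in> D \<times> \<Xi>. (case gx of (\<gamma>, \<xi>) \<Rightarrow> \<gamma> ** \<xi>) = g}" and e: "fst p = fst r"
      have d: "det (fst p) = 1" using p det_G by (auto simp: D_def)
      have "fst p ** snd p = fst p ** snd r" using p r e by auto
      then have "snd p = snd r" using adj_mult_cancel(1)[OF d] by metis
      then show "p = r" using e by (simp add: prod_eq_iff)
    qed
    moreover have "fst ` {gx \<in> D \<times> \<Xi>. (case gx of (\<gamma>, \<xi>) \<Rightarrow> \<gamma> ** \<xi>) = g} \<subseteq> {c \<in> G. frobenius_norm c < A \<and> frobenius_norm (adj c ** g) < B}"
    proof (rule image_subsetI)
      fix p assume p: "p \<in> {gx \<in> D \<times> \<Xi>. (case gx of (\<gamma>, \<xi>) \<Rightarrow> \<gamma> ** \<xi>) = g}"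
      then have "fst p \<in> G" "frobenius_norm (fst p) < A" "snd p \<in> \<Xi>" "g = fst p ** snd p" by (auto simp: D_def)
      then show "fst p \<in> {c \<in> G. frobenius_norm c < A \<and> frobenius_norm (adj c ** g) < B}"
        using \<Xi>(2) by (simp add: adj_mult_cancel(1) det_G)
    qed
    moreover have "finite {c \<in> G. frobenius_norm c < A \<and> frobenius_norm (adj c ** g) < B}"
      by (rule finite_subset[OF _ finite_ball[of A]]) auto
    ultimately show "card {gx \<in> D \<times> \<Xi>. (case gx of (\<gamma>, \<xi>) \<Rightarrow> \<gamma> ** \<xi>) = g} \<le> rep_count A B g"
      unfolding rep_count_def by (rule card_inj_on_le)
  qed simp
  finally have "(\<Sum>p\<in>F. cmod (es (pt p)))\<^sup>2 \<le> (\<Sum>g\<in>S. real (rep_count A B g) * cmod (H (row g)))\<^sup>2"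
    by (intro power_mono sum_nonneg) auto
  also have "\<dots> \<le> (\<Sum>g\<in>S. (real (rep_count A B g))\<^sup>2) * (\<Sum>g\<in>S. (cmod (H (row g)))\<^sup>2)"
    by (rule Cauchy_Schwarz_ineq_sum)
  also have "(\<Sum>g\<in>S. (cmod (H (row g)))\<^sup>2) \<le> 1024 * (real M)\<^sup>2 * real (card (near_pairs Y Q \<beta> M))"
  proof -
    define R where "R = {- int M..int M}"
    have "row ` S \<subseteq> R \<times> R"
    proof (rule image_subsetI)
      fix g assume g: "g \<in> S"
      have "\<bar>real_of_int ((v v* g) $ j)\<bar> \<le> real M" for j
      proof -
        have "\<bar>real_of_int ((v v* g) $ j)\<bar> \<le> (\<bar>real_of_int (v$1)\<bar> + \<bar>real_of_int (v$2)\<bar>) * frobenius_norm g"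
          by (rule abs_row_vec_le)
        also have "\<dots> \<le> (\<bar>real_of_int (v$1)\<bar> + \<bar>real_of_int (v$2)\<bar>) * (A * B)"
          using Snorm[OF g] by (intro mult_left_mono) auto
        finally show ?thesis using MB by (simp add: A_def)
      qed
      then have "\<bar>(v v* g) $ j\<bar> \<le> int M" for j by (metis of_int_abs of_int_le_iff of_int_of_nat_eq)
      then show "row g \<in> R \<times> R" by (simp add: row_def R_def abs_le_iff minus_le_iff)
    qed
    have "(\<Sum>g\<in>S. (cmod (H (row g)))\<^sup>2) = (\<Sum>x\<in>row ` S. (cmod (H x))\<^sup>2)"
      by (simp add: sum.reindex[OF inj_on_subset[OF inj_row S(2)]])
    also have "\<dots> \<le> (\<Sum>x\<in>R \<times> R. (cmod (H x))\<^sup>2)"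
      by (rule sum_mono2) (use \<open>row ` S \<subseteq> R \<times> R\<close> in \<open>auto simp: R_def\<close>)
    also have "\<dots> = (\<Sum>x\<in>R. \<Sum>y\<in>R. (cmod (H (x, y)))\<^sup>2)" by (simp add: sum.cartesian_product case_prod_unfold)
    also have "\<dots> \<le> 1024 * (real M)\<^sup>2 * real (card {(k, l) \<in> W \<times> W.
        (\<exists>n::int. \<bar>\<phi> k - \<phi> l - n\<bar> \<le> 1 / M) \<and> (\<exists>n::int. \<bar>\<psi> k - \<psi> l - n\<bar> \<le> 1 / M)})"
      unfolding H_def R_def fst_conv snd_conv by (rule large_sieve[OF W \<zeta> M])
    also have "{(k, l) \<in> W \<times> W.
        (\<exists>n::int. \<bar>\<phi> k - \<phi> l - n\<bar> \<le> 1 / M) \<and> (\<exists>n::int. \<bar>\<psi> k - \<psi> l - n\<bar> \<le> 1 / M)} = near_pairs Y Q \<beta> M"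
      by (auto simp: near_pairs_def W_def F_def \<phi>_def \<psi>_def pt_def)
    finally show ?thesis .
  qed
  finally have main: "(\<Sum>p\<in>F. cmod (es (pt p)))\<^sup>2 \<le> (\<Sum>g\<in>S. (real (rep_count A B g))\<^sup>2) * (1024 * (real M)\<^sup>2 * real (card (near_pairs Y Q \<beta> M)))"
    by (simp add: mult_left_mono sum_nonneg)
  have "(\<Sum>\<theta>\<in>points Q \<beta>. cmod (es \<theta>)) \<le> (\<Sum>\<theta>\<in>pt ` F. cmod (es \<theta>))"
    using points_subset_farey[OF Q, of \<beta>] F by (intro sum_mono2) (auto simp: pt_def[abs_def] F_def case_prod_unfold)
  also have "\<dots> \<le> (\<Sum>p\<in>F. cmod (es (pt p)))"
    using sum_image_le[OF F, of "\<lambda>\<theta>. cmod (es \<theta>)" pt] by (simp add: o_def)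
  finally have "(\<Sum>\<theta>\<in>points Q \<beta>. cmod (es \<theta>))\<^sup>2 \<le> (\<Sum>p\<in>F. cmod (es (pt p)))\<^sup>2"
    by (intro power_mono sum_nonneg) auto
  then show ?thesis using main S unfolding A_def Y_def es_def col_def[abs_def] by (intro exI[of _ S]) simp
qed

text \<open>To be read with e = N^\<eta>, h = N^(1/2), g = N^\<sigma>, V the number of vectors y,
  and t t2 = N^(2s). One factor V is bounded by \<open>e * t\<close>, from the growth of the group,
  and joins the second moment in \<open>P\<close>; the other is bounded by \<open>e * w\<close>,
  from the integer points in a box. The condition g^2 \<le> h, a consequence of \<sigma> < 1/4,
  brings every term to one of the three final shapes; 23 is 18 + 1 + 4.\<close>

lemma final_estimate:
  fixes e h g Q V t t2 m0 \<G> P E :: real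
  assumes e: "1 \<le> e" and h: "1 \<le> h" and g: "1 \<le> g" "g\<^sup>2 \<le> h" and Q: "0 < Q" "Q < h"
    and V: "0 \<le> V" "V \<le> e * t" "V \<le> e * (h\<^sup>2 / g\<^sup>2)" and m0: "m0 \<le> Q\<^sup>2 / (h * g) + 4"
    and G: "0 \<le> \<G>" "\<G> \<le> e\<^sup>2 * (Q\<^sup>2 / g\<^sup>2)"
    and E: "E \<le> 2 * V * (2 * m0 + 1) * Q\<^sup>2 + V\<^sup>2 * e * Q + (V\<^sup>2 * e\<^sup>2 + 4 * V * Q * e) * \<G>" "0 \<le> E"
    and P: "P \<le> e\<^sup>2 * t2 * (h\<^sup>2 * g\<^sup>2)" and t: "0 \<le> t" "0 \<le> t2"
  shows "P * E \<le> e ^ 8 * (t * t2) * h ^ 4 * (23 * (Q + Q\<^sup>2 / g\<^sup>2 + Q ^ 4 / (h\<^sup>2 * g)))"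
proof -
  define w where "w = h\<^sup>2 / g\<^sup>2"
  define X where "X = 4 * (Q^4 / (h * g)) + 18 * Q\<^sup>2 + w * Q + w * (Q\<^sup>2 / g\<^sup>2) + 4 * (Q ^ 3 / g\<^sup>2)"
  have w: "0 \<le> w" using h g by (simp add: w_def)
  have X: "0 \<le> X" unfolding X_def using w Q h g by (intro add_nonneg_nonneg) auto
  have ek: "e ^ k \<le> e ^ 5" if "k \<le> 5" for k using e that by (intro power_increasing) auto
  have E1: "E \<le> V * (2 * (2 * m0 + 1) * Q\<^sup>2 + V * e * Q + (V * e\<^sup>2 + 4 * Q * e) * \<G>)"
    using E(1) by (simp add: power2_eq_square algebra_simps)
  also have "2 * (2 * m0 + 1) * Q\<^sup>2 + V * e * Q + (V * e\<^sup>2 + 4 * Q * e) * \<G>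
     \<le> 2 * (2 * (Q\<^sup>2 / (h * g) + 4) + 1) * Q\<^sup>2 + (e * w) * e * Q + ((e * w) * e\<^sup>2 + 4 * Q * e) * (e\<^sup>2 * (Q\<^sup>2 / g\<^sup>2))"
    using m0 V G Q e w unfolding w_def by (intro add_mono mult_mono mult_right_mono mult_left_mono) auto
  also have "\<dots> = e ^ 0 * (4 * (Q^4 / (h * g)) + 18 * Q\<^sup>2) + e ^ 2 * (w * Q) + e ^ 5 * (w * (Q\<^sup>2 / g\<^sup>2)) + e ^ 3 * (4 * (Q ^ 3 / g\<^sup>2))"
    by (simp add: algebra_simps power2_eq_square power3_eq_cube power4_eq_xxxx eval_nat_numeral)
  also have "\<dots> \<le> e ^ 5 * (4 * (Q^4 / (h * g)) + 18 * Q\<^sup>2) + e ^ 5 * (w * Q) + e ^ 5 * (w * (Q\<^sup>2 / g\<^sup>2)) + e ^ 5 * (4 * (Q ^ 3 / g\<^sup>2))"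
    using w Q h g by (intro add_mono mult_right_mono ek) auto
  also have "\<dots> = e ^ 5 * X" by (simp add: X_def algebra_simps)
  finally have "E \<le> V * (e ^ 5 * X)" using V(1) by (simp add: mult_left_mono)
  also have "\<dots> \<le> (e * t) * (e ^ 5 * X)" using V X e by (intro mult_right_mono) auto
  finally have E2: "E \<le> e ^ 6 * t * X" by (simp add: eval_nat_numeral mult_ac)
  have "P * E \<le> (e\<^sup>2 * t2 * (h\<^sup>2 * g\<^sup>2)) * (e ^ 6 * t * X)"
    using P E2 E(2) e t X by (intro mult_mono) auto
  also have "\<dots> = e ^ 8 * (t * t2) * (h\<^sup>2 * g\<^sup>2 * X)"
    by (simp add: eval_nat_numeral mult_ac)
  also have "h\<^sup>2 * g\<^sup>2 * X \<le> h ^ 4 * (23 * (Q + Q\<^sup>2 / g\<^sup>2 + Q ^ 4 / (h\<^sup>2 * g)))"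
  proof -
    have h0: "h > 0" and g0: "g > 0" using h g by auto
    have "h\<^sup>2 * g\<^sup>2 * X = 4 * Q^4 * (h * g) + 18 * h\<^sup>2 * (Q * (Q * g\<^sup>2)) + h ^ 4 * Q + h ^ 4 * (Q\<^sup>2 / g\<^sup>2) + 4 * h\<^sup>2 * (Q * Q\<^sup>2)"
      using h0 g0 by (simp add: X_def w_def field_simps eval_nat_numeral)
    also have "\<dots> \<le> 4 * Q^4 * (h\<^sup>2 / g) + 18 * h\<^sup>2 * (Q * (h * h)) + h ^ 4 * Q + h ^ 4 * (Q\<^sup>2 / g\<^sup>2) + 4 * h\<^sup>2 * (Q * h\<^sup>2)"
    proof (intro add_mono mult_left_mono)
      have "(h * g) * g \<le> h\<^sup>2" using g h0 by (simp add: power2_eq_square mult.assoc)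
      then show "h * g \<le> h\<^sup>2 / g" using g0 by (simp add: pos_le_divide_eq)
      show "Q * g\<^sup>2 \<le> h * h" using Q g h0 by (intro mult_mono) auto
      show "Q\<^sup>2 \<le> h\<^sup>2" using Q by (intro power_mono) auto
    qed (use Q h0 in auto)
    also have "\<dots> = h ^ 4 * (23 * Q + Q\<^sup>2 / g\<^sup>2 + 4 * (Q ^ 4 / (h\<^sup>2 * g)))"
      using h0 g0 by (simp add: field_simps eval_nat_numeral)
    also have "\<dots> \<le> h ^ 4 * (23 * (Q + Q\<^sup>2 / g\<^sup>2 + Q ^ 4 / (h\<^sup>2 * g)))"
    proof -
      have le: "23 * Q + x + 4 * y \<le> 23 * (Q + x + y)" if "0 \<le> x" "0 \<le> y" for x y using that by simp
      show ?thesis by (rule mult_left_mono[OF le]) (use Q h0 g0 in auto)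
    qed
    finally show ?thesis .
  qed
  then have "e ^ 8 * (t * t2) * (h\<^sup>2 * g\<^sup>2 * X) \<le> e ^ 8 * (t * t2) * (h ^ 4 * (23 * (Q + Q\<^sup>2 / g\<^sup>2 + Q ^ 4 / (h\<^sup>2 * g))))"
    using e t by (intro mult_left_mono) auto
  finally show ?thesis by (simp only: mult.assoc)
qed

lemma card_integer_box:
  fixes Y :: "(int \<times> int) set" and Y0 :: real
  assumes Y0: "1 \<le> Y0" and Y: "\<And>y. y \<in> Y \<Longrightarrow> \<bar>real_of_int (fst y)\<bar> \<le> Y0 \<and> \<bar>real_of_int (snd y)\<bar> \<le> Y0"
  shows "real (card Y) \<le> 9 * Y0\<^sup>2"
proof -
  define I where "I = {-\<lfloor>Y0\<rfloor>..\<lfloor>Y0\<rfloor>}"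
  have "Y \<subseteq> I \<times> I"
  proof
    fix y assume "y \<in> Y"
    then have "\<bar>real_of_int (fst y)\<bar> \<le> Y0" "\<bar>real_of_int (snd y)\<bar> \<le> Y0" using Y by auto
    then have "\<bar>fst y\<bar> \<le> \<lfloor>Y0\<rfloor>" "\<bar>snd y\<bar> \<le> \<lfloor>Y0\<rfloor>" by (simp_all add: le_floor_iff)
    then have "fst y \<in> I" "snd y \<in> I" unfolding I_def by auto
    then show "y \<in> I \<times> I" by (metis mem_Times_iff)
  qed
  then have "card Y \<le> card (I \<times> I)" by (rule card_mono[rotated]) (simp add: I_def)
  then have "real (card Y) \<le> real (card I) * real (card I)" by (simp add: card_cartesian_product flip: of_nat_mult)
  also have "real (card I) = 2 * real_of_int \<lfloor>Y0\<rfloor> + 1" using Y0 by (simp add: I_def)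
  also have "\<dots> * \<dots> \<le> (3 * Y0) * (3 * Y0)"
  proof -
    have "real_of_int \<lfloor>Y0\<rfloor> \<le> Y0" by simp
    then have f: "2 * real_of_int \<lfloor>Y0\<rfloor> + 1 \<le> 3 * Y0" using Y0 by linarith
    show ?thesis by (rule mult_mono[OF f f]) (use Y0 in auto)
  qed
  finally show ?thesis by (simp add: power2_eq_square)
qed

section \<open>Choice of the parameters for large N\<close>

context nonparabolic_group begin

text \<open>Constants, logarithms and divisor counts are each absorbed by a factor N^\<eta>; eight
  of these occur, two from the moment and sieve factors and six from the pair count.\<close>

lemma exp_sum_bound:
  fixes v w :: "int^2" and s \<eta> \<sigma> :: real
  assumes v: "primitive v" and w: "primitive w" and s: "0 < s" and dim: "hausdorff_dim (limit_set G) < ereal s"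
    and \<sigma>: "0 < \<sigma>" "\<sigma> < 1/4" and \<eta>: "0 < \<eta>"
  shows "\<forall>\<^sub>F N in at_top. \<forall>\<Xi> \<Omega>. \<Xi> \<subseteq> G \<longrightarrow> (\<forall>\<xi>\<in>\<Xi>. frobenius_norm \<xi> < N powr (1/2)) \<longrightarrow>
      \<Omega> \<subseteq> G \<longrightarrow> (\<forall>\<omega>\<in>\<Omega>. frobenius_norm \<omega> < N powr (1/2 - \<sigma>)) \<longrightarrow>
      (\<forall>Q \<beta>. 0 < Q \<longrightarrow> Q < N powr (1/2) \<longrightarrow> \<bar>\<beta>\<bar> < 2 / (Q * N powr (1/2)) \<longrightarrow>
        (\<Sum>\<theta>\<in>points Q \<beta>. cmod (exp_sum G v w \<sigma> \<Xi> \<Omega> N \<theta>))\<^sup>2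
          \<le> 23 * N powr (8 * \<eta> + 2 * s + 2) * (Q + Q\<^sup>2 * N powr (- 2 * \<sigma>) + Q ^ 4 * N powr (- \<sigma> - 1)))"
proof -
  obtain A0 where A0: "A0 \<ge> 0" "\<forall>T>0. real (ball_count T) \<le> A0 * T powr (2 * s)"
    using ball_count_bound[OF dim] by blast
  obtain K1 where K1: "K1 \<ge> 0" "\<forall>A\<ge>1. \<forall>B\<ge>1. \<forall>S. finite S \<longrightarrow> S \<subseteq> G \<longrightarrow>
     (\<Sum>g\<in>S. (real (rep_count A B g))\<^sup>2) \<le> K1 * (A * B) powr (2 * s) * (log 2 (A * B) + 1)"
    using sum_rep_count_sq_bound[OF dim s] by (elim exE conjE)
  have "\<eta> / 2 > 0" using \<eta> by simp
  from card_divisors_bound[OF this] obtain Cd where Cd: "Cd \<ge> 1"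
    "\<forall>n::nat. n > 0 \<longrightarrow> real (card {d. d dvd n}) \<le> Cd * real n powr (\<eta> / 2)" by (elim exE conjE)
  define cv where "cv = \<bar>real_of_int (v$1)\<bar> + \<bar>real_of_int (v$2)\<bar>"
  define cw where "cw = \<bar>real_of_int (w$1)\<bar> + \<bar>real_of_int (w$2)\<bar>"
  have cv: "1 \<le> cv" using primitive_nonzero[OF v] unfolding cv_def by linarith
  have cw: "1 \<le> cw" using primitive_nonzero[OF w] unfolding cw_def by linarith
  \<comment> \<open>\<open>cz\<close> bounds Z / (Q / g): 1 comes from the sieve resolution 1 / M
    and \<open>4 * cw\<close> from the shift \<beta>. Then \<open>cD * N\<close> bounds the wedge
    products whose divisors are counted.\<close>
  define cz where "cz = 1 + 4 * cw"
  have cz: "cz > 0" using cw by (simp add: cz_def)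
  define cD where "cD = 2 * cw * (cw + cz)"
  have cD: "cD > 0" using cw cz by (simp add: cD_def)
  have const: "\<forall>\<^sub>F N in at_top. c \<le> N powr \<eta>" for c using \<eta> by real_asymp
  have F1: "\<forall>\<^sub>F N in at_top. (1::real) \<le> N" by (rule eventually_ge_at_top)
  have F2: "\<forall>\<^sub>F N in at_top. Cd * (cD * N) powr (\<eta> / 2) \<le> N powr \<eta>" using \<eta> cD Cd(1) by real_asymp
  have F3: "\<forall>\<^sub>F N in at_top. 1 + ln (1 + cz * N powr (1/2)) \<le> N powr \<eta>" using \<eta> cz by real_asymp
  have F4: "\<forall>\<^sub>F N in at_top. log 2 (N powr \<sigma> * N powr (1/2)) + 1 \<le> N powr \<eta>" using \<eta> \<sigma>(1) by real_asymp
  \<comment> \<open>All thresholds for N are collected before the sets, Q and \<beta> are fixed, so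
    the estimate is uniform in them.\<close>
  define large where "large N \<longleftrightarrow> 1 \<le> N \<and> Cd * (cD * N) powr (\<eta> / 2) \<le> N powr \<eta> \<and>
     1 + ln (1 + cz * N powr (1/2)) \<le> N powr \<eta> \<and> log 2 (N powr \<sigma> * N powr (1/2)) + 1 \<le> N powr \<eta> \<and>
     A0 \<le> N powr \<eta> \<and> 9 * cw\<^sup>2 \<le> N powr \<eta> \<and> 9 * cz\<^sup>2 \<le> N powr \<eta> \<and> K1 * (1024 * (2 * cv)\<^sup>2) \<le> N powr \<eta>"
    for N :: real
  have "\<forall>\<^sub>F N in at_top. large N"
    unfolding large_def by (intro eventually_conj F1 F2 F3 F4 const)
  then show ?thesis
  proof (rule eventually_mono, intro allI impI)
    fix N \<Xi> \<Omega> Q \<beta>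
    assume lrg: "large N" and \<Xi>: "\<Xi> \<subseteq> G" "\<forall>\<xi>\<in>\<Xi>. frobenius_norm \<xi> < N powr (1/2)"
      and \<Omega>: "\<Omega> \<subseteq> G" "\<forall>\<omega>\<in>\<Omega>. frobenius_norm \<omega> < N powr (1/2 - \<sigma>)"
      and Q: "0 < Q" "Q < N powr (1/2)" and \<beta>: "\<bar>\<beta>\<bar> < 2 / (Q * N powr (1/2))"
    from lrg have N1: "1 \<le> N" and N2: "Cd * (cD * N) powr (\<eta> / 2) \<le> N powr \<eta>"
      and N3: "1 + ln (1 + cz * N powr (1/2)) \<le> N powr \<eta>" and N4: "log 2 (N powr \<sigma> * N powr (1/2)) + 1 \<le> N powr \<eta>"
      and N5: "A0 \<le> N powr \<eta>" "9 * cw\<^sup>2 \<le> N powr \<eta>" "9 * cz\<^sup>2 \<le> N powr \<eta>" "K1 * (1024 * (2 * cv)\<^sup>2) \<le> N powr \<eta>"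
      unfolding large_def by blast+
    define e where "e = N powr \<eta>"
    define h where "h = N powr (1/2)"
    define g where "g = N powr \<sigma>"
    define t where "t = N powr ((1 - 2 * \<sigma>) * s)"
    define t2 where "t2 = N powr ((1 + 2 * \<sigma>) * s)"
    have e: "1 \<le> e" using N1 \<eta> by (simp add: e_def ge_one_powr_ge_zero)
    have h: "1 \<le> h" using N1 by (simp add: h_def ge_one_powr_ge_zero)
    have g: "1 \<le> g" using N1 \<sigma> by (simp add: g_def ge_one_powr_ge_zero)
    have hh: "h\<^sup>2 = N" using N1 by (simp add: h_def power2_eq_square flip: powr_add)
    have g2: "g\<^sup>2 = N powr (2 * \<sigma>)" by (simp add: g_def power2_eq_square flip: powr_add)
    have gh: "g\<^sup>2 \<le> h" unfolding g2 h_def using N1 \<sigma> by (intro powr_mono) auto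
    have Th: "N powr (1/2 - \<sigma>) = h / g" by (simp add: h_def g_def powr_diff)
    have Qh: "0 < Q" "Q < h" using Q by (simp_all add: h_def)
    have h0: "0 < h" and g0: "0 < g" using h g by auto
    have \<beta>h: "\<bar>\<beta>\<bar> \<le> 2 / (Q * h)" using \<beta> by (simp add: h_def)
    define Y where "Y = (\<lambda>\<omega>. ((\<omega> *v w)$1, (\<omega> *v w)$2)) ` \<Omega>"
    have fin\<Omega>: "finite \<Omega>"
      by (rule finite_subset[OF _ finite_frobenius_norm_less[of "N powr (1/2 - \<sigma>)"]]) (use \<Omega> in auto)
    define Y0 where "Y0 = cw * (h / g)"
    have hg: "1 \<le> h / g"
    proof -
      have "g \<le> g\<^sup>2" using g by (simp add: self_le_power)
      then show ?thesis using gh g0 by (simp add: pos_le_divide_eq)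
    qed
    have Y0: "1 \<le> Y0" using mult_mono[OF cw hg] cw by (simp add: Y0_def)
    have bdY: "\<bar>real_of_int (fst y)\<bar> \<le> Y0 \<and> \<bar>real_of_int (snd y)\<bar> \<le> Y0" if y: "y \<in> Y" for y
    proof -
      obtain \<omega> where \<omega>: "\<omega> \<in> \<Omega>" "y = ((\<omega> *v w)$1, (\<omega> *v w)$2)" using y by (auto simp: Y_def)
      have "\<bar>real_of_int ((\<omega> *v w)$i)\<bar> \<le> Y0" for i
      proof -
        have "\<bar>real_of_int ((\<omega> *v w)$i)\<bar> \<le> cw * frobenius_norm \<omega>" unfolding cw_def by (rule abs_col_vec_le)
        also have "\<dots> \<le> Y0" unfolding Y0_def Th[symmetric] using \<Omega>(2) \<omega>(1) cw by (intro mult_left_mono) (auto intro: less_imp_le)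
        finally show ?thesis .
      qed
      then show ?thesis by (simp add: \<omega>(2))
    qed
    have coY: "coprime (fst y) (snd y)" if "y \<in> Y" for y
      using that primitive_col_vec[OF det_G w] \<Omega>(1) by (auto simp: Y_def)
    have finY: "finite Y" using fin\<Omega> by (simp add: Y_def)
    define V where "V = real (card Y)"
    have V1: "V \<le> e * t"
    proof -
      have "card Y \<le> card \<Omega>" unfolding Y_def by (rule card_image_le[OF fin\<Omega>])
      also have "\<dots> \<le> ball_count (N powr (1/2 - \<sigma>))"
        unfolding ball_count_def using \<Omega> by (intro card_mono finite_ball) auto
      finally have "V \<le> A0 * (N powr (1/2 - \<sigma>)) powr (2 * s)"
        using A0(2)[rule_format, of "N powr (1/2 - \<sigma>)"] N1 unfolding V_def by (smt (verit) of_nat_mono powr_gt_zero)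
      also have "(N powr (1/2 - \<sigma>)) powr (2 * s) = t" by (simp add: t_def powr_powr algebra_simps)
      also have "A0 * t \<le> e * t" using N5 by (intro mult_right_mono) (auto simp: e_def t_def)
      finally show ?thesis .
    qed
    have V2: "V \<le> e * (h\<^sup>2 / g\<^sup>2)"
    proof -
      have "V \<le> 9 * Y0\<^sup>2" unfolding V_def by (rule card_integer_box[OF Y0 bdY])
      also have "\<dots> = (9 * cw\<^sup>2) * (h\<^sup>2 / g\<^sup>2)" by (simp add: Y0_def power_mult_distrib power_divide)
      also have "\<dots> \<le> e * (h\<^sup>2 / g\<^sup>2)" using N5 by (intro mult_right_mono) (auto simp: e_def)
      finally show ?thesis .
    qed
    \<comment> \<open>The side of the box containing all vectors v g; as its lower bound is at least
      1, rounding up at most doubles it.\<close>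
    define M where "M = nat \<lceil>cv * (g * h)\<rceil>"
    have gh1: "1 \<le> g * h" using mult_mono[OF g h] g by simp
    have cgh: "1 \<le> cv * (g * h)" using mult_mono[OF cv gh1] cv by simp
    have M: "cv * (g * h) \<le> real M" "real M \<le> 2 * cv * (g * h)" "M \<ge> 1"
      using cgh unfolding M_def by linarith+
    have Mgh: "h * g \<le> real M" using M(1) mult_right_mono[OF cv, of "g * h"] gh1 by (simp add: mult.commute)
    have invM: "1 / real M \<le> 1 / (h * g)" using Mgh h0 g0 M(3) by (intro divide_left_mono) auto
    define Z where "Z = Q\<^sup>2 * (1 / real M + 2 * \<bar>\<beta>\<bar> * Y0)"
    define m0 where "m0 = Q\<^sup>2 * (1 / real M + 2 * \<bar>\<beta>\<bar>)"
    have m0: "m0 \<le> Q\<^sup>2 / (h * g) + 4"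
    proof -
      have "m0 \<le> Q\<^sup>2 * (1 / (h * g) + 2 * (2 / (Q * h)))"
        unfolding m0_def using invM \<beta>h by (intro mult_left_mono add_mono) auto
      also have "\<dots> = Q\<^sup>2 / (h * g) + 4 * (Q / h)" using Qh h0 by (simp add: field_simps power2_eq_square)
      also have "Q / h \<le> 1" using Qh h0 by simp
      finally show ?thesis by simp
    qed
    have Z0: "0 \<le> Z" unfolding Z_def using Y0 by (intro mult_nonneg_nonneg add_nonneg_nonneg) auto
    have Zle: "Z \<le> cz * (Q / g)"
    proof -
      have "Z \<le> Q\<^sup>2 * (1 / (h * g) + 2 * (2 / (Q * h)) * Y0)"
        unfolding Z_def using invM \<beta>h Y0 by (intro mult_left_mono add_mono mult_right_mono) auto
      also have "\<dots> = (Q / g) * (Q / h) + 4 * cw * (Q / g)"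
        using Qh h0 g0 by (simp add: Y0_def field_simps power2_eq_square)
      also have "\<dots> \<le> (Q / g) * 1 + 4 * cw * (Q / g)"
        using Qh h0 g0 by (intro add_right_mono mult_left_mono) auto
      also have "\<dots> = cz * (Q / g)" by (simp add: cz_def algebra_simps)
      finally show ?thesis .
    qed
    have Zh: "Z \<le> cz * h"
    proof -
      have "Q / g \<le> Q / 1" using Qh g by (intro divide_left_mono) auto
      then have "cz * (Q / g) \<le> cz * h" using Qh cz by (intro mult_left_mono) auto
      then show ?thesis using Zle by linarith
    qed
    have div: "real (card (pos_divisors u)) \<le> e"
      if u: "u \<noteq> 0" "\<bar>real_of_int u\<bar> \<le> 2 * Y0 * (Y0 + Q\<^sup>2 * (1 / real M + 2 * \<bar>\<beta>\<bar> * Y0))" for u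
    proof -
      have "Y0 \<le> cw * h" unfolding Y0_def using g h0 cw by (intro mult_left_mono) (auto simp: pos_divide_le_eq)
      then have "2 * Y0 * (Y0 + Z) \<le> 2 * (cw * h) * (cw * h + cz * h)"
        using Zh Y0 Z0 cw h0 by (intro mult_mono add_mono) auto
      also have "\<dots> = cD * h\<^sup>2" by (simp add: cD_def power2_eq_square algebra_simps)
      finally have uN: "\<bar>real_of_int u\<bar> \<le> cD * N" using u(2) unfolding Z_def hh by linarith
      have "real (card (pos_divisors u)) \<le> real (card {d. d dvd nat \<bar>u\<bar>})"
        using card_pos_divisors[OF u(1)] by simp
      also have "\<dots> \<le> Cd * real (nat \<bar>u\<bar>) powr (\<eta> / 2)" by (rule Cd(2)[rule_format]) (use u(1) in simp)
      also have "\<dots> \<le> Cd * (cD * N) powr (\<eta> / 2)"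
        using uN Cd(1) \<eta> by (intro mult_left_mono powr_mono2) auto
      also have "\<dots> \<le> e" using N2 by (simp add: e_def)
      finally show ?thesis .
    qed
    define \<G> where "\<G> = 9 * Z\<^sup>2 * (1 + ln (1 + Z))"
    have G0: "0 \<le> \<G>" unfolding \<G>_def using Z0 by simp
    have G1: "\<G> \<le> e\<^sup>2 * (Q\<^sup>2 / g\<^sup>2)"
    proof -
      have "Z\<^sup>2 \<le> (cz * (Q / g))\<^sup>2" using Zle Z0 by (intro power_mono)
      moreover have "1 + ln (1 + Z) \<le> e"
      proof -
        have "ln (1 + Z) \<le> ln (1 + cz * h)" using Zh Z0 by (intro ln_mono) auto
        then show ?thesis using N3 by (simp add: e_def h_def)
      qed
      ultimately have "\<G> \<le> 9 * (cz * (Q / g))\<^sup>2 * e" unfolding \<G>_def using Z0 by (intro mult_mono) auto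
      also have "\<dots> = (9 * cz\<^sup>2) * e * (Q\<^sup>2 / g\<^sup>2)" by (simp add: power_mult_distrib power_divide)
      also have "\<dots> \<le> e * e * (Q\<^sup>2 / g\<^sup>2)" using N5 e by (intro mult_right_mono) (auto simp: e_def)
      finally show ?thesis by (simp add: power2_eq_square)
    qed
    define E where "E = real (card (near_pairs Y Q \<beta> M))"
    have E: "E \<le> 2 * V * (2 * m0 + 1) * Q\<^sup>2 + V\<^sup>2 * e * Q + (V\<^sup>2 * e\<^sup>2 + 4 * V * Q * e) * \<G>"
      unfolding E_def V_def \<G>_def m0_def Z_def
      by (rule near_pairs_bound[OF finY coY bdY Qh(1) _ _ _ div]) (use M(3) Y0 e in auto)
    have norm\<Xi>: "frobenius_norm \<xi> < N powr (1/2)" if "\<xi> \<in> \<Xi>" for \<xi> using \<Xi>(2) that by blast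
    have MB: "(\<bar>real_of_int (v$1)\<bar> + \<bar>real_of_int (v$2)\<bar>) * (N powr \<sigma> * N powr (1/2)) \<le> real M"
      using M(1) by (simp only: cv_def g_def h_def)
    have "\<exists>S. finite S \<and> S \<subseteq> G \<and> (\<Sum>\<theta>\<in>points Q \<beta>. cmod (exp_sum G v w \<sigma> \<Xi> \<Omega> N \<theta>))\<^sup>2
       \<le> (\<Sum>x\<in>S. (real (rep_count (N powr \<sigma>) (N powr (1/2)) x))\<^sup>2) * (1024 * (real M)\<^sup>2 * E)"
      unfolding E_def Y_def by (rule exp_sum_sq_bound[OF v w Qh(1) M(3) \<Xi>(1) _ \<Omega>(1) fin\<Omega> MB]) (rule norm\<Xi>)
    then obtain S where S: "finite S" "S \<subseteq> G"
      and CS: "(\<Sum>\<theta>\<in>points Q \<beta>. cmod (exp_sum G v w \<sigma> \<Xi> \<Omega> N \<theta>))\<^sup>2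
       \<le> (\<Sum>x\<in>S. (real (rep_count (N powr \<sigma>) (N powr (1/2)) x))\<^sup>2) * (1024 * (real M)\<^sup>2 * E)"
      by (elim exE conjE)
    have R: "(\<Sum>x\<in>S. (real (rep_count (N powr \<sigma>) (N powr (1/2)) x))\<^sup>2) \<le> K1 * t2 * e"
    proof -
      have "(\<Sum>x\<in>S. (real (rep_count g h x))\<^sup>2) \<le> K1 * (g * h) powr (2 * s) * (log 2 (g * h) + 1)"
        using K1(2) S g h by blast
      also have "(g * h) powr (2 * s) = t2"
        unfolding g_def h_def powr_add[symmetric] by (simp add: t2_def powr_powr algebra_simps)
      also have "K1 * t2 * (log 2 (g * h) + 1) \<le> K1 * t2 * e"
        using N4 K1(1) by (intro mult_left_mono) (auto simp: g_def h_def e_def t2_def)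
      finally show ?thesis by (simp only: g_def h_def)
    qed
    have P: "(K1 * t2 * e) * (1024 * (real M)\<^sup>2) \<le> e\<^sup>2 * t2 * (h\<^sup>2 * g\<^sup>2)"
    proof -
      have "(real M)\<^sup>2 \<le> (2 * cv * (g * h))\<^sup>2" using M(2) by (intro power_mono) auto
      then have "(K1 * t2 * e) * (1024 * (real M)\<^sup>2) \<le> (K1 * t2 * e) * (1024 * (2 * cv * (g * h))\<^sup>2)"
        using K1(1) e by (intro mult_left_mono) (auto simp: t2_def)
      also have "\<dots> = (K1 * (1024 * (2 * cv)\<^sup>2)) * (e * t2 * (h\<^sup>2 * g\<^sup>2))"
        by (simp add: power_mult_distrib mult_ac)
      also have "\<dots> \<le> e * (e * t2 * (h\<^sup>2 * g\<^sup>2))"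
        using N5(4) e by (intro mult_right_mono) (auto simp: e_def t2_def)
      finally show ?thesis by (simp add: power2_eq_square mult_ac)
    qed
    have E0: "0 \<le> E" by (simp add: E_def)
    have "(\<Sum>\<theta>\<in>points Q \<beta>. cmod (exp_sum G v w \<sigma> \<Xi> \<Omega> N \<theta>))\<^sup>2 \<le> (K1 * t2 * e) * (1024 * (real M)\<^sup>2 * E)"
      using CS mult_right_mono[OF R, of "1024 * (real M)\<^sup>2 * E"] E0 by simp
    also have "\<dots> = ((K1 * t2 * e) * (1024 * (real M)\<^sup>2)) * E" by simp
    also have "\<dots> \<le> e ^ 8 * (t * t2) * h ^ 4 * (23 * (Q + Q\<^sup>2 / g\<^sup>2 + Q ^ 4 / (h\<^sup>2 * g)))"
      by (rule final_estimate[OF e h g gh Qh _ V1 V2 m0 G0 G1 E E0 P]) (simp_all add: V_def t_def t2_def)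
    also have "e ^ 8 * (t * t2) * h ^ 4 = N powr (8 * \<eta> + 2 * s + 2)"
    proof -
      have "e ^ 8 = N powr (8 * \<eta>)"
        unfolding e_def using N1 by (simp add: powr_powr mult.commute flip: powr_realpow)
      moreover have "t * t2 = N powr (2 * s)" by (simp add: t_def t2_def algebra_simps flip: powr_add)
      moreover have "h ^ 4 = N powr 2"
      proof -
        have "h ^ 4 = (h\<^sup>2)\<^sup>2" by simp
        also have "\<dots> = N powr 2" unfolding hh using N1 by (simp add: powr_numeral)
        finally show ?thesis .
      qed
      ultimately show ?thesis by (simp add: powr_add)
    qed
    also have "Q\<^sup>2 / g\<^sup>2 = Q\<^sup>2 * N powr (- 2 * \<sigma>)" by (simp add: g2 powr_minus divide_inverse)
    also have "Q ^ 4 / (h\<^sup>2 * g) = Q ^ 4 * N powr (- \<sigma> - 1)"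
      using N1 by (simp add: hh g_def powr_diff powr_minus divide_inverse mult_ac)
    finally show "(\<Sum>\<theta>\<in>points Q \<beta>. cmod (exp_sum G v w \<sigma> \<Xi> \<Omega> N \<theta>))\<^sup>2
          \<le> 23 * N powr (8 * \<eta> + 2 * s + 2) * (Q + Q\<^sup>2 * N powr (- 2 * \<sigma>) + Q ^ 4 * N powr (- \<sigma> - 1))"
      by (simp only: mult_ac)
  qed
qed

end

theorem theorem6p1:
  fixes \<Gamma> X :: "(int^2^2) set" and v\<^sub>0 w\<^sub>0 :: "int^2" and \<delta> \<sigma> c\<^sub>1 c\<^sub>2 \<epsilon> :: real
  assumes "finite X" and "free_generating_set SL2Z \<Gamma> X"
    and "\<forall>g\<in>\<Gamma>. \<not> parabolic g"
    and "hausdorff_dim (limit_set \<Gamma>) = ereal \<delta>" and "\<delta> > 5 / 6"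
    and "primitive v\<^sub>0" and "primitive w\<^sub>0"
    and "0 < \<sigma>" and "\<sigma> < 1 / 4"
    and "c\<^sub>1 > 0" and "c\<^sub>2 > 0" and "\<epsilon> > 0"
  shows "\<exists>C::real. \<forall>\<^sub>F N::real in at_top.
    \<forall>(\<Xi> :: (int^2^2) set) (\<Omega> :: (int^2^2) set) l l'.
      \<Xi> \<subseteq> \<Gamma> \<and>
      (\<forall>\<xi>\<in>\<Xi>. frobenius_norm \<xi> < N powr (1/2) \<and> (\<exists>u. reduced_word SL2Z X \<xi> = u @ [l])) \<and>
      real (card \<Xi>) \<ge> c\<^sub>1 * N powr \<delta> \<and>
      \<Omega> \<subseteq> \<Gamma> \<and>
      (\<forall>\<omega>\<in>\<Omega>. frobenius_norm \<omega> < N powr (1/2 - \<sigma>) \<and> (\<exists>u. reduced_word SL2Z X \<omega> = l' # u)) \<and>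
      l' \<noteq> inv_letter l \<and>
      real (card \<Omega>) \<ge> c\<^sub>2 * N powr (\<delta> * (1 - 2 * \<sigma>)) \<longrightarrow>
      (\<forall>Q \<beta> :: real. 0 < Q \<and> Q < N powr (1/2) \<and> \<bar>\<beta>\<bar> < 2 / (Q * N powr (1/2)) \<longrightarrow>
        (\<Sum>\<theta>\<in>points Q \<beta>. cmod (exp_sum \<Gamma> v\<^sub>0 w\<^sub>0 \<sigma> \<Xi> \<Omega> N \<theta>))
          \<le> C * N powr (\<delta> + 1 + \<epsilon>) * Q *
              (Q powr (- 1/2) + N powr (- \<sigma>) + N powr (- \<sigma>/2 - 1/2) * Q))"
proof -
  interpret nonparabolic_group \<Gamma> X
    using assms(1-3) by unfold_locales (auto simp: free_generating_set_def SL2Z_def)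
  \<comment> \<open>The excess of s contributes \<epsilon> to the exponent of the squared bound and
    the eight factors N^\<eta> contribute another \<epsilon>, which makes \<epsilon> after taking
    the root.\<close>
  define s where "s = \<delta> + \<epsilon> / 2"
  define \<eta> where "\<eta> = \<epsilon> / 8"
  have s: "0 < s" and \<eta>: "0 < \<eta>" and exponent: "8 * \<eta> + 2 * s + 2 = 2 * (\<delta> + 1 + \<epsilon>)"
    using assms(5,12) by (simp_all add: s_def \<eta>_def)
  have dim: "hausdorff_dim (limit_set \<Gamma>) < ereal s" using assms(4,12) by (simp add: s_def)
  have "\<forall>\<^sub>F N::real in at_top. 1 \<le> N" by (rule eventually_ge_at_top)
  with exp_sum_bound[OF assms(6,7) s dim assms(8,9) \<eta>]
  show ?thesis
  proof (intro exI[of _ 5], eventually_elim, intro allI impI, elim conjE)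
    fix N :: real and \<Xi> \<Omega> :: "(int^2^2) set" and Q \<beta> :: real and l l'
    assume bound: "\<forall>\<Xi> \<Omega>. \<Xi> \<subseteq> \<Gamma> \<longrightarrow> (\<forall>\<xi>\<in>\<Xi>. frobenius_norm \<xi> < N powr (1/2)) \<longrightarrow>
      \<Omega> \<subseteq> \<Gamma> \<longrightarrow> (\<forall>\<omega>\<in>\<Omega>. frobenius_norm \<omega> < N powr (1/2 - \<sigma>)) \<longrightarrow>
      (\<forall>Q \<beta>. 0 < Q \<longrightarrow> Q < N powr (1/2) \<longrightarrow> \<bar>\<beta>\<bar> < 2 / (Q * N powr (1/2)) \<longrightarrow>
        (\<Sum>\<theta>\<in>points Q \<beta>. cmod (exp_sum \<Gamma> v\<^sub>0 w\<^sub>0 \<sigma> \<Xi> \<Omega> N \<theta>))\<^sup>2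
          \<le> 23 * N powr (8 * \<eta> + 2 * s + 2) * (Q + Q\<^sup>2 * N powr (- 2 * \<sigma>) + Q ^ 4 * N powr (- \<sigma> - 1)))"
      and N: "1 \<le> N" and Q: "0 < Q" "Q < N powr (1/2)" "\<bar>\<beta>\<bar> < 2 / (Q * N powr (1/2))"
      and \<Xi>: "\<Xi> \<subseteq> \<Gamma>" "\<forall>\<xi>\<in>\<Xi>. frobenius_norm \<xi> < N powr (1/2) \<and> (\<exists>u. reduced_word SL2Z X \<xi> = u @ [l])"
      and \<Omega>: "\<Omega> \<subseteq> \<Gamma>" "\<forall>\<omega>\<in>\<Omega>. frobenius_norm \<omega> < N powr (1/2 - \<sigma>) \<and> (\<exists>u. reduced_word SL2Z X \<omega> = l' # u)"
    define a b c where abc: "a = Q powr (- 1/2)" "b = N powr (- \<sigma>)" "c = N powr (- \<sigma>/2 - 1/2) * Q"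
    have nn: "0 \<le> a" "0 \<le> b" "0 \<le> c" using Q by (simp_all add: abc)
    have "(\<Sum>\<theta>\<in>points Q \<beta>. cmod (exp_sum \<Gamma> v\<^sub>0 w\<^sub>0 \<sigma> \<Xi> \<Omega> N \<theta>))\<^sup>2
          \<le> 23 * N powr (2 * (\<delta> + 1 + \<epsilon>)) * (Q + Q\<^sup>2 * N powr (- 2 * \<sigma>) + Q ^ 4 * N powr (- \<sigma> - 1))"
      by (rule bound[unfolded exponent, rule_format]) (use \<Xi> \<Omega> Q in auto)
    also have "N powr (2 * (\<delta> + 1 + \<epsilon>)) = (N powr (\<delta> + 1 + \<epsilon>))\<^sup>2"
      by (simp only: power2_eq_square powr_add[symmetric] mult_2)
    also have "Q + Q\<^sup>2 * N powr (- 2 * \<sigma>) + Q ^ 4 * N powr (- \<sigma> - 1) = Q\<^sup>2 * (a\<^sup>2 + b\<^sup>2 + c\<^sup>2)"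
    proof -
      have sq: "(x powr y)\<^sup>2 = x powr (2 * y)" for x y :: real
        by (simp only: power2_eq_square powr_add[symmetric] mult_2)
      have "a\<^sup>2 = 1 / Q" using Q unfolding abc sq by (simp add: powr_neg_one)
      moreover have "b\<^sup>2 = N powr (- 2 * \<sigma>)" unfolding abc sq by simp
      moreover have "c\<^sup>2 = N powr (- \<sigma> - 1) * Q\<^sup>2"
        unfolding abc power_mult_distrib sq by (simp add: algebra_simps)
      ultimately show ?thesis using Q by (simp add: field_simps eval_nat_numeral)
    qed
    \<comment> \<open>A sum of squares of nonnegative numbers is at most the square of their sum,
      and 23 is raised to the square 25, which gives the constant 5.\<close>
    also have "23 * (N powr (\<delta> + 1 + \<epsilon>))\<^sup>2 * (Q\<^sup>2 * (a\<^sup>2 + b\<^sup>2 + c\<^sup>2)) \<le> 25 * (N powr (\<delta> + 1 + \<epsilon>))\<^sup>2 * (Q\<^sup>2 * (a + b + c)\<^sup>2)"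
    proof (intro mult_mono mult_left_mono)
      have "(a + b + c)\<^sup>2 = a\<^sup>2 + b\<^sup>2 + c\<^sup>2 + 2 * (a * b + b * c + a * c)" by (simp add: power2_eq_square algebra_simps)
      then show "a\<^sup>2 + b\<^sup>2 + c\<^sup>2 \<le> (a + b + c)\<^sup>2" using nn by simp
    qed auto
    also have "\<dots> = (5 * N powr (\<delta> + 1 + \<epsilon>) * Q * (a + b + c))\<^sup>2"
      by (simp add: power_mult_distrib)
    finally show "(\<Sum>\<theta>\<in>points Q \<beta>. cmod (exp_sum \<Gamma> v\<^sub>0 w\<^sub>0 \<sigma> \<Xi> \<Omega> N \<theta>))
          \<le> 5 * N powr (\<delta> + 1 + \<epsilon>) * Q * (Q powr (- 1/2) + N powr (- \<sigma>) + N powr (- \<sigma>/2 - 1/2) * Q)"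
      unfolding abc by (rule power2_le_imp_le) (use Q in auto)
  qed
qed

end
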